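(* Fix $\varepsilon>0$. Let $K\subseteq[N]$, $k=|K|$, let $A\in\mathbb{R}^{m\times N}$ be a Gaussian matrix and $b=A\mathbb{1}_K$. If $$m\ge \Delta_{\mathrm{bin}}(k)+\sqrt{8\log(4/\varepsilon)N},$$ where $$\Delta_{\mathrm{bin}}(k)=\inf_{\tau\ge 0}\Big[k\int_{-\infty}^{\tau}(u-\tau)^2\phi(u)\,du+(N-k)\int_{\tau}^{\infty}(u-\tau)^2\phi(u)\,du\Big],\qquad \phi(u)=(2\pi)^{-1/2}e^{-u^2/2},$$ then with probability larger than $1-\varepsilon$, $\mathbb{1}_K$ is the unique solution of $(P_{\mathrm{bin}})$.
   Context: $[N]=\{1,\dots,N\}$; $\mathbb{1}_K$ is the vector with entries $1$ on $K$ and $0$ elsewhere. A Gaussian matrix is $A=m^{-1/2}[a_{ij}]$ with $a_{ij}$ i.i.d. standard normal. $(P_{\mathrm{bin}})$ is the program $\min\|x\|_1$ subject to $Ax=b$ and $x\in[0,1]^N$; "unique solution" means unique minimizer. $\log$ is the natural logarithm. *)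

theory Defs
  imports "HOL-Probability.Probability"
begin

definition std_gauss :: "real measure" where
  "std_gauss = density lborel std_normal_density"

(* Law of the raw entries a_ij (i in {0..<m} rows, j in [N] = {1..N} columns),
   i.i.d. standard normal. The Gaussian matrix is A = m^(-1/2) [a_ij]. *)
definition gauss_entries :: "nat \<Rightarrow> nat \<Rightarrow> (nat \<times> nat \<Rightarrow> real) measure" where
  "gauss_entries m N = PiM ({..<m} \<times> {1..N}) (\<lambda>_. std_gauss)"

definition gauss_matrix :: "nat \<Rightarrow> (nat \<times> nat \<Rightarrow> real) \<Rightarrow> (nat \<times> nat \<Rightarrow> real)" where
  "gauss_matrix m a = (\<lambda>ij. a ij / sqrt (real m))"

definition ind_vec :: "nat set \<Rightarrow> nat \<Rightarrow> real" where
  "ind_vec K = (\<lambda>i. if i \<in> K then 1 else 0)"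

definition is_vec :: "nat \<Rightarrow> (nat \<Rightarrow> real) \<Rightarrow> bool" where
  "is_vec N x \<longleftrightarrow> (\<forall>i. i \<notin> {1..N} \<longrightarrow> x i = 0)"

definition mat_vec :: "nat \<Rightarrow> nat \<Rightarrow> (nat \<times> nat \<Rightarrow> real) \<Rightarrow> (nat \<Rightarrow> real) \<Rightarrow> (nat \<Rightarrow> real)" where
  "mat_vec m N A x = (\<lambda>i. if i < m then (\<Sum>j=1..N. A (i, j) * x j) else 0)"

definition l1norm :: "nat \<Rightarrow> (nat \<Rightarrow> real) \<Rightarrow> real" where
  "l1norm N x = (\<Sum>i=1..N. \<bar>x i\<bar>)"

definition Pbin_feasible :: "nat \<Rightarrow> nat \<Rightarrow> (nat \<times> nat \<Rightarrow> real) \<Rightarrow> (nat \<Rightarrow> real) \<Rightarrow> (nat \<Rightarrow> real) \<Rightarrow> bool" where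
  "Pbin_feasible m N A b x \<longleftrightarrow> is_vec N x \<and> mat_vec m N A x = b \<and> (\<forall>i\<in>{1..N}. 0 \<le> x i \<and> x i \<le> 1)"

definition Pbin_unique_solution :: "nat \<Rightarrow> nat \<Rightarrow> (nat \<times> nat \<Rightarrow> real) \<Rightarrow> (nat \<Rightarrow> real) \<Rightarrow> (nat \<Rightarrow> real) \<Rightarrow> bool" where
  "Pbin_unique_solution m N A b x0 \<longleftrightarrow> Pbin_feasible m N A b x0 \<and>
     (\<forall>x. Pbin_feasible m N A b x \<and> x \<noteq> x0 \<longrightarrow> l1norm N x0 < l1norm N x)"

definition Delta_bin :: "nat \<Rightarrow> nat \<Rightarrow> real" where
  "Delta_bin N k = (INF \<tau>\<in>{0::real..}.
      real k * (LINT u:{..\<tau>}|lborel. (u - \<tau>)\<^sup>2 * std_normal_density u)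
    + real (N - k) * (LINT u:{\<tau>..}|lborel. (u - \<tau>)\<^sup>2 * std_normal_density u))"

end

theory Submission
  imports Defs "HOL-Real_Asymp.Real_Asymp"
begin

text \<open>Recovery fails exactly when the kernel of the Gaussian matrix \<open>a\<close> meets the set of unit vectors \<open>x\<close> with
  \<open>x \<le> 0\<close> on \<open>K\<close>, \<open>x \<ge> 0\<close> off \<open>K\<close> and \<open>\<Sum> x \<le> 0\<close>. Gordon's comparison, applied to exponential functionals,
  gives for every \<open>lam > 0\<close> the bound
  \<open>exp (lam\<^sup>2 / 2) * P(failure) \<le> E exp (- lam * |h|) * E exp (lam * sup (- g \<bullet> x))\<close> with independent standard Gaussian
  vectors \<open>h\<close> in \<open>m\<close>-space and \<open>g\<close> in \<open>N\<close>-space. For each \<open>\<tau> \<ge> 0\<close> the supremum is at most the square root of a sum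
  of independent truncated squares whose mean is the objective in \<open>Delta_bin\<close>, and both factors obey the sharp
  sub-Gaussian bounds, so that \<open>P(failure) \<le> exp (lam\<^sup>2 / 2 - lam * (sqrt (m - 1) - sqrt \<Delta>))\<close>. For \<open>m \<le> N\<close> take
  \<open>lam = sqrt m - sqrt \<Delta>\<close>. For \<open>m > N\<close> this is too weak for tiny \<open>\<epsilon>\<close>, but then the kernel is
  almost surely trivial.\<close>

subsection \<open>Standard Gaussian measures\<close>

text \<open>Comparing exponential functionals rather than expectations yields a tail bound directly.
  The obstacle is that Gaussian interpolation asks for bounded functions with bounded second
  derivatives, while the supremum of the exponentials is not smooth and, with a Gaussian scalar in
  the exponent, not bounded. Three layers of smoothing bridge this: the norm becomes
  \<open>sqrt (\<eta>\<^sup>2 + ...)\<close>; the supremum over a finite set becomes the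
  \<open>p\<close>-th power of a sum \<open>S\<close> of exponentials with rate
  \<open>lam / p\<close>; and the power is a mixture of the functions
  \<open>1 - exp (- u * S)\<close>. Letting \<open>p\<close> and \<open>\<eta>\<close> tend to 0
  recovers the supremum. Constants: put \<open>s = sqrt m - sqrt \<Delta>\<close>. For
  \<open>m \<le> N\<close>, \<open>m - \<Delta> = s * (sqrt m + sqrt \<Delta>) \<le> s * (2 * sqrt
  N)\<close>, so the assumed excess forces \<open>s\<^sup>2 / 2 \<ge> ln (4 / \<epsilon>)\<close>;
  this is the origin of \<open>8\<close> and \<open>N\<close> under the root. The norm bound reaches
  \<open>sqrt (m - 1)\<close> instead of \<open>sqrt m\<close>; that costs at most 1 in the
  exponent, and the resulting factor \<open>exp 1\<close> is absorbed by the 4.\<close>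

abbreviation gaussian :: "'i set \<Rightarrow> ('i \<Rightarrow> real) measure" where
  "gaussian L \<equiv> PiM L (\<lambda>_. std_gauss)"

abbreviation gauss_pdf :: "real \<Rightarrow> real" where
  "gauss_pdf \<equiv> std_normal_density"

abbreviation matrix_law :: "nat \<Rightarrow> nat \<Rightarrow> (nat \<times> nat \<Rightarrow> real) measure" where
  "matrix_law m N \<equiv> gaussian ({..<m} \<times> {1..N})"

abbreviation array_law :: "nat \<Rightarrow> nat \<Rightarrow> (nat \<times> nat \<Rightarrow> real) measure" where
  "array_law m N \<equiv> gaussian ({..m} \<times> {..N})"

abbreviation row_dot :: "nat \<Rightarrow> (nat \<Rightarrow> real) \<Rightarrow> (nat \<times> nat \<Rightarrow> real) \<Rightarrow> nat \<Rightarrow> real" where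
  "row_dot N x a i \<equiv> \<Sum>j=1..N. x j * a (i, j)"

abbreviation image_norm :: "nat \<Rightarrow> nat \<Rightarrow> (nat \<Rightarrow> real) \<Rightarrow> (nat \<times> nat \<Rightarrow> real) \<Rightarrow> real" where
  "image_norm m N x a \<equiv> sqrt (\<Sum>i<m. (row_dot N x a i)\<^sup>2)"

abbreviation column_norm :: "nat \<Rightarrow> (nat \<times> nat \<Rightarrow> real) \<Rightarrow> real" where
  "column_norm m h \<equiv> sqrt (\<Sum>i<m. (h (i, 0))\<^sup>2)"

abbreviation vec_norm :: "'i set \<Rightarrow> ('i \<Rightarrow> real) \<Rightarrow> real" where
  "vec_norm A z \<equiv> sqrt (\<Sum>i\<in>A. (z i)\<^sup>2)"

lemma sets_std_gauss [simp, measurable_cong]: "sets std_gauss = sets borel"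
  by (simp add: std_gauss_def)

lemma space_std_gauss [simp]: "space std_gauss = UNIV"
  by (simp add: std_gauss_def)

lemma prob_space_std_gauss: "prob_space std_gauss"
  by (simp add: std_gauss_def prob_space_normal_density)

interpretation std_gauss: real_distribution std_gauss
  by (simp add: real_distribution_def real_distribution_axioms_def prob_space_std_gauss)

interpretation gaussian: product_sigma_finite "\<lambda>_. std_gauss"
  by unfold_locales

lemma prob_space_gaussian: "prob_space (gaussian L)"
  by (rule prob_space_PiM) (rule prob_space_std_gauss)

lemma integral_std_gauss:
  "f \<in> borel_measurable borel \<Longrightarrow> (\<integral>x. f x \<partial>std_gauss) = (\<integral>x. gauss_pdf x * f x \<partial>lborel)"
  for f :: "real \<Rightarrow> real"
  unfolding std_gauss_def by (subst integral_density) auto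

lemma integrable_std_gauss:
  "f \<in> borel_measurable borel \<Longrightarrow> integrable std_gauss f \<longleftrightarrow> integrable lborel (\<lambda>x. gauss_pdf x * f x)"
  for f :: "real \<Rightarrow> real"
  unfolding std_gauss_def by (subst integrable_density) auto

lemma nn_integral_std_gauss:
  "f \<in> borel_measurable borel \<Longrightarrow>
    (\<integral>\<^sup>+x. f x \<partial>std_gauss) = (\<integral>\<^sup>+x. ennreal (gauss_pdf x) * f x \<partial>lborel)"
  unfolding std_gauss_def by (subst nn_integral_density) auto

lemma integrable_std_gauss_abs: "integrable std_gauss (\<lambda>x. \<bar>x\<bar>)"
  using integrable_std_normal_moment_abs[of 1] by (subst integrable_std_gauss) auto

section \<open>Gaussian integration by parts and interpolation\<close>

lemma norm_mult_le_abs: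
  fixes a b C :: real
  assumes "\<bar>b\<bar> \<le> C"
  shows "\<bar>a * b\<bar> \<le> \<bar>C * \<bar>a\<bar>\<bar>"
proof -
  have "\<bar>a\<bar> * \<bar>b\<bar> \<le> \<bar>a\<bar> * \<bar>C\<bar>"
    using assms by (intro mult_left_mono) auto
  then show ?thesis by (simp add: abs_mult mult.commute)
qed

lemma DERIV_std_normal_density:
  "(gauss_pdf has_real_derivative - x * gauss_pdf x) (at x)"
  unfolding std_normal_density_def
  by (auto intro!: derivative_eq_intros simp: field_simps power2_eq_square)

lemma std_normal_density_at_top: "(gauss_pdf \<longlongrightarrow> 0) at_top"
  unfolding std_normal_density_def by real_asymp

lemma std_normal_density_at_bot: "(gauss_pdf \<longlongrightarrow> 0) at_bot"
  unfolding std_normal_density_def by real_asymp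

text \<open>Stein's identity. The derivative of \<open>gauss_pdf x * f x\<close> is
  \<open>gauss_pdf x * f' x - gauss_pdf x * (x * f x)\<close>; it integrates to 0 because
  \<open>f\<close> is bounded and the density vanishes at both ends.\<close>

lemma gaussian_integration_by_parts_1:
  fixes f f' :: "real \<Rightarrow> real"
  assumes deriv: "\<And>x. (f has_real_derivative f' x) (at x)" and cont: "\<And>x. isCont f' x"
    and bound: "\<And>x. \<bar>f x\<bar> \<le> C" "\<And>x. \<bar>f' x\<bar> \<le> C"
  shows "(\<integral>x. x * f x \<partial>std_gauss) = (\<integral>x. f' x \<partial>std_gauss)"
proof -
  have contf: "continuous_on UNIV f"
    using deriv by (intro DERIV_continuous_on) (auto intro: DERIV_subset)
  have [measurable]: "f \<in> borel_measurable borel"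
    by (rule borel_measurable_continuous_onI[OF contf])
  have [measurable]: "f' \<in> borel_measurable borel"
    using cont by (intro borel_measurable_continuous_onI continuous_at_imp_continuous_on) auto
  let ?p = gauss_pdf
  have i1: "integrable std_gauss (\<lambda>x. x * f x)"
    by (rule Bochner_Integration.integrable_bound[of _ "\<lambda>x. C * \<bar>x\<bar>"])
       (use bound in \<open>auto intro!: integrable_mult_right integrable_std_gauss_abs AE_I2 norm_mult_le_abs\<close>)
  have i2: "integrable std_gauss f'"
    by (rule std_gauss.integrable_const_bound[of _ C]) (use bound in auto)
  have D: "((\<lambda>x. ?p x * f x) has_real_derivative ?p x * f' x - ?p x * (x * f x)) (at x)" for x
    by (auto intro!: derivative_eq_intros DERIV_std_normal_density deriv simp: algebra_simps)
  have lim: "((\<lambda>x. ?p x * f x) \<longlongrightarrow> 0) F" if "(?p \<longlongrightarrow> 0) F" for F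
  proof (rule Lim_null_comparison)
    show "\<forall>\<^sub>F x in F. norm (?p x * f x) \<le> ?p x * C"
      by (intro always_eventually) (auto simp: abs_mult intro!: mult_left_mono bound)
    show "((\<lambda>x. ?p x * C) \<longlongrightarrow> 0) F"
      using tendsto_mult_right[OF that, of C] by simp
  qed
  have int: "integrable lborel (\<lambda>x. ?p x * f' x - ?p x * (x * f x))"
    using i1 i2 by (subst (asm) (1 2) integrable_std_gauss) auto
  have "(LBINT x=-\<infinity>..\<infinity>. ?p x * f' x - ?p x * (x * f x)) = 0 - 0"
  proof (rule interval_integral_FTC_integrable)
    show "((\<lambda>x. ?p x * f x) has_vector_derivative ?p x * f' x - ?p x * (x * f x)) (at x)" for x
      using D by (simp add: has_real_derivative_iff_has_vector_derivative)
    show "isCont (\<lambda>x. ?p x * f' x - ?p x * (x * f x)) x" for x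
      using cont DERIV_isCont[OF deriv] DERIV_isCont[OF DERIV_std_normal_density]
      by (intro continuous_intros) auto
    show "set_integrable lborel (einterval (-\<infinity>) \<infinity>) (\<lambda>x. ?p x * f' x - ?p x * (x * f x))"
      using int by (simp add: set_integrable_def)
    show "(((\<lambda>x. ?p x * f x) \<circ> real_of_ereal) \<longlongrightarrow> 0) (at_right (-\<infinity>))"
      unfolding comp_def by (rule filterlim_compose[OF lim[OF std_normal_density_at_bot]])
        (simp add: at_right_MInf filterlim_filtermap filterlim_ident)
    show "(((\<lambda>x. ?p x * f x) \<circ> real_of_ereal) \<longlongrightarrow> 0) (at_left \<infinity>)"
      unfolding comp_def by (rule filterlim_compose[OF lim[OF std_normal_density_at_top]])
        (simp add: at_left_PInf filterlim_filtermap filterlim_ident)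
  qed auto
  then have "(\<integral>x. ?p x * f' x - ?p x * (x * f x) \<partial>lborel) = 0"
    by (simp add: interval_lebesgue_integral_def set_lebesgue_integral_def)
  moreover have "integrable lborel (\<lambda>x. ?p x * f' x)" "integrable lborel (\<lambda>x. ?p x * (x * f x))"
    using i1 i2 by (subst (asm) (1 2) integrable_std_gauss; auto)+
  ultimately show ?thesis
    by (simp add: integral_std_gauss)
qed

lemma integrable_gaussian_component:
  assumes "l \<in> L"
  shows "integrable (gaussian L) (\<lambda>z. \<bar>z l\<bar>)"
proof -
  have "distr (gaussian L) std_gauss (\<lambda>z. z l) = std_gauss"
    using distr_PiM_component[of L "\<lambda>_. std_gauss" l] prob_space_std_gauss assms by simp
  then have "integrable (distr (gaussian L) std_gauss (\<lambda>z. z l)) (\<lambda>x. \<bar>x\<bar>)"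
    using integrable_std_gauss_abs by simp
  then show ?thesis
    using assms by (subst (asm) integrable_distr_eq) auto
qed

lemma integrable_bounded_gaussian:
  fixes F :: "('i \<Rightarrow> real) \<Rightarrow> real"
  assumes "F \<in> borel_measurable (gaussian L)" "\<And>z. \<bar>F z\<bar> \<le> C"
  shows "integrable (gaussian L) F"
proof -
  interpret prob_space "gaussian L" by (rule prob_space_gaussian)
  show ?thesis using assms by (intro integrable_const_bound[of _ C]) auto
qed

lemma integrable_component_mult_bounded:
  fixes F :: "('i \<Rightarrow> real) \<Rightarrow> real"
  assumes "l \<in> L" "F \<in> borel_measurable (gaussian L)" "\<And>z. \<bar>F z\<bar> \<le> C"
  shows "integrable (gaussian L) (\<lambda>z. z l * F z)"
  by (rule Bochner_Integration.integrable_bound[of _ "\<lambda>z. C * \<bar>z l\<bar>"])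
     (use assms in \<open>auto intro!: integrable_mult_right integrable_gaussian_component AE_I2 norm_mult_le_abs\<close>)

text \<open>Fubini: with all coordinates but \<open>l\<close> frozen, this is the one-dimensional
  identity.\<close>

lemma gaussian_integration_by_parts:
  fixes F F' :: "('i \<Rightarrow> real) \<Rightarrow> real"
  assumes L: "finite L" "l \<in> L"
    and meas: "F \<in> borel_measurable (gaussian L)" "F' \<in> borel_measurable (gaussian L)"
    and deriv: "\<And>z s. ((\<lambda>s. F (z(l := s))) has_real_derivative F' (z(l := s))) (at s)"
    and cont: "\<And>z s. isCont (\<lambda>s. F' (z(l := s))) s"
    and bound: "\<And>z. \<bar>F z\<bar> \<le> C" "\<And>z. \<bar>F' z\<bar> \<le> C"
  shows "(\<integral>z. z l * F z \<partial>gaussian L) = (\<integral>z. F' z \<partial>gaussian L)"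
proof -
  define L' where "L' = L - {l}"
  have L': "L = insert l L'" "finite L'" "l \<notin> L'"
    using L by (auto simp: L'_def)
  note int = integrable_component_mult_bounded[OF L(2) meas(1) bound(1)]
    integrable_bounded_gaussian[OF meas(2) bound(2)]
  have "(\<integral>z. z l * F z \<partial>gaussian L) = (\<integral>z. (\<integral>s. s * F (z(l := s)) \<partial>std_gauss) \<partial>gaussian L')"
    using gaussian.product_integral_insert[OF L'(2,3), of "\<lambda>z. z l * F z"] int(1) by (simp add: L'(1))
  also have "\<dots> = (\<integral>z. (\<integral>s. F' (z(l := s)) \<partial>std_gauss) \<partial>gaussian L')"
    by (intro Bochner_Integration.integral_cong refl gaussian_integration_by_parts_1[of _ _ C] deriv cont bound)
  also have "\<dots> = (\<integral>z. F' z \<partial>gaussian L)"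
    using gaussian.product_integral_insert[OF L'(2,3), of F'] int(2) by (simp add: L'(1))
  finally show ?thesis .
qed

text \<open>By the mean value theorem \<open>w\<close> dominates all difference quotients, so
  dominated convergence applies along every sequence of increments tending to 0.\<close>

lemma has_derivative_integral_dominated:
  fixes f f' :: "real \<Rightarrow> 'a \<Rightarrow> real"
  assumes int: "\<And>t. integrable M (f t)" and meas: "\<And>t. f' t \<in> borel_measurable M"
    and deriv: "\<And>t z. z \<in> space M \<Longrightarrow> ((\<lambda>t. f t z) has_real_derivative f' t z) (at t)"
    and bound: "\<And>t z. z \<in> space M \<Longrightarrow> \<bar>f' t z\<bar> \<le> w z" and w: "integrable M w"
  shows "((\<lambda>t. \<integral>z. f t z \<partial>M) has_real_derivative (\<integral>z. f' t z \<partial>M)) (at t)"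
  unfolding DERIV_def tendsto_at_iff_sequentially comp_def
proof (intro allI impI)
  fix X :: "nat \<Rightarrow> real" assume X: "\<forall>i. X i \<in> UNIV - {0}" and X0: "X \<longlonglongrightarrow> 0"
  have "(\<lambda>i. \<integral>z. (f (t + X i) z - f t z) / X i \<partial>M) \<longlonglongrightarrow> (\<integral>z. f' t z \<partial>M)"
  proof (rule integral_dominated_convergence[OF _ _ w])
    show "AE z in M. (\<lambda>i. (f (t + X i) z - f t z) / X i) \<longlonglongrightarrow> f' t z"
    proof (rule AE_I2)
      fix z assume "z \<in> space M"
      from deriv[OF this, of t] show "(\<lambda>i. (f (t + X i) z - f t z) / X i) \<longlonglongrightarrow> f' t z"
        unfolding DERIV_def tendsto_at_iff_sequentially comp_def using X X0 by auto
    qed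
    show "AE z in M. norm ((f (t + X i) z - f t z) / X i) \<le> w z" for i
    proof (rule AE_I2)
      fix z assume z: "z \<in> space M"
      have "norm (f (t + X i) z - f t z) \<le> w z * norm (t + X i - t)"
        by (rule field_differentiable_bound[of UNIV "\<lambda>t. f t z" "\<lambda>t. f' t z"])
           (use deriv[OF z] bound[OF z] in auto)
      then show "norm ((f (t + X i) z - f t z) / X i) \<le> w z"
        using X by (auto simp: field_simps)
    qed
  qed (use int meas in auto)
  moreover have "(\<integral>z. (f (t + X i) z - f t z) / X i \<partial>M) = ((\<integral>z. f (t + X i) z \<partial>M) - (\<integral>z. f t z \<partial>M)) / X i" for i
    using int by (simp only: Bochner_Integration.integral_diff integral_divide_zero)
  ultimately show "(\<lambda>i. ((\<integral>z. f (t + X i) z \<partial>M) - (\<integral>z. f t z \<partial>M)) / X i) \<longlonglongrightarrow> (\<integral>z. f' t z \<partial>M)"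
    by (simp only:)
qed

text \<open>Along \<open>cos t * a + sin t * b\<close> the derivative of the expectation is, by Gaussian integration by parts,
  \<open>sin t * cos t\<close> times the expectation of the expression in the last assumption.\<close>

lemma gaussian_interpolation:
  fixes q :: "('r \<Rightarrow> real) \<Rightarrow> real" and q1 :: "'r \<Rightarrow> ('r \<Rightarrow> real) \<Rightarrow> real"
    and q2 :: "'r \<Rightarrow> 'r \<Rightarrow> ('r \<Rightarrow> real) \<Rightarrow> real" and a b :: "'r \<Rightarrow> 'i \<Rightarrow> real"
  assumes fin: "finite L" "finite R"
    and deriv_q: "\<And>X X' s. (\<And>r. ((\<lambda>s. X s r) has_real_derivative X' r) (at s)) \<Longrightarrow>
        ((\<lambda>s. q (X s)) has_real_derivative (\<Sum>r\<in>R. q1 r (X s) * X' r)) (at s)"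
    and deriv_q1: "\<And>X X' s r. r \<in> R \<Longrightarrow> (\<And>r. ((\<lambda>s. X s r) has_real_derivative X' r) (at s)) \<Longrightarrow>
        ((\<lambda>s. q1 r (X s)) has_real_derivative (\<Sum>r'\<in>R. q2 r r' (X s) * X' r')) (at s)"
    and cont_q2: "\<And>X (s::real) r r'. r \<in> R \<Longrightarrow> r' \<in> R \<Longrightarrow> (\<And>r. isCont (\<lambda>s. X s r) s) \<Longrightarrow> isCont (\<lambda>s. q2 r r' (X s)) s"
    and bound: "\<And>x. \<bar>q x\<bar> \<le> C" "\<And>r x. r \<in> R \<Longrightarrow> \<bar>q1 r x\<bar> \<le> C"
      "\<And>r r' x. r \<in> R \<Longrightarrow> r' \<in> R \<Longrightarrow> \<bar>q2 r r' x\<bar> \<le> C"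
    and meas: "\<And>X. (\<And>r. (\<lambda>z. X z r) \<in> borel_measurable (gaussian L)) \<Longrightarrow> (\<lambda>z. q (X z)) \<in> borel_measurable (gaussian L)"
      "\<And>X r. r \<in> R \<Longrightarrow> (\<And>r. (\<lambda>z. X z r) \<in> borel_measurable (gaussian L)) \<Longrightarrow> (\<lambda>z. q1 r (X z)) \<in> borel_measurable (gaussian L)"
      "\<And>X r r'. r \<in> R \<Longrightarrow> r' \<in> R \<Longrightarrow> (\<And>r. (\<lambda>z. X z r) \<in> borel_measurable (gaussian L)) \<Longrightarrow> (\<lambda>z. q2 r r' (X z)) \<in> borel_measurable (gaussian L)"
    and orth: "\<And>r r'. (\<Sum>l\<in>L. a r l * b r' l) = 0"
    and sign: "\<And>x. (\<Sum>r\<in>R. \<Sum>r'\<in>R. (\<Sum>l\<in>L. b r l * b r' l - a r l * a r' l) * q2 r r' x) \<le> 0"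
  shows "(\<integral>z. q (\<lambda>r. \<Sum>l\<in>L. b r l * z l) \<partial>gaussian L) \<le> (\<integral>z. q (\<lambda>r. \<Sum>l\<in>L. a r l * z l) \<partial>gaussian L)"
proof -
  define c where "c t r l = cos t * a r l + sin t * b r l" for t r l
  define c' where "c' t r l = - sin t * a r l + cos t * b r l" for t r l
  define X where "X t z = (\<lambda>r. \<Sum>l\<in>L. c t r l * z l)" for t and z :: "'i \<Rightarrow> real"
  define Q where "Q t = (\<integral>z. q (X t z) \<partial>gaussian L)" for t
  define Q' where "Q' t = (\<integral>z. (\<Sum>r\<in>R. q1 r (X t z) * (\<Sum>l\<in>L. c' t r l * z l)) \<partial>gaussian L)" for t
  have C: "0 \<le> C" using bound(1)[of undefined] by linarith
  have comp [measurable]: "l \<in> L \<Longrightarrow> (\<lambda>z. z l) \<in> borel_measurable (gaussian L)" for l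
    using measurable_component_singleton[of l L "\<lambda>_. std_gauss"] by simp
  have Xmeas [measurable]: "(\<lambda>z. X t z r) \<in> borel_measurable (gaussian L)" for t r
    unfolding X_def by (intro borel_measurable_sum borel_measurable_times borel_measurable_const comp)
  have c'_bound: "\<bar>c' t r l\<bar> \<le> \<bar>a r l\<bar> + \<bar>b r l\<bar>" for t r l
  proof -
    have "\<bar>c' t r l\<bar> \<le> \<bar>sin t\<bar> * \<bar>a r l\<bar> + \<bar>cos t\<bar> * \<bar>b r l\<bar>"
      unfolding c'_def by (rule order_trans[OF abs_triangle_ineq]) (simp add: abs_mult)
    also have "\<dots> \<le> 1 * \<bar>a r l\<bar> + 1 * \<bar>b r l\<bar>"
      by (intro add_mono mult_right_mono) auto
    finally show ?thesis by simp
  qed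
  note m1 = meas(2)[OF _ Xmeas]
  note m2 = meas(3)[OF _ _ Xmeas]
  have DX: "((\<lambda>t. X t z r) has_real_derivative (\<Sum>l\<in>L. c' t r l * z l)) (at t)" for t z r
    unfolding X_def c_def c'_def by (auto intro!: derivative_eq_intros sum.cong simp: algebra_simps)
  have DQ: "(Q has_real_derivative Q' t) (at t)" for t
    unfolding Q_def Q'_def
  proof (rule has_derivative_integral_dominated)
    show "integrable (gaussian L) (\<lambda>z. q (X t z))" for t
      by (rule integrable_bounded_gaussian[OF _ bound(1)]) (rule meas(1)[OF Xmeas])
    show "(\<lambda>z. \<Sum>r\<in>R. q1 r (X t z) * (\<Sum>l\<in>L. c' t r l * z l)) \<in> borel_measurable (gaussian L)" for t
      by (intro borel_measurable_sum borel_measurable_times m1 comp) auto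
    show "((\<lambda>t. q (X t z)) has_real_derivative (\<Sum>r\<in>R. q1 r (X t z) * (\<Sum>l\<in>L. c' t r l * z l))) (at t)" for t z
      by (rule deriv_q[where X = "\<lambda>t. X t z"]) (rule DX)
    show "\<bar>\<Sum>r\<in>R. q1 r (X t z) * (\<Sum>l\<in>L. c' t r l * z l)\<bar> \<le> (\<Sum>r\<in>R. C * (\<Sum>l\<in>L. (\<bar>a r l\<bar> + \<bar>b r l\<bar>) * \<bar>z l\<bar>))" for t z
      by (intro order_trans[OF sum_abs] sum_mono)
         (auto simp: abs_mult intro!: mult_mono bound C order_trans[OF sum_abs] sum_mono c'_bound)
    show "integrable (gaussian L) (\<lambda>z. \<Sum>r\<in>R. C * (\<Sum>l\<in>L. (\<bar>a r l\<bar> + \<bar>b r l\<bar>) * \<bar>z l\<bar>))"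
      by (intro Bochner_Integration.integrable_sum integrable_mult_right integrable_gaussian_component)
  qed
  \<comment> \<open>The terms in \<open>(sin t)\<^sup>2\<close> and \<open>(cos t)\<^sup>2\<close>
    pair \<open>a\<close> with \<open>b\<close> and vanish by \<open>orth\<close>, that is, by
    independence of the two families. Only the difference of the two covariances survives.\<close>
  have gram: "(\<Sum>l\<in>L. c' t r l * c t r' l) = sin t * cos t * (\<Sum>l\<in>L. b r l * b r' l - a r l * a r' l)" for t r r'
  proof -
    have "(\<Sum>l\<in>L. c' t r l * c t r' l) = sin t * cos t * (\<Sum>l\<in>L. b r l * b r' l - a r l * a r' l)
        - (sin t)\<^sup>2 * (\<Sum>l\<in>L. a r l * b r' l) + (cos t)\<^sup>2 * (\<Sum>l\<in>L. a r' l * b r l)"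
      unfolding c_def c'_def sum_distrib_left sum_subtractf[symmetric] sum.distrib[symmetric]
      by (intro sum.cong) (auto simp: algebra_simps power2_eq_square)
    then show ?thesis by (simp add: orth)
  qed
  have ibp: "(\<integral>z. z l * q1 r (X t z) \<partial>gaussian L) = (\<integral>z. (\<Sum>r'\<in>R. q2 r r' (X t z) * c t r' l) \<partial>gaussian L)"
    if r: "r \<in> R" and l: "l \<in> L" for r l t
  proof (rule gaussian_integration_by_parts[OF fin(1) l, where C = "C + (\<Sum>r'\<in>R. C * \<bar>c t r' l\<bar>)"])
    have DX: "((\<lambda>s. X t (z(l := s)) r') has_real_derivative c t r' l) (at s)" for z s r'
    proof -
      have "X t (z(l := s)) r' = c t r' l * s + (\<Sum>l'\<in>L - {l}. c t r' l' * z l')" for s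
        unfolding X_def using fin(1) l by (subst sum.remove[of _ l]) (auto intro!: sum.cong)
      then show ?thesis by (auto intro!: derivative_eq_intros)
    qed
    show "((\<lambda>s. q1 r (X t (z(l := s)))) has_real_derivative (\<Sum>r'\<in>R. q2 r r' (X t (z(l := s))) * c t r' l)) (at s)" for z s
      by (rule deriv_q1[OF r, where X = "\<lambda>s. X t (z(l := s))"]) (rule DX)
    show "isCont (\<lambda>s. \<Sum>r'\<in>R. q2 r r' (X t (z(l := s))) * c t r' l) s" for z s
      by (intro continuous_intros isCont_sum cont_q2[OF r, where X = "\<lambda>s. X t (z(l := s))"] DERIV_isCont[OF DX]) auto
    have "0 \<le> (\<Sum>r'\<in>R. C * \<bar>c t r' l\<bar>)" using C by (intro sum_nonneg) auto
    then show "\<bar>q1 r (X t z)\<bar> \<le> C + (\<Sum>r'\<in>R. C * \<bar>c t r' l\<bar>)" for z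
      using bound(2)[OF r, of "X t z"] by linarith
    have "\<bar>\<Sum>r'\<in>R. q2 r r' (X t z) * c t r' l\<bar> \<le> (\<Sum>r'\<in>R. C * \<bar>c t r' l\<bar>)" for z
      by (intro order_trans[OF sum_abs] sum_mono) (auto simp: abs_mult intro!: mult_mono bound r C)
    from add_increasing[OF C this]
    show "\<bar>\<Sum>r'\<in>R. q2 r r' (X t z) * c t r' l\<bar> \<le> C + (\<Sum>r'\<in>R. C * \<bar>c t r' l\<bar>)" for z .
    show "(\<lambda>z. \<Sum>r'\<in>R. q2 r r' (X t z) * c t r' l) \<in> borel_measurable (gaussian L)"
      by (intro borel_measurable_sum borel_measurable_times m2 r) auto
  qed (rule m1[OF r])
  have int2: "integrable (gaussian L) (\<lambda>z. q2 r r' (X t z))" if "r \<in> R" "r' \<in> R" for r r' t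
    by (rule integrable_bounded_gaussian[OF m2 bound(3)]) (use that in auto)
  have Q'_eq: "Q' t = sin t * cos t * (\<integral>z. (\<Sum>r\<in>R. \<Sum>r'\<in>R. (\<Sum>l\<in>L. b r l * b r' l - a r l * a r' l) * q2 r r' (X t z)) \<partial>gaussian L)" for t
  proof -
    have "Q' t = (\<integral>z. (\<Sum>r\<in>R. \<Sum>l\<in>L. c' t r l * (z l * q1 r (X t z))) \<partial>gaussian L)"
      unfolding Q'_def by (simp add: sum_distrib_left ac_simps)
    also have "\<dots> = (\<Sum>r\<in>R. \<Sum>l\<in>L. c' t r l * (\<integral>z. z l * q1 r (X t z) \<partial>gaussian L))"
    proof -
      have *: "integrable (gaussian L) (\<lambda>z. z l * q1 r (X t z))" if "r \<in> R" "l \<in> L" for r l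
        by (rule integrable_component_mult_bounded[OF that(2) m1 bound(2)]) (use that in auto)
      have "(\<integral>z. (\<Sum>r\<in>R. \<Sum>l\<in>L. c' t r l * (z l * q1 r (X t z))) \<partial>gaussian L) =
          (\<Sum>r\<in>R. \<integral>z. (\<Sum>l\<in>L. c' t r l * (z l * q1 r (X t z))) \<partial>gaussian L)"
        using * by (intro Bochner_Integration.integral_sum Bochner_Integration.integrable_sum integrable_mult_right) auto
      also have "\<dots> = (\<Sum>r\<in>R. \<Sum>l\<in>L. \<integral>z. c' t r l * (z l * q1 r (X t z)) \<partial>gaussian L)"
        using * by (intro sum.cong refl Bochner_Integration.integral_sum integrable_mult_right) auto
      finally show ?thesis by simp
    qed
    also have "\<dots> = (\<Sum>r\<in>R. \<Sum>l\<in>L. c' t r l * (\<Sum>r'\<in>R. (\<integral>z. q2 r r' (X t z) \<partial>gaussian L) * c t r' l))"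
      by (intro sum.cong refl, subst ibp)
         (auto intro!: arg_cong2[where f = "(*)"] sum.cong simp: Bochner_Integration.integral_sum int2)
    also have "\<dots> = (\<Sum>r\<in>R. \<Sum>r'\<in>R. (\<Sum>l\<in>L. c' t r l * c t r' l) * (\<integral>z. q2 r r' (X t z) \<partial>gaussian L))"
      by (intro sum.cong refl) (simp add: sum_distrib_left sum_distrib_right sum.swap[of _ R L] ac_simps)
    also have "\<dots> = sin t * cos t * (\<Sum>r\<in>R. \<Sum>r'\<in>R. (\<Sum>l\<in>L. b r l * b r' l - a r l * a r' l) * (\<integral>z. q2 r r' (X t z) \<partial>gaussian L))"
      by (simp only: gram sum_distrib_left[of _ _ R] mult.assoc)
    also have "(\<Sum>r\<in>R. \<Sum>r'\<in>R. (\<Sum>l\<in>L. b r l * b r' l - a r l * a r' l) * (\<integral>z. q2 r r' (X t z) \<partial>gaussian L)) =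
      (\<integral>z. (\<Sum>r\<in>R. \<Sum>r'\<in>R. (\<Sum>l\<in>L. b r l * b r' l - a r l * a r' l) * q2 r r' (X t z)) \<partial>gaussian L)"
      by (simp add: Bochner_Integration.integral_sum int2 integrable_mult_right Bochner_Integration.integrable_sum)
    finally show ?thesis .
  qed
  \<comment> \<open>The path runs from \<open>a\<close> at 0 to \<open>b\<close> at
    \<open>pi / 2\<close>; on this quarter circle \<open>sin t * cos t\<close> is nonnegative, so
    \<open>sign\<close> decides the sign of \<open>Q'\<close>.\<close>
  have "Q (pi / 2) \<le> Q 0"
  proof (rule DERIV_nonpos_imp_nonincreasing[of 0 "pi / 2" Q])
    fix t assume t: "0 \<le> t" "t \<le> pi / 2"
    have "0 \<le> sin t" "0 \<le> cos t" using t by (auto intro!: sin_ge_zero cos_ge_zero)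
    moreover have "0 \<le> (\<integral>z. - (\<Sum>r\<in>R. \<Sum>r'\<in>R. (\<Sum>l\<in>L. b r l * b r' l - a r l * a r' l) * q2 r r' (X t z)) \<partial>gaussian L)"
      by (intro Bochner_Integration.integral_nonneg) (simp only: neg_0_le_iff_le sign)
    ultimately have "Q' t \<le> 0" unfolding Q'_eq by (intro mult_nonneg_nonpos) simp_all
    then show "\<exists>y. (Q has_real_derivative y) (at t) \<and> y \<le> 0" using DQ by blast
  qed simp
  then show ?thesis
    by (simp add: Q_def X_def c_def)
qed

subsection \<open>Gordon's comparison\<close>

text \<open>A family of vectors \<open>v x\<close> in \<open>m\<close>-space with scalars \<open>w x\<close> is encoded as a function \<open>X\<close> on pairs:
  \<open>X (x, i)\<close> is the \<open>i\<close>-th coordinate of \<open>v x\<close> for \<open>i < m\<close>, and \<open>X (x, m) = w x\<close>. The functions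
  \<open>gordon_fun1\<close> and \<open>gordon_fun2\<close> are the first and second partial derivatives of \<open>gordon_fun\<close>.\<close>

context
  fixes m :: nat and T :: "'x set" and \<eta> \<beta> u :: real
begin

text \<open>The shift by \<open>\<eta>\<^sup>2\<close> keeps the root away from 0: the norm becomes
  differentiable at the origin and its second derivatives are at most
  \<open>2 / \<eta>\<close>.\<close>

definition soft_norm :: "'x \<Rightarrow> ('x \<times> nat \<Rightarrow> real) \<Rightarrow> real" where
  "soft_norm x X = sqrt (\<eta>\<^sup>2 + (\<Sum>i<m. (X (x, i))\<^sup>2))"

definition gordon_weight :: "'x \<Rightarrow> ('x \<times> nat \<Rightarrow> real) \<Rightarrow> real" where
  "gordon_weight x X = u * exp (- \<beta> * (soft_norm x X + X (x, m)))"

text \<open>The gradient of \<open>soft_norm x X + X (x, m)\<close>. It is constant in the scalar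
  coordinate \<open>m\<close>, which is why its derivative \<open>gordon_dir'\<close> is 0
  there.\<close>

definition gordon_dir :: "'x \<times> nat \<Rightarrow> ('x \<times> nat \<Rightarrow> real) \<Rightarrow> real" where
  "gordon_dir r X = (if snd r < m then X r / soft_norm (fst r) X else 1)"

definition gordon_dir' :: "'x \<times> nat \<Rightarrow> nat \<Rightarrow> ('x \<times> nat \<Rightarrow> real) \<Rightarrow> real" where
  "gordon_dir' r i X = (if snd r < m \<and> i < m
     then (if snd r = i then 1 / soft_norm (fst r) X else 0) - X r * X (fst r, i) / soft_norm (fst r) X ^ 3 else 0)"

text \<open>The Laplace kernel \<open>exp (- u * S)\<close> of the sum \<open>S\<close> of the
  exponentials. The sum itself is unbounded, but this kernel and its derivatives up to order two are
  bounded, as the interpolation requires.\<close>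

definition gordon_fun :: "('x \<times> nat \<Rightarrow> real) \<Rightarrow> real" where
  "gordon_fun X = exp (- (\<Sum>x\<in>T. gordon_weight x X))"

definition gordon_fun1 :: "'x \<times> nat \<Rightarrow> ('x \<times> nat \<Rightarrow> real) \<Rightarrow> real" where
  "gordon_fun1 r X = \<beta> * gordon_fun X * gordon_weight (fst r) X * gordon_dir r X"

text \<open>The branch \<open>fst r = fst r'\<close> collects what arises from differentiating the
  weight and the direction at the same point. In the comparison it meets covariance differences that
  are 0, so only the first, product-shaped term decides the sign.\<close>

definition gordon_fun2 :: "'x \<times> nat \<Rightarrow> 'x \<times> nat \<Rightarrow> ('x \<times> nat \<Rightarrow> real) \<Rightarrow> real" where
  "gordon_fun2 r r' X = \<beta>\<^sup>2 * gordon_fun X * gordon_weight (fst r) X * gordon_weight (fst r') X * gordon_dir r X * gordon_dir r' X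
    + (if fst r = fst r' then gordon_fun X * gordon_weight (fst r) X *
        (\<beta> * gordon_dir' r (snd r') X - \<beta>\<^sup>2 * gordon_dir r X * gordon_dir r' X) else 0)"

context
  assumes fin: "finite T" and pos: "\<eta> > 0" "\<beta> > 0" "u > 0"
begin

lemma soft_norm_ge: "soft_norm x X \<ge> \<eta>"
proof -
  have "sqrt (\<eta>\<^sup>2) \<le> soft_norm x X"
    unfolding soft_norm_def by (intro real_sqrt_le_mono) (simp add: sum_nonneg)
  then show ?thesis using pos by simp
qed

lemma soft_norm_pos: "soft_norm x X > 0"
  using soft_norm_ge[of x X] pos by linarith

lemma soft_norm_sq: "(soft_norm x X)\<^sup>2 = \<eta>\<^sup>2 + (\<Sum>i<m. (X (x, i))\<^sup>2)"
  unfolding soft_norm_def by (simp add: sum_nonneg)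

text \<open>The gradient of the softened norm at \<open>v\<close> is
  \<open>v / sqrt (\<eta>\<^sup>2 + |v|\<^sup>2)\<close>, shorter than a unit vector. This is what
  decides the sign in \<open>gordon_exp_comparison\<close>.\<close>

lemma sum_gordon_dir_sq_le_1: "(\<Sum>i<m. (gordon_dir (x, i) X)\<^sup>2) \<le> 1"
proof -
  have "(\<Sum>i<m. (gordon_dir (x, i) X)\<^sup>2) = (\<Sum>i<m. (X (x, i))\<^sup>2) / (soft_norm x X)\<^sup>2"
    by (simp add: gordon_dir_def power_divide sum_divide_distrib)
  also have "\<dots> \<le> 1"
    unfolding soft_norm_sq using pos by (intro divide_le_eq_1_pos[THEN iffD2]) (auto intro!: add_pos_nonneg sum_nonneg)
  finally show ?thesis .
qed

lemma abs_component_le_soft_norm: "i < m \<Longrightarrow> \<bar>X (x, i)\<bar> \<le> soft_norm x X"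
proof -
  assume "i < m"
  then have "(X (x, i))\<^sup>2 \<le> (\<Sum>i<m. (X (x, i))\<^sup>2)"
    by (intro member_le_sum) auto
  also have "\<dots> \<le> \<eta>\<^sup>2 + \<dots>" by simp
  finally have "sqrt ((X (x, i))\<^sup>2) \<le> soft_norm x X"
    unfolding soft_norm_def by (rule real_sqrt_le_mono)
  then show ?thesis by simp
qed

lemma abs_gordon_dir_le: "\<bar>gordon_dir r X\<bar> \<le> 1"
  using abs_component_le_soft_norm[of "snd r" X "fst r"] soft_norm_pos[of "fst r" X]
  by (auto simp: gordon_dir_def abs_divide divide_le_eq)

lemma abs_gordon_dir'_le: "\<bar>gordon_dir' r i X\<bar> \<le> 2 / \<eta>"
proof -
  define s where "s = soft_norm (fst r) X"
  have s: "s > 0" "\<eta> \<le> s" using soft_norm_pos soft_norm_ge by (auto simp: s_def)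
  have i: "1 / s \<le> 1 / \<eta>" using s pos by (simp add: frac_le)
  show ?thesis
  proof (cases "snd r < m \<and> i < m")
    case True
    then have "\<bar>X r\<bar> \<le> s" "\<bar>X (fst r, i)\<bar> \<le> s"
      using abs_component_le_soft_norm[of "snd r" X "fst r"] abs_component_le_soft_norm[of i X "fst r"]
      by (auto simp: s_def)
    then have "\<bar>X r * X (fst r, i)\<bar> \<le> s * s" by (simp add: abs_mult mult_mono)
    then have "\<bar>X r * X (fst r, i) / s ^ 3\<bar> \<le> s * s / s ^ 3"
      unfolding abs_divide using s by (simp add: divide_right_mono)
    also have "\<dots> = 1 / s" using s by (simp add: power3_eq_cube)
    finally have "\<bar>X r * X (fst r, i) / s ^ 3\<bar> \<le> 1 / \<eta>" using i by linarith
    moreover have "\<bar>if snd r = i then 1 / s else 0\<bar> \<le> 1 / \<eta>" using i s pos by auto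
    ultimately have "\<bar>(if snd r = i then 1 / s else 0) - X r * X (fst r, i) / s ^ 3\<bar> \<le> 2 / \<eta>"
      using abs_triangle_ineq4[of "if snd r = i then 1 / s else 0" "X r * X (fst r, i) / s ^ 3"] by linarith
    moreover have "gordon_dir' r i X = (if snd r = i then 1 / s else 0) - X r * X (fst r, i) / s ^ 3"
      using True by (simp add: gordon_dir'_def s_def)
    ultimately show ?thesis by (simp only:)
  qed (use pos in \<open>auto simp: gordon_dir'_def\<close>)
qed

lemma gordon_weight_pos: "gordon_weight x X > 0"
  using pos by (simp add: gordon_weight_def)

lemma gordon_fun_pos: "gordon_fun X > 0"
  by (simp add: gordon_fun_def)

lemma sum_gordon_weight_nonneg: "0 \<le> (\<Sum>x\<in>T. gordon_weight x X)"
  by (intro sum_nonneg less_imp_le gordon_weight_pos)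

lemma gordon_fun_le: "gordon_fun X \<le> 1"
  unfolding gordon_fun_def using sum_gordon_weight_nonneg by simp

lemma gordon_weight_le_sum: "x \<in> T \<Longrightarrow> gordon_weight x X \<le> (\<Sum>x\<in>T. gordon_weight x X)"
  using gordon_weight_pos fin by (intro member_le_sum) (auto intro: less_imp_le)

text \<open>A single weight is at most the sum \<open>S\<close>, and \<open>S \<le> exp S\<close>:
  the outer exponential tames the unbounded weights. The next lemma uses
  \<open>S * S \<le> 2 * exp S\<close> in the same way.\<close>

lemma gordon_fun_weight_le:
  assumes "x \<in> T"
  shows "gordon_fun X * gordon_weight x X \<le> 1"
proof -
  define S where "S = (\<Sum>x\<in>T. gordon_weight x X)"
  have "gordon_weight x X \<le> exp S"
    using gordon_weight_le_sum[OF assms, of X] exp_ge_add_one_self[of S] unfolding S_def by linarith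
  then show ?thesis
    by (simp add: gordon_fun_def exp_minus field_simps flip: S_def)
qed

lemma gordon_fun_weight_weight_le:
  assumes "x \<in> T" "y \<in> T"
  shows "gordon_fun X * gordon_weight x X * gordon_weight y X \<le> 2"
proof -
  define S where "S = (\<Sum>x\<in>T. gordon_weight x X)"
  have "0 \<le> S" unfolding S_def by (rule sum_gordon_weight_nonneg)
  then have "S * S \<le> 2 * exp S"
    using exp_lower_Taylor_quadratic[of S] by (simp add: power2_eq_square)
  moreover have "gordon_weight x X * gordon_weight y X \<le> S * S"
    unfolding S_def using assms
    by (intro mult_mono gordon_weight_le_sum sum_gordon_weight_nonneg less_imp_le[OF gordon_weight_pos])
  ultimately have "gordon_weight x X * gordon_weight y X \<le> 2 * exp S" by linarith
  then show ?thesis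
    by (simp add: gordon_fun_def exp_minus field_simps flip: S_def)
qed

lemma abs_gordon_fun1_le: "fst r \<in> T \<Longrightarrow> \<bar>gordon_fun1 r X\<bar> \<le> \<beta>"
proof -
  assume r: "fst r \<in> T"
  have "\<bar>gordon_fun1 r X\<bar> = \<beta> * ((gordon_fun X * gordon_weight (fst r) X) * \<bar>gordon_dir r X\<bar>)"
    using pos(2) gordon_fun_pos[of X] gordon_weight_pos[of "fst r" X] by (simp add: gordon_fun1_def abs_mult)
  also have "\<dots> \<le> \<beta> * (1 * 1)"
    using pos(2) gordon_fun_pos[of X] gordon_weight_pos[of "fst r" X] gordon_fun_weight_le[OF r, of X] abs_gordon_dir_le[of r X]
    by (intro mult_left_mono mult_mono) auto
  finally show ?thesis by simp
qed

lemma abs_gordon_fun2_le: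
  assumes r: "fst r \<in> T" "fst r' \<in> T"
  shows "\<bar>gordon_fun2 r r' X\<bar> \<le> 3 * \<beta>\<^sup>2 + 2 * \<beta> / \<eta>"
proof -
  have "\<bar>\<beta>\<^sup>2 * gordon_fun X * gordon_weight (fst r) X * gordon_weight (fst r') X * gordon_dir r X * gordon_dir r' X\<bar>
      = \<beta>\<^sup>2 * ((gordon_fun X * gordon_weight (fst r) X * gordon_weight (fst r') X) * (\<bar>gordon_dir r X\<bar> * \<bar>gordon_dir r' X\<bar>))"
    using gordon_fun_pos[of X] gordon_weight_pos[of "fst r" X] gordon_weight_pos[of "fst r'" X] by (simp add: abs_mult)
  also have "\<dots> \<le> \<beta>\<^sup>2 * (2 * (1 * 1))"
    using gordon_fun_pos[of X] gordon_weight_pos gordon_fun_weight_weight_le[OF r, of X]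
    by (intro mult_left_mono mult_mono abs_gordon_dir_le) auto
  finally have 1: "\<bar>\<beta>\<^sup>2 * gordon_fun X * gordon_weight (fst r) X * gordon_weight (fst r') X * gordon_dir r X * gordon_dir r' X\<bar> \<le> 2 * \<beta>\<^sup>2"
    by simp
  have "\<bar>\<beta>\<^sup>2 * gordon_dir r X * gordon_dir r' X\<bar> = \<beta>\<^sup>2 * (\<bar>gordon_dir r X\<bar> * \<bar>gordon_dir r' X\<bar>)"
    by (simp add: abs_mult)
  also have "\<dots> \<le> \<beta>\<^sup>2 * (1 * 1)" by (intro mult_left_mono mult_mono abs_gordon_dir_le) auto
  finally have 2: "\<bar>\<beta>\<^sup>2 * gordon_dir r X * gordon_dir r' X\<bar> \<le> \<beta>\<^sup>2" by simp
  have 3: "\<bar>\<beta> * gordon_dir' r (snd r') X\<bar> \<le> \<beta> * (2 / \<eta>)"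
    unfolding abs_mult using pos abs_gordon_dir'_le[of r "snd r'" X] by (intro mult_mono) auto
  have "\<bar>\<beta> * gordon_dir' r (snd r') X - \<beta>\<^sup>2 * gordon_dir r X * gordon_dir r' X\<bar> \<le> \<beta> * (2 / \<eta>) + \<beta>\<^sup>2"
    using 2 3 by linarith
  then have "\<bar>gordon_fun X * gordon_weight (fst r) X * (\<beta> * gordon_dir' r (snd r') X - \<beta>\<^sup>2 * gordon_dir r X * gordon_dir r' X)\<bar>
      \<le> 1 * (\<beta> * (2 / \<eta>) + \<beta>\<^sup>2)"
    unfolding abs_mult[of "gordon_fun X * gordon_weight (fst r) X"]
    using gordon_fun_pos[of X] gordon_weight_pos[of "fst r" X] gordon_fun_weight_le[OF r(1), of X]
    by (intro mult_mono) auto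
  then have "\<bar>if fst r = fst r' then gordon_fun X * gordon_weight (fst r) X *
        (\<beta> * gordon_dir' r (snd r') X - \<beta>\<^sup>2 * gordon_dir r X * gordon_dir r' X) else 0\<bar> \<le> \<beta> * (2 / \<eta>) + \<beta>\<^sup>2"
    using pos by auto
  then show ?thesis
    unfolding gordon_fun2_def using 1 by (intro order_trans[OF abs_triangle_ineq]) (simp add: algebra_simps)
qed

context
  fixes X :: "real \<Rightarrow> 'x \<times> nat \<Rightarrow> real" and X' :: "'x \<times> nat \<Rightarrow> real" and s :: real
  assumes DX: "\<And>r. ((\<lambda>s. X s r) has_real_derivative X' r) (at s)"
begin

lemma DERIV_soft_norm:
  "((\<lambda>s. soft_norm x (X s)) has_real_derivative (\<Sum>i<m. gordon_dir (x, i) (X s) * X' (x, i))) (at s)"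
proof -
  have p: "\<eta>\<^sup>2 + (\<Sum>i<m. (X s (x, i))\<^sup>2) > 0"
    using pos by (intro add_pos_nonneg sum_nonneg) auto
  have "((\<lambda>s. \<eta>\<^sup>2 + (\<Sum>i<m. (X s (x, i))\<^sup>2)) has_real_derivative (\<Sum>i<m. 2 * X s (x, i) * X' (x, i))) (at s)"
    by (auto intro!: derivative_eq_intros DX sum.cong)
  from DERIV_chain2[where f = sqrt and g = "\<lambda>s. \<eta>\<^sup>2 + (\<Sum>i<m. (X s (x, i))\<^sup>2)", OF DERIV_real_sqrt[OF p] this]
  have "((\<lambda>s. soft_norm x (X s)) has_real_derivative
      inverse (soft_norm x (X s)) / 2 * (\<Sum>i<m. 2 * X s (x, i) * X' (x, i))) (at s)"
    by (simp only: soft_norm_def)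
  also have "inverse (soft_norm x (X s)) / 2 * (\<Sum>i<m. 2 * X s (x, i) * X' (x, i)) = (\<Sum>i<m. gordon_dir (x, i) (X s) * X' (x, i))"
    unfolding sum_distrib_left by (intro sum.cong) (auto simp: gordon_dir_def divide_simps)
  finally show ?thesis .
qed

lemma DERIV_weight:
  "((\<lambda>s. gordon_weight x (X s)) has_real_derivative
     - \<beta> * gordon_weight x (X s) * (\<Sum>i\<le>m. gordon_dir (x, i) (X s) * X' (x, i))) (at s)"
proof -
  have eq: "(\<Sum>i\<le>m. gordon_dir (x, i) (X s) * X' (x, i)) = (\<Sum>i<m. gordon_dir (x, i) (X s) * X' (x, i)) + X' (x, m)"
    unfolding lessThan_Suc_atMost[symmetric] by (simp add: gordon_dir_def)
  show ?thesis
    unfolding gordon_weight_def eq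
    by (auto intro!: derivative_eq_intros DERIV_soft_norm DX simp: algebra_simps)
qed

lemma DERIV_gordon_fun:
  "((\<lambda>s. gordon_fun (X s)) has_real_derivative (\<Sum>r\<in>T \<times> {..m}. gordon_fun1 r (X s) * X' r)) (at s)"
proof -
  have "((\<lambda>s. gordon_fun (X s)) has_real_derivative gordon_fun (X s) *
      - (\<Sum>x\<in>T. - \<beta> * gordon_weight x (X s) * (\<Sum>i\<le>m. gordon_dir (x, i) (X s) * X' (x, i)))) (at s)"
    unfolding gordon_fun_def
    by (intro derivative_intros DERIV_fun_exp[THEN DERIV_cong] DERIV_weight)
  also have "gordon_fun (X s) * - (\<Sum>x\<in>T. - \<beta> * gordon_weight x (X s) * (\<Sum>i\<le>m. gordon_dir (x, i) (X s) * X' (x, i)))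
      = (\<Sum>x\<in>T. \<Sum>i\<le>m. gordon_fun1 (x, i) (X s) * X' (x, i))"
    by (simp add: gordon_fun1_def sum_distrib_left sum_negf ac_simps)
  finally show ?thesis by (simp add: sum.cartesian_product case_prod_unfold)
qed

lemma DERIV_gordon_dir:
  assumes "snd r \<le> m"
  shows "((\<lambda>s. gordon_dir r (X s)) has_real_derivative (\<Sum>i\<le>m. gordon_dir' r i (X s) * X' (fst r, i))) (at s)"
proof (cases "snd r < m")
  case True
  obtain x i where r: "r = (x, i)" by (cases r)
  define n where "n = soft_norm x (X s)"
  have n: "n > 0" using soft_norm_pos by (simp add: n_def)
  have i: "i < m" using True r by simp
  have "((\<lambda>s. X s (x, i) / soft_norm x (X s)) has_real_derivative
      (X' (x, i) * n - X s (x, i) * (\<Sum>j<m. gordon_dir (x, j) (X s) * X' (x, j))) / (n * n)) (at s)"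
    unfolding n_def using soft_norm_pos[of x "X s"] by (intro DERIV_divide DX DERIV_soft_norm) auto
  also have "(X' (x, i) * n - X s (x, i) * (\<Sum>j<m. gordon_dir (x, j) (X s) * X' (x, j))) / (n * n)
      = X' (x, i) / n - (\<Sum>j<m. X s (x, i) * X s (x, j) / n ^ 3 * X' (x, j))"
  proof -
    have "X s (x, i) * (\<Sum>j<m. gordon_dir (x, j) (X s) * X' (x, j)) / (n * n) = (\<Sum>j<m. X s (x, i) * X s (x, j) / n ^ 3 * X' (x, j))"
      unfolding sum_distrib_left sum_divide_distrib using n
      by (intro sum.cong) (auto simp: gordon_dir_def n_def power3_eq_cube)
    then show ?thesis using n by (simp add: diff_divide_distrib)
  qed
  also have "X' (x, i) / n = (\<Sum>j<m. (if i = j then 1 / n else 0) * X' (x, j))"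
    using i by (subst sum.remove[of _ i]) (auto intro!: sum.neutral)
  also have "(\<Sum>j<m. (if i = j then 1 / n else 0) * X' (x, j)) - (\<Sum>j<m. X s (x, i) * X s (x, j) / n ^ 3 * X' (x, j))
     = (\<Sum>j<m. gordon_dir' r j (X s) * X' (x, j))"
    unfolding sum_subtractf[symmetric] using i by (intro sum.cong) (auto simp: gordon_dir'_def r n_def algebra_simps)
  also have "\<dots> = (\<Sum>j\<le>m. gordon_dir' r j (X s) * X' (fst r, j))"
    unfolding lessThan_Suc_atMost[symmetric] by (simp add: gordon_dir'_def r)
  finally show ?thesis using i by (simp add: gordon_dir_def[abs_def] r)
next
  case False
  then show ?thesis by (simp add: gordon_dir_def[abs_def] gordon_dir'_def)
qed

lemma DERIV_gordon_fun1:
  assumes r: "r \<in> T \<times> {..m}"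
  shows "((\<lambda>s. gordon_fun1 r (X s)) has_real_derivative (\<Sum>r'\<in>T \<times> {..m}. gordon_fun2 r r' (X s) * X' r')) (at s)"
proof -
  let ?q = "gordon_fun (X s)" and ?k = "gordon_weight (fst r) (X s)" and ?d = "gordon_dir r (X s)"
  let ?S = "\<Sum>i\<le>m. gordon_dir (fst r, i) (X s) * X' (fst r, i)"
  have "((\<lambda>s. \<beta> * gordon_fun (X s) * gordon_weight (fst r) (X s) * gordon_dir r (X s)) has_real_derivative
      \<beta> * (\<Sum>r'\<in>T \<times> {..m}. gordon_fun1 r' (X s) * X' r') * ?k * ?d + \<beta> * ?q * (- \<beta> * ?k * ?S) * ?d
       + \<beta> * ?q * ?k * (\<Sum>i\<le>m. gordon_dir' r i (X s) * X' (fst r, i))) (at s)"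
    using r by (auto intro!: derivative_eq_intros DERIV_gordon_fun DERIV_weight DERIV_gordon_dir simp: algebra_simps)
  moreover have "(\<Sum>r'\<in>T \<times> {..m}. gordon_fun2 r r' (X s) * X' r') =
      \<beta> * (\<Sum>r'\<in>T \<times> {..m}. gordon_fun1 r' (X s) * X' r') * ?k * ?d + \<beta> * ?q * (- \<beta> * ?k * ?S) * ?d
       + \<beta> * ?q * ?k * (\<Sum>i\<le>m. gordon_dir' r i (X s) * X' (fst r, i))"
  proof -
    have "(\<Sum>r'\<in>T \<times> {..m}. (if fst r = fst r' then ?q * ?k * (\<beta> * gordon_dir' r (snd r') (X s) - \<beta>\<^sup>2 * ?d * gordon_dir r' (X s)) else 0) * X' r')
       = (\<Sum>x\<in>T. \<Sum>i\<le>m. (if fst r = x then ?q * ?k * (\<beta> * gordon_dir' r i (X s) - \<beta>\<^sup>2 * ?d * gordon_dir (x, i) (X s)) else 0) * X' (x, i))"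
      unfolding sum.cartesian_product by (intro sum.cong) auto
    also have "\<dots> = (\<Sum>x\<in>T. if fst r = x then (\<Sum>i\<le>m. ?q * ?k * (\<beta> * gordon_dir' r i (X s) - \<beta>\<^sup>2 * ?d * gordon_dir (x, i) (X s)) * X' (x, i)) else 0)"
      by (intro sum.cong) auto
    also have "\<dots> = (\<Sum>i\<le>m. ?q * ?k * (\<beta> * gordon_dir' r i (X s) - \<beta>\<^sup>2 * ?d * gordon_dir (fst r, i) (X s)) * X' (fst r, i))"
      using r fin by (subst sum.delta') auto
    also have "\<dots> = \<beta> * ?q * (- \<beta> * ?k * ?S) * ?d + \<beta> * ?q * ?k * (\<Sum>i\<le>m. gordon_dir' r i (X s) * X' (fst r, i))"
      unfolding sum_distrib_left sum_distrib_right sum.distrib[symmetric]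
      by (intro sum.cong) (auto simp: algebra_simps power2_eq_square)
    finally have 1: "(\<Sum>r'\<in>T \<times> {..m}. (if fst r = fst r' then ?q * ?k * (\<beta> * gordon_dir' r (snd r') (X s) - \<beta>\<^sup>2 * ?d * gordon_dir r' (X s)) else 0) * X' r')
      = \<beta> * ?q * (- \<beta> * ?k * ?S) * ?d + \<beta> * ?q * ?k * (\<Sum>i\<le>m. gordon_dir' r i (X s) * X' (fst r, i))" .
    have 2: "(\<Sum>r'\<in>T \<times> {..m}. \<beta>\<^sup>2 * ?q * ?k * gordon_weight (fst r') (X s) * ?d * gordon_dir r' (X s) * X' r')
      = \<beta> * (\<Sum>r'\<in>T \<times> {..m}. gordon_fun1 r' (X s) * X' r') * ?k * ?d"
      unfolding sum_distrib_left sum_distrib_right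
      by (intro sum.cong) (auto simp: gordon_fun1_def power2_eq_square)
    show ?thesis
      unfolding gordon_fun2_def distrib_right sum.distrib 1 2 by simp
  qed
  ultimately show ?thesis
    unfolding gordon_fun1_def by simp
qed

end

lemma isCont_gordon_fun2:
  fixes X :: "real \<Rightarrow> 'x \<times> nat \<Rightarrow> real"
  assumes cont: "\<And>r. isCont (\<lambda>s. X s r) s"
  shows "isCont (\<lambda>s. gordon_fun2 r r' (X s)) s"
proof -
  have n: "isCont (\<lambda>s. soft_norm x (X s)) s" for x
    unfolding soft_norm_def by (intro continuous_intros cont)
  have n0: "soft_norm x X \<noteq> 0" for x X using soft_norm_pos[of x X] by simp
  have w: "isCont (\<lambda>s. gordon_weight x (X s)) s" for x
    unfolding gordon_weight_def by (intro continuous_intros cont n)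
  have d: "isCont (\<lambda>s. gordon_dir r (X s)) s" for r
    unfolding gordon_dir_def by (cases "snd r < m") (auto intro!: continuous_intros cont n simp: n0)
  have d': "isCont (\<lambda>s. gordon_dir' r i (X s)) s" for r i
    unfolding gordon_dir'_def
    by (cases "snd r < m \<and> i < m"; cases "snd r = i") (auto intro!: continuous_intros cont n simp: n0)
  have q: "isCont (\<lambda>s. gordon_fun (X s)) s"
    unfolding gordon_fun_def by (intro continuous_intros w)
  show ?thesis
    unfolding gordon_fun2_def by (cases "fst r = fst r'") (auto intro!: continuous_intros w d d' q)
qed

end

context
  fixes M :: "'z measure" and X :: "'z \<Rightarrow> 'x \<times> nat \<Rightarrow> real"
  assumes meas [measurable]: "\<And>r. (\<lambda>z. X z r) \<in> borel_measurable M"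
begin

lemma measurable_gordon [measurable]:
  "(\<lambda>z. soft_norm x (X z)) \<in> borel_measurable M"
  "(\<lambda>z. gordon_weight x (X z)) \<in> borel_measurable M"
  "(\<lambda>z. gordon_dir r (X z)) \<in> borel_measurable M"
  "(\<lambda>z. gordon_dir' r i (X z)) \<in> borel_measurable M"
  "(\<lambda>z. gordon_fun (X z)) \<in> borel_measurable M"
  unfolding soft_norm_def gordon_weight_def gordon_dir_def gordon_dir'_def gordon_fun_def by measurable

lemma measurable_gordon_fun12 [measurable]:
  "(\<lambda>z. gordon_fun1 r (X z)) \<in> borel_measurable M"
  "(\<lambda>z. gordon_fun2 r r' (X z)) \<in> borel_measurable M"
  unfolding gordon_fun1_def gordon_fun2_def by measurable

end

end

section \<open>The two Gaussian processes and the sign of their covariance difference\<close>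

lemma sum_row:
  fixes f :: "nat \<times> nat \<Rightarrow> real"
  assumes "i \<le> m"
  shows "(\<Sum>l\<in>{..m} \<times> {..N}. (if fst l = i then v (snd l) else 0) * f l) = (\<Sum>j\<le>N. v j * f (i, j))"
proof -
  have "(\<Sum>l\<in>{..m} \<times> {..N}. (if fst l = i then v (snd l) else 0) * f l)
      = (\<Sum>i'\<le>m. \<Sum>j\<le>N. (if i' = i then v j else 0) * f (i', j))"
    by (simp add: sum.cartesian_product case_prod_unfold)
  also have "\<dots> = (\<Sum>i'\<le>m. if i' = i then (\<Sum>j\<le>N. v j * f (i', j)) else 0)"
    by (intro sum.cong) auto
  also have "\<dots> = (\<Sum>j\<le>N. v j * f (i, j))"
    using assms by (subst sum.delta) auto
  finally show ?thesis .
qed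

lemma sum_atMost_shift_if:
  fixes f g :: "nat \<Rightarrow> real"
  shows "(\<Sum>j\<le>N. (if j = 0 then 0 else f j) * g j) = (\<Sum>j=1..N. f j * g j)"
proof -
  have "{..N} = insert 0 {1..N}" by auto
  then have "(\<Sum>j\<le>N. (if j = 0 then 0 else f j) * g j) = (\<Sum>j=1..N. (if j = 0 then 0 else f j) * g j)" by simp
  also have "\<dots> = (\<Sum>j=1..N. f j * g j)" by (intro sum.cong) auto
  finally show ?thesis .
qed

lemma sum_atMost_0_if:
  fixes g :: "nat \<Rightarrow> real"
  shows "(\<Sum>j\<le>N. (if j = 0 then 1 else 0) * g j) = g 0"
proof -
  have "{..N} = insert 0 {1..N}" by auto
  then show ?thesis by simp
qed

lemma sum_prod_le_1:
  fixes f g :: "'a \<Rightarrow> real"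
  assumes "(\<Sum>i\<in>A. (f i)\<^sup>2) \<le> 1" "(\<Sum>i\<in>A. (g i)\<^sup>2) \<le> 1"
  shows "(\<Sum>i\<in>A. f i * g i) \<le> 1"
proof -
  have "(\<Sum>i\<in>A. f i * g i) \<le> (\<Sum>i\<in>A. ((f i)\<^sup>2 + (g i)\<^sup>2) / 2)"
    using sum_squares_bound[of "f i" "g i" for i] by (intro sum_mono) (simp add: field_simps)
  also have "\<dots> = ((\<Sum>i\<in>A. (f i)\<^sup>2) + (\<Sum>i\<in>A. (g i)\<^sup>2)) / 2"
    by (simp add: sum.distrib flip: sum_divide_distrib)
  finally show ?thesis using assms by simp
qed

text \<open>One standard Gaussian array indexed by \<open>{0..m} \<times> {0..N}\<close> carries all the randomness: the block
  with \<open>i < m\<close> and \<open>j \<ge> 1\<close> is the matrix, the rest of column \<open>0\<close> is the vector \<open>h\<close>, the rest of row \<open>m\<close>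
  is the vector \<open>g\<close>, and the corner \<open>(m, 0)\<close> is an extra scalar.\<close>

lemma gordon_exp_comparison:
  fixes T :: "(nat \<Rightarrow> real) set" and m N :: nat
  assumes fin: "finite T" and pos: "\<eta> > 0" "\<beta> > 0" "u > 0"
    and unit: "\<And>x. x \<in> T \<Longrightarrow> (\<Sum>j=1..N. (x j)\<^sup>2) = 1"
  shows "(\<integral>z. exp (- (\<Sum>x\<in>T. u * exp (- \<beta> * (sqrt (\<eta>\<^sup>2 + (\<Sum>i<m. (z (i, 0))\<^sup>2)) + row_dot N x z m)))) \<partial>array_law m N)
     \<le> (\<integral>z. exp (- (\<Sum>x\<in>T. u * exp (- \<beta> * (sqrt (\<eta>\<^sup>2 + (\<Sum>i<m. (row_dot N x z i)\<^sup>2)) + z (m, 0))))) \<partial>array_law m N)"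
proof -
  define w where "w x j = (if j = 0 then 0 else x j)" for x :: "nat \<Rightarrow> real" and j :: nat
  define e where "e j = (if j = 0 then 1 else 0 :: real)" for j :: nat
  \<comment> \<open>\<open>a\<close> produces the pair (matrix times \<open>x\<close>, corner
    scalar) and \<open>b\<close> the pair (\<open>h\<close>, \<open>g\<close> dot \<open>x\<close>).
    They read disjoint entries of the array, which gives the orthogonality needed for the
    interpolation.\<close>
  define a where "a r l = (if fst l = snd r then (if snd r < m then w (fst r) else e) (snd l) else 0)"
    for r :: "(nat \<Rightarrow> real) \<times> nat" and l :: "nat \<times> nat"
  define b where "b r l = (if fst l = snd r then (if snd r < m then e else w (fst r)) (snd l) else 0)"
    for r :: "(nat \<Rightarrow> real) \<times> nat" and l :: "nat \<times> nat"
  let ?L = "{..m} \<times> {..N}" and ?R = "T \<times> {..m}"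
  let ?q = "gordon_fun m T \<eta> \<beta> u" and ?q1 = "gordon_fun1 m T \<eta> \<beta> u" and ?q2 = "gordon_fun2 m T \<eta> \<beta> u"
  have row_w: "(\<Sum>j\<le>N. w x j * f j) = (\<Sum>j=1..N. x j * f j)" for x f
    unfolding w_def by (rule sum_atMost_shift_if)
  have row_e: "(\<Sum>j\<le>N. e j * f j) = f 0" for f
    unfolding e_def by (rule sum_atMost_0_if)
  have suma: "(\<Sum>l\<in>?L. a (x, i) l * f l) = (if i < m then \<Sum>j=1..N. x j * f (i, j) else f (i, 0))" if "i \<le> m" for x i f
    unfolding a_def fst_conv snd_conv sum_row[OF that] by (auto simp: row_w row_e)
  have sumb: "(\<Sum>l\<in>?L. b (x, i) l * f l) = (if i < m then f (i, 0) else \<Sum>j=1..N. x j * f (i, j))" if "i \<le> m" for x i f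
    unfolding b_def fst_conv snd_conv sum_row[OF that] by (auto simp: row_w row_e)
  define \<sigma> where "\<sigma> x y = 1 - (\<Sum>j=1..N. x j * y j)" for x y :: "nat \<Rightarrow> real"
  define G where "G r r' = (\<Sum>l\<in>?L. b r l * b r' l - a r l * a r' l)" for r r'
  \<comment> \<open>For unit vectors \<open>\<sigma> x y\<close> is half the squared distance, hence
    nonnegative and 0 on the diagonal. The covariances differ by \<open>\<sigma>\<close> in each of
    the first \<open>m\<close> coordinates and by \<open>- \<sigma>\<close> in the scalar
    one.\<close>
  have gram: "G (x, i) (y, i') = (if i = i' then if i < m then \<sigma> x y else - \<sigma> x y else 0)"
    if "i \<le> m" "i' \<le> m" for x y i i'
  proof -
    have "(\<Sum>j=1..N. x j * w y j) = (\<Sum>j=1..N. x j * y j)"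
      by (intro sum.cong) (auto simp: w_def)
    then show ?thesis
      unfolding G_def sum_subtractf suma[OF that(1)] sumb[OF that(1)] by (auto simp: a_def b_def e_def w_def \<sigma>_def)
  qed
  have "(\<integral>z. ?q (\<lambda>r. \<Sum>l\<in>?L. b r l * z l) \<partial>gaussian ?L) \<le> (\<integral>z. ?q (\<lambda>r. \<Sum>l\<in>?L. a r l * z l) \<partial>gaussian ?L)"
  proof (rule gaussian_interpolation[where R = ?R and ?q1.0 = ?q1 and ?q2.0 = ?q2 and C = "1 + \<beta> + (3 * \<beta>\<^sup>2 + 2 * \<beta> / \<eta>)"])
    show "finite ?L" "finite ?R" using fin by auto
    have c: "0 \<le> 3 * \<beta>\<^sup>2 + 2 * \<beta> / \<eta>" using pos by auto
    show "\<bar>?q X\<bar> \<le> 1 + \<beta> + (3 * \<beta>\<^sup>2 + 2 * \<beta> / \<eta>)" for X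
      unfolding abs_of_pos[OF gordon_fun_pos[OF fin pos]] using gordon_fun_le[OF fin pos, of m X] c pos(2) by linarith
    show "\<bar>?q1 r X\<bar> \<le> 1 + \<beta> + (3 * \<beta>\<^sup>2 + 2 * \<beta> / \<eta>)" if "r \<in> ?R" for r X
    proof -
      have "\<bar>?q1 r X\<bar> \<le> \<beta>" using abs_gordon_fun1_le[OF fin pos, of r m X] that by auto
      then show ?thesis using c by linarith
    qed
    show "\<bar>?q2 r r' X\<bar> \<le> 1 + \<beta> + (3 * \<beta>\<^sup>2 + 2 * \<beta> / \<eta>)" if "r \<in> ?R" "r' \<in> ?R" for r r' X
    proof -
      have "\<bar>?q2 r r' X\<bar> \<le> 3 * \<beta>\<^sup>2 + 2 * \<beta> / \<eta>" using abs_gordon_fun2_le[OF fin pos, of r r' m X] that by auto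
      then show ?thesis using pos(2) by linarith
    qed
    show "(\<Sum>l\<in>?L. a r l * b r' l) = 0" for r r'
      unfolding a_def b_def by (intro sum.neutral) (auto simp: e_def w_def)
    show "(\<Sum>r\<in>?R. \<Sum>r'\<in>?R. (\<Sum>l\<in>?L. b r l * b r' l - a r l * a r' l) * ?q2 r r' X) \<le> 0" for X
    proof -
      have "(\<Sum>r\<in>?R. \<Sum>r'\<in>?R. G r r' * ?q2 r r' X)
        = (\<Sum>x\<in>T. \<Sum>i\<le>m. \<Sum>y\<in>T. \<Sum>i'\<le>m. (if i' = i then (if i < m then \<sigma> x y else - \<sigma> x y) * ?q2 (x, i) (y, i) X else 0))"
        unfolding sum.cartesian_product' fst_conv snd_conv by (intro sum.cong refl) (auto simp: gram)
      also have "\<dots> = (\<Sum>x\<in>T. \<Sum>y\<in>T. \<Sum>i\<le>m. (if i < m then \<sigma> x y else - \<sigma> x y) * ?q2 (x, i) (y, i) X)"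
        by (intro sum.cong refl) (simp add: sum.swap[of _ T "{..m}"])
      also have "\<dots> \<le> 0"
      proof (rule sum_nonpos, rule sum_nonpos)
        fix x y assume xy: "x \<in> T" "y \<in> T"
        show "(\<Sum>i\<le>m. (if i < m then \<sigma> x y else - \<sigma> x y) * ?q2 (x, i) (y, i) X) \<le> 0"
        proof (cases "x = y")
          case True
          then have "\<sigma> x y = 0" using unit[OF xy(1)] by (simp add: \<sigma>_def power2_eq_square)
          then show ?thesis by (intro sum_nonpos) simp
        next
          case False
          let ?d = "gordon_dir m \<eta>"
          define c where "c = \<beta>\<^sup>2 * ?q X * gordon_weight m \<eta> \<beta> u x X * gordon_weight m \<eta> \<beta> u y X"
          have c: "c \<ge> 0"
            unfolding c_def using gordon_fun_pos[OF fin pos, of m X] gordon_weight_pos[OF fin pos, of m]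
            by (intro mult_nonneg_nonneg) (auto intro: less_imp_le)
          have s: "\<sigma> x y \<ge> 0"
            unfolding \<sigma>_def using sum_prod_le_1[of x "{1..N}" y] unit xy by simp
          have d: "(\<Sum>i<m. ?d (x, i) X * ?d (y, i) X) \<le> 1"
            by (intro sum_prod_le_1 sum_gordon_dir_sq_le_1[OF fin pos])
          \<comment> \<open>For \<open>x \<noteq> y\<close> only the product term of
            \<open>gordon_fun2\<close> is left. The sum becomes \<open>\<sigma> x y * c\<close>
            times (inner product of two gradients minus 1): the \<open>- 1\<close> stems from the
            scalar coordinate, and the inner product is at most 1.\<close>
          have "(\<Sum>i\<le>m. (if i < m then \<sigma> x y else - \<sigma> x y) * ?q2 (x, i) (y, i) X)
              = (\<Sum>i\<le>m. (if i < m then \<sigma> x y else - \<sigma> x y) * (c * (?d (x, i) X * ?d (y, i) X)))"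
            using False by (intro sum.cong refl) (auto simp: gordon_fun2_def c_def)
          also have "\<dots> = \<sigma> x y * c * ((\<Sum>i<m. ?d (x, i) X * ?d (y, i) X) - 1)"
            unfolding lessThan_Suc_atMost[symmetric]
            by (simp add: gordon_dir_def[of _ _ "(_, m)"] sum_distrib_left right_diff_distrib ac_simps)
          also have "\<dots> \<le> 0" using s c d by (intro mult_nonneg_nonpos) auto
          finally show ?thesis .
        qed
      qed
      finally show ?thesis by (simp only: G_def)
    qed
  qed (auto intro!: DERIV_gordon_fun[OF fin pos] DERIV_gordon_fun1[OF fin pos] isCont_gordon_fun2[OF fin pos]
        measurable_gordon measurable_gordon_fun12)
  moreover have "?q (\<lambda>r. \<Sum>l\<in>?L. b r l * z l) = exp (- (\<Sum>x\<in>T. u * exp (- \<beta> * (sqrt (\<eta>\<^sup>2 + (\<Sum>i<m. (z (i, 0))\<^sup>2)) + row_dot N x z m))))" for z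
    by (simp add: gordon_fun_def gordon_weight_def soft_norm_def sumb)
  moreover have "?q (\<lambda>r. \<Sum>l\<in>?L. a r l * z l) = exp (- (\<Sum>x\<in>T. u * exp (- \<beta> * (sqrt (\<eta>\<^sup>2 + (\<Sum>i<m. (row_dot N x z i)\<^sup>2)) + z (m, 0)))))" for z
    by (simp add: gordon_fun_def gordon_weight_def soft_norm_def suma)
  ultimately show ?thesis by simp
qed

section \<open>Powers as mixtures of Laplace kernels\<close>

lemma nn_integral_exp_atLeast_0:
  assumes "\<mu> > 0"
  shows "(\<integral>\<^sup>+x. ennreal (exp (- \<mu> * x)) * indicator {0..} x \<partial>lborel) = ennreal (1 / \<mu>)"
proof -
  have "(\<integral>\<^sup>+x. ennreal (exp (- \<mu> * x)) * indicator {0..} x \<partial>lborel) = 0 - (- (1 / \<mu>) * exp (- \<mu> * 0))"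
  proof (rule nn_integral_FTC_atLeast)
    show "DERIV (\<lambda>x. - (1 / \<mu>) * exp (- \<mu> * x)) x :> exp (- \<mu> * x)" for x
      using assms by (auto intro!: derivative_eq_intros)
    show "((\<lambda>x. - (1 / \<mu>) * exp (- \<mu> * x)) \<longlongrightarrow> 0) at_top"
      using assms by real_asymp
  qed auto
  then show ?thesis by simp
qed

text \<open>Writing the mixing variable as \<open>u = exp c\<close> makes scaling by
  \<open>S\<close> a translation: shifting \<open>c\<close> by \<open>- ln S\<close> turns
  \<open>exp c * S\<close> into \<open>exp c\<close> and releases the factor
  \<open>S powr p\<close>.\<close>

lemma nn_integral_powr_mixture:
  fixes S p :: real
  assumes S: "S > 0"
  shows "(\<integral>\<^sup>+c. ennreal (exp (- p * c) * (1 - exp (- (exp c * S)))) \<partial>lborel)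
    = ennreal (S powr p) * (\<integral>\<^sup>+c. ennreal (exp (- p * c) * (1 - exp (- exp c))) \<partial>lborel)"
proof -
  have "(\<integral>\<^sup>+c. ennreal (exp (- p * c) * (1 - exp (- (exp c * S)))) \<partial>lborel)
      = (\<integral>\<^sup>+c. ennreal (exp (- p * (- ln S + 1 * c)) * (1 - exp (- (exp (- ln S + 1 * c) * S)))) \<partial>lborel)"
    by (subst nn_integral_real_affine[where t = "- ln S" and c = 1]) auto
  also have "\<dots> = (\<integral>\<^sup>+c. ennreal (S powr p) * ennreal (exp (- p * c) * (1 - exp (- exp c))) \<partial>lborel)"
  proof (rule nn_integral_cong)
    fix c :: real
    have "exp (- ln S + 1 * c) * S = exp c"
      using S by (simp add: exp_diff exp_minus exp_add)
    moreover have "exp (- p * (- ln S + 1 * c)) = S powr p * exp (- p * c)"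
      using S by (simp add: powr_def algebra_simps flip: exp_add)
    ultimately show "ennreal (exp (- p * (- ln S + 1 * c)) * (1 - exp (- (exp (- ln S + 1 * c) * S))))
        = ennreal (S powr p) * ennreal (exp (- p * c) * (1 - exp (- exp c)))"
      by (simp add: mult.assoc flip: ennreal_mult')
  qed
  also have "\<dots> = ennreal (S powr p) * (\<integral>\<^sup>+c. ennreal (exp (- p * c) * (1 - exp (- exp c))) \<partial>lborel)"
    by (rule nn_integral_cmult) simp
  finally show ?thesis .
qed

text \<open>For \<open>c \<ge> 0\<close> the integrand is below \<open>exp (- p * c)\<close>,
  integrable as \<open>p > 0\<close>; for \<open>c < 0\<close> the bound
  \<open>1 - exp (- exp c) \<le> exp c\<close> leaves \<open>exp ((1 - p) * c)\<close>, integrable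
  as \<open>p < 1\<close>. A nonzero finite constant can be cancelled from both sides of a
  comparison.\<close>

lemma powr_mixture_const:
  assumes p: "0 < p" "p < 1"
  defines "\<kappa> \<equiv> (\<integral>\<^sup>+c. ennreal (exp (- p * c) * (1 - exp (- exp c))) \<partial>lborel)"
  shows "\<kappa> \<noteq> 0" "\<kappa> \<noteq> \<top>"
proof -
  show "\<kappa> \<noteq> 0"
  proof
    assume "\<kappa> = 0"
    then have "AE c in lborel. ennreal (exp (- p * c) * (1 - exp (- exp c))) = 0"
      unfolding \<kappa>_def by (subst (asm) nn_integral_0_iff_AE) auto
    moreover have "ennreal (exp (- p * c) * (1 - exp (- exp c))) \<noteq> 0" for c
      by (auto simp: ennreal_eq_0_iff not_le intro!: mult_pos_pos)
    ultimately have "AE c in (lborel :: real measure). False" by simp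
    then show False by (simp add: ae_filter_eq_bot_iff eventually_False emeasure_lborel_UNIV)
  qed
  have "\<kappa> \<le> (\<integral>\<^sup>+c. ennreal (exp (- p * c)) * indicator {0..} c + ennreal (exp (- (1 - p) * (0 + (- 1) * c))) * indicator {0..} (0 + (- 1) * c) \<partial>lborel)"
    unfolding \<kappa>_def
  proof (rule nn_integral_mono)
    fix c :: real
    show "ennreal (exp (- p * c) * (1 - exp (- exp c))) \<le> ennreal (exp (- p * c)) * indicator {0..} c
        + ennreal (exp (- (1 - p) * (0 + (- 1) * c))) * indicator {0..} (0 + (- 1) * c)"
    proof (cases "0 \<le> c")
      case True
      have "exp (- p * c) * (1 - exp (- exp c)) \<le> exp (- p * c) * 1" by (intro mult_left_mono) auto
      then have "ennreal (exp (- p * c) * (1 - exp (- exp c))) \<le> ennreal (exp (- p * c))" by (intro ennreal_leI) simp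
      then show ?thesis using True by (simp add: add_increasing2)
    next
      case False
      have "exp (- p * c) * (1 - exp (- exp c)) \<le> exp (- p * c) * exp c"
        using exp_ge_add_one_self[of "- exp c"] by (intro mult_left_mono) auto
      also have "\<dots> = exp (- (1 - p) * (0 + (- 1) * c))" by (simp add: algebra_simps flip: exp_add)
      finally have "ennreal (exp (- p * c) * (1 - exp (- exp c))) \<le> ennreal (exp (- (1 - p) * (0 + (- 1) * c)))" by (intro ennreal_leI)
      then show ?thesis using False by simp
    qed
  qed
  also have "\<dots> = (\<integral>\<^sup>+c. ennreal (exp (- p * c)) * indicator {0..} c \<partial>lborel)
     + (\<integral>\<^sup>+c. ennreal (exp (- (1 - p) * (0 + (- 1) * c))) * indicator {0..} (0 + (- 1) * c) \<partial>lborel)"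
    by (rule nn_integral_add) auto
  also have "(\<integral>\<^sup>+c. ennreal (exp (- (1 - p) * (0 + (- 1) * c))) * indicator {0..} (0 + (- 1) * c) \<partial>lborel)
      = (\<integral>\<^sup>+c. ennreal (exp (- (1 - p) * c)) * indicator {0..} c \<partial>lborel)"
    by (subst nn_integral_real_affine[where t = 0 and c = "- 1", of "\<lambda>c. ennreal (exp (- (1 - p) * c)) * indicator {0..} c"]) auto
  also have "(\<integral>\<^sup>+c. ennreal (exp (- p * c)) * indicator {0..} c \<partial>lborel) + \<dots> < \<top>"
    using p by (simp only: nn_integral_exp_atLeast_0 diff_gt_0_iff_gt) simp
  finally show "\<kappa> \<noteq> \<top>" by simp
qed

text \<open>The function \<open>s \<mapsto> s powr p\<close> with \<open>0 < p < 1\<close> is a mixture of the functions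
  \<open>s \<mapsto> 1 - exp (- u * s)\<close>, \<open>u = exp c > 0\<close>.\<close>

lemma nn_integral_powr_mono_of_laplace:
  fixes S1 S2 :: "'a \<Rightarrow> real"
  assumes M: "prob_space M" and [measurable]: "S1 \<in> borel_measurable M" "S2 \<in> borel_measurable M"
    and pos: "\<And>z. 0 < S1 z" "\<And>z. 0 < S2 z" and p: "0 < p" "p < 1"
    and laplace: "\<And>u. 0 < u \<Longrightarrow> (\<integral>z. exp (- (u * S2 z)) \<partial>M) \<le> (\<integral>z. exp (- (u * S1 z)) \<partial>M)"
  shows "(\<integral>\<^sup>+z. ennreal (S1 z powr p) \<partial>M) \<le> (\<integral>\<^sup>+z. ennreal (S2 z powr p) \<partial>M)"
proof -
  interpret prob_space M by fact
  interpret pair_sigma_finite M lborel ..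
  define \<kappa> where "\<kappa> = (\<integral>\<^sup>+c. ennreal (exp (- p * c) * (1 - exp (- exp c))) \<partial>lborel)"
  have \<kappa>: "\<kappa> \<noteq> 0" "\<kappa> \<noteq> \<top>"
    using powr_mixture_const[OF p] by (auto simp: \<kappa>_def)
  have eq: "(\<integral>\<^sup>+z. ennreal (S z powr p) \<partial>M) * \<kappa> = (\<integral>\<^sup>+c. ennreal (exp (- p * c)) * ennreal (1 - (\<integral>z. exp (- (exp c * S z)) \<partial>M)) \<partial>lborel)"
    if [measurable]: "S \<in> borel_measurable M" and pos: "\<And>z. 0 < S z" for S :: "'a \<Rightarrow> real"
  proof -
    have "(\<integral>\<^sup>+z. ennreal (S z powr p) \<partial>M) * \<kappa> = (\<integral>\<^sup>+z. ennreal (S z powr p) * \<kappa> \<partial>M)"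
      by (rule nn_integral_multc[symmetric]) simp
    also have "\<dots> = (\<integral>\<^sup>+z. (\<integral>\<^sup>+c. ennreal (exp (- p * c) * (1 - exp (- (exp c * S z)))) \<partial>lborel) \<partial>M)"
      unfolding \<kappa>_def by (intro nn_integral_cong nn_integral_powr_mixture[symmetric] pos)
    also have "\<dots> = (\<integral>\<^sup>+c. (\<integral>\<^sup>+z. ennreal (exp (- p * c) * (1 - exp (- (exp c * S z)))) \<partial>M) \<partial>lborel)"
      by (rule Fubini'[symmetric]) measurable
    also have "\<dots> = (\<integral>\<^sup>+c. ennreal (exp (- p * c)) * ennreal (1 - (\<integral>z. exp (- (exp c * S z)) \<partial>M)) \<partial>lborel)"
    proof (rule nn_integral_cong)
      fix c :: real
      have le: "exp (- (exp c * S z)) \<le> 1" for z using pos[of z] by simp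
      have int: "integrable M (\<lambda>z. exp (- (exp c * S z)))"
        by (rule integrable_const_bound[of _ 1]) (use le in auto)
      have "(\<integral>\<^sup>+z. ennreal (exp (- p * c) * (1 - exp (- (exp c * S z)))) \<partial>M) = ennreal (\<integral>z. exp (- p * c) * (1 - exp (- (exp c * S z))) \<partial>M)"
        using int le by (intro nn_integral_eq_integral integrable_mult_right Bochner_Integration.integrable_diff) auto
      also have "(\<integral>z. exp (- p * c) * (1 - exp (- (exp c * S z))) \<partial>M) = exp (- p * c) * (1 - (\<integral>z. exp (- (exp c * S z)) \<partial>M))"
        using int by (simp add: prob_space)
      finally show "(\<integral>\<^sup>+z. ennreal (exp (- p * c) * (1 - exp (- (exp c * S z)))) \<partial>M)
          = ennreal (exp (- p * c)) * ennreal (1 - (\<integral>z. exp (- (exp c * S z)) \<partial>M))"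
        by (simp add: ennreal_mult')
    qed
    finally show ?thesis .
  qed
  have "(\<integral>\<^sup>+z. ennreal (S1 z powr p) \<partial>M) * \<kappa> \<le> (\<integral>\<^sup>+z. ennreal (S2 z powr p) \<partial>M) * \<kappa>"
    by (subst (1 2) eq) (auto intro!: pos nn_integral_mono mult_left_mono ennreal_leI laplace)
  then show ?thesis
    using \<kappa> by (metis ennreal_mult_le_mult_iff mult.commute)
qed

section \<open>Independence of disjoint coordinate blocks\<close>

lemma measurable_gaussian_component [measurable (raw)]:
  "l \<in> L \<Longrightarrow> (\<lambda>z. z l) \<in> borel_measurable (gaussian L)"
  using measurable_component_singleton[of l L "\<lambda>_. std_gauss"] by simp

lemma nn_integral_gaussian_restrict:
  assumes "finite L" "J \<subseteq> L" and [measurable]: "f \<in> borel_measurable (gaussian J)"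
  shows "(\<integral>\<^sup>+z. f (restrict z J) \<partial>gaussian L) = (\<integral>\<^sup>+z. f z \<partial>gaussian J)"
proof -
  interpret R: prob_space "gaussian (L - J)" by (rule prob_space_gaussian)
  have L: "L = J \<union> (L - J)" using assms by auto
  have [measurable]: "(\<lambda>z. f (restrict z J)) \<in> borel_measurable (gaussian L)"
    by (rule measurable_compose[OF measurable_restrict_subset[OF assms(2)] assms(3)])
  have "(\<integral>\<^sup>+z. f (restrict z J) \<partial>gaussian L) = (\<integral>\<^sup>+x. (\<integral>\<^sup>+y. f (restrict (merge J (L - J) (x, y)) J) \<partial>gaussian (L - J)) \<partial>gaussian J)"
    using assms L by (subst L, intro gaussian.product_nn_integral_fold) (auto intro: finite_subset)
  also have "\<dots> = (\<integral>\<^sup>+x. f x \<partial>gaussian J)"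
  proof (rule nn_integral_cong)
    fix x :: "'a \<Rightarrow> real" assume "x \<in> space (gaussian J)"
    then have "restrict x J = x" by (auto simp: space_PiM PiE_def extensional_restrict)
    then show "(\<integral>\<^sup>+y. f (restrict (merge J (L - J) (x, y)) J) \<partial>gaussian (L - J)) = f x"
      by (simp add: R.emeasure_space_1)
  qed
  finally show ?thesis .
qed

text \<open>Fubini over \<open>I\<close> and its complement: the second factor does not depend on
  the coordinates in \<open>I\<close>, and the coordinates outside \<open>J\<close> integrate to
  1.\<close>

lemma nn_integral_gaussian_mult:
  assumes fin: "finite L" and IJ: "I \<subseteq> L" "J \<subseteq> L" "I \<inter> J = {}"
    and f [measurable]: "f \<in> borel_measurable (gaussian I)" and g [measurable]: "g \<in> borel_measurable (gaussian J)"
  shows "(\<integral>\<^sup>+z. f (restrict z I) * g (restrict z J) \<partial>gaussian L) = (\<integral>\<^sup>+z. f z \<partial>gaussian I) * (\<integral>\<^sup>+z. g z \<partial>gaussian J)"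
proof -
  have L: "L = I \<union> (L - I)" using IJ by auto
  have J: "J \<subseteq> L - I" using IJ by auto
  have [measurable]: "(\<lambda>z. f (restrict z I)) \<in> borel_measurable (gaussian L)"
    by (rule measurable_compose[OF measurable_restrict_subset[OF IJ(1)] f])
  have [measurable]: "(\<lambda>z. g (restrict z J)) \<in> borel_measurable (gaussian L)"
    by (rule measurable_compose[OF measurable_restrict_subset[OF IJ(2)] g])
  have g': "(\<lambda>z. g (restrict z J)) \<in> borel_measurable (gaussian (L - I))"
    by (rule measurable_compose[OF measurable_restrict_subset[OF J] g])
  have restr: "restrict (merge I (L - I) (x, y)) J = restrict y J" for x y :: "'a \<Rightarrow> real"
    using J by (auto simp: restrict_def merge_def fun_eq_iff)
  have "(\<integral>\<^sup>+z. f (restrict z I) * g (restrict z J) \<partial>gaussian L)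
      = (\<integral>\<^sup>+x. (\<integral>\<^sup>+y. f (restrict (merge I (L - I) (x, y)) I) * g (restrict (merge I (L - I) (x, y)) J) \<partial>gaussian (L - I)) \<partial>gaussian I)"
    using fin L IJ by (subst L, intro gaussian.product_nn_integral_fold) (auto intro: finite_subset)
  also have "\<dots> = (\<integral>\<^sup>+x. f x * (\<integral>\<^sup>+y. g (restrict y J) \<partial>gaussian (L - I)) \<partial>gaussian I)"
    by (intro nn_integral_cong) (auto simp: restr space_PiM PiE_def extensional_restrict nn_integral_cmult[OF g'])
  also have "\<dots> = (\<integral>\<^sup>+z. f z \<partial>gaussian I) * (\<integral>\<^sup>+z. g z \<partial>gaussian J)"
    using fin J by (subst nn_integral_gaussian_restrict) (auto simp: nn_integral_multc)
  finally show ?thesis .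
qed

text \<open>Completing the square leaves the normal density centred at \<open>- lam\<close>.\<close>

lemma nn_integral_exp_std_gauss:
  "(\<integral>\<^sup>+x. ennreal (exp (- lam * x)) \<partial>std_gauss) = ennreal (exp (lam\<^sup>2 / 2))"
proof -
  have "(\<integral>\<^sup>+x. ennreal (exp (- lam * x)) \<partial>std_gauss) = (\<integral>\<^sup>+x. ennreal (exp (lam\<^sup>2 / 2)) * ennreal (normal_density (- lam) 1 x) \<partial>lborel)"
    by (subst nn_integral_std_gauss)
       (auto intro!: nn_integral_cong simp: normal_density_def power2_eq_square field_simps
         simp flip: ennreal_mult' exp_add)
  also have "\<dots> = ennreal (exp (lam\<^sup>2 / 2)) * (\<integral>\<^sup>+x. ennreal (normal_density (- lam) 1 x) \<partial>lborel)"
    by (rule nn_integral_cmult) simp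
  also have "(\<integral>\<^sup>+x. ennreal (normal_density (- lam) 1 x) \<partial>lborel) = 1"
    using prob_space.emeasure_space_1[OF prob_space_normal_density[of 1 "- lam"]] by (simp add: emeasure_density)
  finally show ?thesis by simp
qed

lemma lim_1_over_real: "(\<lambda>n. 1 / real n) \<longlonglongrightarrow> 0"
  by (rule lim_1_over_n)

section \<open>From smooth functionals to suprema of exponentials\<close>

context
  fixes m N :: nat and lam :: real
  assumes lam: "lam > 0"
begin

text \<open>With rate \<open>\<beta> = lam / p\<close>, the \<open>p\<close>-th power of a sum of
  \<open>exp (- \<beta> * r)\<close> lies between the maximum of \<open>exp (- lam * r)\<close> and
  \<open>card T powr p\<close> times that maximum. Softening the norm changes it by at most
  \<open>\<eta>\<close>, which costs \<open>exp (- lam * \<eta>)\<close> on the left and nothing on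
  the right.\<close>

lemma gordon_smoothed:
  fixes T :: "(nat \<Rightarrow> real) set"
  assumes fin: "finite T" and ne: "T \<noteq> {}" and unit: "\<And>x. x \<in> T \<Longrightarrow> (\<Sum>j=1..N. (x j)\<^sup>2) = 1"
    and \<eta>: "\<eta> > 0" and p: "0 < p" "p < 1"
  shows "ennreal (exp (- lam * \<eta>)) * (\<integral>\<^sup>+z. (SUP x\<in>T. ennreal (exp (- lam * (image_norm m N x z + z (m, 0))))) \<partial>array_law m N)
    \<le> ennreal (real (card T) powr p) * (\<integral>\<^sup>+z. (SUP x\<in>T. ennreal (exp (- lam * (column_norm m z + row_dot N x z m)))) \<partial>array_law m N)"
    (is "_ * ?I \<le> _ * ?J")
proof -
  define \<beta> where "\<beta> = lam / p"
  have \<beta>: "\<beta> > 0" "p * \<beta> = lam" using lam p by (auto simp: \<beta>_def)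
  define S1 where "S1 z = (\<Sum>x\<in>T. exp (- \<beta> * (sqrt (\<eta>\<^sup>2 + (\<Sum>i<m. (row_dot N x z i)\<^sup>2)) + z (m, 0))))" for z :: "nat \<times> nat \<Rightarrow> real"
  define S2 where "S2 z = (\<Sum>x\<in>T. exp (- \<beta> * (sqrt (\<eta>\<^sup>2 + (\<Sum>i<m. (z (i, 0))\<^sup>2)) + row_dot N x z m)))" for z :: "nat \<times> nat \<Rightarrow> real"
  have [measurable]: "S1 \<in> borel_measurable (array_law m N)" "S2 \<in> borel_measurable (array_law m N)"
    unfolding S1_def S2_def by (measurable; simp)+
  have S: "(\<integral>\<^sup>+z. ennreal (S1 z powr p) \<partial>array_law m N) \<le> (\<integral>\<^sup>+z. ennreal (S2 z powr p) \<partial>array_law m N)"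
  proof (rule nn_integral_powr_mono_of_laplace[OF prob_space_gaussian _ _ _ _ p])
    show "0 < S1 z" "0 < S2 z" for z
      unfolding S1_def S2_def using fin ne by (auto intro: sum_pos)
    show "(\<integral>z. exp (- (u * S2 z)) \<partial>array_law m N) \<le> (\<integral>z. exp (- (u * S1 z)) \<partial>array_law m N)" if "0 < u" for u
      unfolding S1_def S2_def sum_distrib_left[of u]
      using gordon_exp_comparison[OF fin \<eta> \<beta>(1) that unit, of m] by (simp add: sum_distrib_left)
  qed auto
  have powr_exp: "exp (- \<beta> * r) powr p = exp (- lam * r)" for r
    using \<beta>(2) by (simp add: powr_def mult.assoc flip: \<beta>(2))
  have 1: "ennreal (exp (- lam * \<eta>)) * (SUP x\<in>T. ennreal (exp (- lam * (image_norm m N x z + z (m, 0)))))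
      \<le> ennreal (S1 z powr p)" for z
    unfolding SUP_mult_left_ennreal
  proof (rule SUP_least)
    fix x assume x: "x \<in> T"
    define s where "s = (\<Sum>i<m. (row_dot N x z i)\<^sup>2)"
    have "s \<ge> 0" unfolding s_def by (intro sum_nonneg) auto
    then have "sqrt (\<eta>\<^sup>2 + s) \<le> \<eta> + sqrt s"
      using sqrt_add_le_add_sqrt[of "\<eta>\<^sup>2" s] \<eta> by simp
    then have "- lam * \<eta> + - lam * (sqrt s + z (m, 0)) \<le> - lam * (sqrt (\<eta>\<^sup>2 + s) + z (m, 0))"
      using mult_left_mono[of "sqrt (\<eta>\<^sup>2 + s)" "\<eta> + sqrt s" lam] lam by (simp add: algebra_simps)
    then have "exp (- lam * \<eta>) * exp (- lam * (sqrt s + z (m, 0))) \<le> exp (- lam * (sqrt (\<eta>\<^sup>2 + s) + z (m, 0)))"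
      by (simp only: exp_add[symmetric] exp_le_cancel_iff)
    also have "\<dots> = exp (- \<beta> * (sqrt (\<eta>\<^sup>2 + s) + z (m, 0))) powr p"
      by (rule powr_exp[symmetric])
    also have "\<dots> \<le> S1 z powr p"
      using p unfolding S1_def s_def by (intro powr_mono2 member_le_sum x fin) auto
    finally show "ennreal (exp (- lam * \<eta>)) * ennreal (exp (- lam * (image_norm m N x z + z (m, 0)))) \<le> ennreal (S1 z powr p)"
      unfolding s_def by (subst ennreal_mult'[symmetric]) (auto intro: ennreal_leI)
  qed
  have 2: "ennreal (S2 z powr p) \<le> ennreal (real (card T) powr p) *
      (SUP x\<in>T. ennreal (exp (- lam * (column_norm m z + row_dot N x z m))))" for z
  proof -
    define n where "n = sqrt (\<eta>\<^sup>2 + (\<Sum>i<m. (z (i, 0))\<^sup>2))"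
    define f where "f x = exp (- \<beta> * (n + row_dot N x z m))" for x
    have "Max (f ` T) \<in> f ` T" using fin ne by (intro Max_in) auto
    then obtain x where x: "x \<in> T" "Max (f ` T) = f x" by auto
    have "S2 z \<le> (\<Sum>y\<in>T. f x)"
      unfolding S2_def n_def[symmetric] f_def[symmetric] using fin by (intro sum_mono) (auto simp flip: x(2))
    then have "S2 z powr p \<le> (real (card T) * f x) powr p"
      using p by (intro powr_mono2) (auto simp: S2_def intro!: sum_nonneg)
    also have "\<dots> = real (card T) powr p * exp (- lam * (n + row_dot N x z m))"
      by (subst powr_mult) (auto simp only: f_def powr_exp exp_ge_zero of_nat_0_le_iff)
    also have "\<dots> \<le> real (card T) powr p * exp (- lam * (column_norm m z + row_dot N x z m))"
      using lam by (intro mult_left_mono) (auto simp: n_def intro!: real_sqrt_le_mono)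
    finally have "ennreal (S2 z powr p) \<le> ennreal (real (card T) powr p) * ennreal (exp (- lam * (column_norm m z + row_dot N x z m)))"
      by (subst ennreal_mult'[symmetric]) (auto intro: ennreal_leI)
    also have "\<dots> \<le> ennreal (real (card T) powr p) *
      (SUP x\<in>T. ennreal (exp (- lam * (column_norm m z + row_dot N x z m))))"
      by (intro mult_left_mono SUP_upper x) auto
    finally show ?thesis .
  qed
  have cT: "countable T" using fin by (rule countable_finite)
  have m1: "(\<lambda>z. SUP x\<in>T. ennreal (exp (- lam * (image_norm m N x z + z (m, 0))))) \<in> borel_measurable (array_law m N)"
    by (intro borel_measurable_SUP cT) (measurable; simp)
  have m2: "(\<lambda>z. SUP x\<in>T. ennreal (exp (- lam * (column_norm m z + row_dot N x z m)))) \<in> borel_measurable (array_law m N)"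
    by (intro borel_measurable_SUP cT) (measurable; simp)
  have "ennreal (exp (- lam * \<eta>)) * ?I \<le> (\<integral>\<^sup>+z. ennreal (S1 z powr p) \<partial>array_law m N)"
    unfolding nn_integral_cmult[OF m1, symmetric] by (intro nn_integral_mono 1)
  also note S
  also have "(\<integral>\<^sup>+z. ennreal (S2 z powr p) \<partial>array_law m N) \<le> ennreal (real (card T) powr p) * ?J"
    unfolding nn_integral_cmult[OF m2, symmetric] by (intro nn_integral_mono 2)
  finally show ?thesis .
qed

text \<open>Both error factors of \<open>gordon_smoothed\<close> tend to 1 as \<open>p\<close> and
  \<open>\<eta>\<close> tend to 0. The trivial case of an infinite right-hand side is split off so
  that multiplication by it is continuous.\<close>

lemma gordon_finite:
  fixes T :: "(nat \<Rightarrow> real) set"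
  assumes fin: "finite T" and unit: "\<And>x. x \<in> T \<Longrightarrow> (\<Sum>j=1..N. (x j)\<^sup>2) = 1"
  shows "(\<integral>\<^sup>+z. (SUP x\<in>T. ennreal (exp (- lam * (image_norm m N x z + z (m, 0))))) \<partial>array_law m N)
    \<le> (\<integral>\<^sup>+z. (SUP x\<in>T. ennreal (exp (- lam * (column_norm m z + row_dot N x z m)))) \<partial>array_law m N)"
    (is "?I \<le> ?J")
proof (cases "T = {} \<or> ?J = \<top>")
  case False
  \<comment> \<open>\<open>\<eta> = 1 / (n + 1)\<close> and \<open>p = 1 / (n + 2)\<close>; the
    \<open>n + 2\<close> keeps \<open>p\<close> strictly below 1 already for
    \<open>n = 0\<close>.\<close>
  define c where "c n = exp (lam * (1 / real (Suc n))) * real (card T) powr (1 / real (n + 2))" for n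
  have card: "card T > 0" using False fin by (simp add: card_gt_0_iff)
  have "c \<longlonglongrightarrow> exp (lam * 0) * real (card T) powr 0"
    unfolding c_def using card LIMSEQ_Suc[OF lim_1_over_real] LIMSEQ_ignore_initial_segment[OF lim_1_over_real, of 2]
    by (intro tendsto_intros) auto
  then have "(\<lambda>n. ?J * ennreal (c n)) \<longlonglongrightarrow> ?J * ennreal (exp (lam * 0) * real (card T) powr 0)"
    using False by (intro ennreal_tendsto_cmult tendsto_ennrealI) (auto simp: less_top)
  then have lim: "(\<lambda>n. ?J * ennreal (c n)) \<longlonglongrightarrow> ?J" using card by simp
  have "?I \<le> ?J * ennreal (c n)" for n
  proof -
    have "ennreal (exp (lam * (1 / real (Suc n)))) * (ennreal (exp (- lam * (1 / real (Suc n)))) * ?I)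
        \<le> ennreal (exp (lam * (1 / real (Suc n)))) * (ennreal (real (card T) powr (1 / real (n + 2))) * ?J)"
      using False by (intro mult_left_mono gordon_smoothed fin unit) auto
    also have "ennreal (exp (lam * (1 / real (Suc n)))) * (ennreal (exp (- lam * (1 / real (Suc n)))) * ?I) = ?I"
      unfolding mult.assoc[symmetric] by (subst ennreal_mult'[symmetric]) (auto simp flip: exp_add)
    also have "ennreal (exp (lam * (1 / real (Suc n)))) * (ennreal (real (card T) powr (1 / real (n + 2))) * ?J) = ?J * ennreal (c n)"
      unfolding c_def ennreal_mult'[OF exp_ge_zero] by (simp only: ac_simps)
    finally show ?thesis .
  qed
  then show ?thesis by (intro LIMSEQ_le_const[OF lim]) auto
next
  case True
  then show ?thesis
  proof
    assume "T = {}"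
    then show ?thesis by simp
  next
    assume J: "?J = \<top>"
    show ?thesis unfolding J by simp
  qed
qed

text \<open>The four blocks of the array are pairwise disjoint, so both sides of
  \<open>gordon_finite\<close> split into products. The corner scalar contributes
  \<open>exp (lam\<^sup>2 / 2)\<close> on the matrix side.\<close>

lemma gordon_finite_factored:
  fixes T :: "(nat \<Rightarrow> real) set"
  assumes fin: "finite T" and unit: "\<And>x. x \<in> T \<Longrightarrow> (\<Sum>j=1..N. (x j)\<^sup>2) = 1"
  shows "ennreal (exp (lam\<^sup>2 / 2)) * (\<integral>\<^sup>+a. (SUP x\<in>T. ennreal (exp (- lam * image_norm m N x a))) \<partial>matrix_law m N)
    \<le> (\<integral>\<^sup>+h. ennreal (exp (- lam * column_norm m h)) \<partial>gaussian ({..<m} \<times> {0::nat}))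
      * (\<integral>\<^sup>+g. (SUP x\<in>T. ennreal (exp (- lam * row_dot N x g m))) \<partial>gaussian ({m} \<times> {1..N}))"
proof -
  let ?L = "{..m} \<times> {..N}" and ?A = "{..<m} \<times> {1..N}" and ?H = "{..<m} \<times> {0::nat}" and ?G = "{m} \<times> {1..N}" and ?C = "{(m, 0::nat)}"
  define fA where "fA a = (SUP x\<in>T. ennreal (exp (- lam * image_norm m N x a)))" for a :: "nat \<times> nat \<Rightarrow> real"
  define fC where "fC c = ennreal (exp (- lam * c (m, 0)))" for c :: "nat \<times> nat \<Rightarrow> real"
  define fH where "fH h = ennreal (exp (- lam * column_norm m h))" for h :: "nat \<times> nat \<Rightarrow> real"
  define fG where "fG g = (SUP x\<in>T. ennreal (exp (- lam * row_dot N x g m)))" for g :: "nat \<times> nat \<Rightarrow> real"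
  have cT: "countable T" using fin by (rule countable_finite)
  have mA: "fA \<in> borel_measurable (gaussian ?A)"
    unfolding fA_def by (intro borel_measurable_SUP cT) (measurable; simp)
  have mC: "fC \<in> borel_measurable (gaussian ?C)"
    unfolding fC_def by (measurable; simp)
  have mH: "fH \<in> borel_measurable (gaussian ?H)"
    unfolding fH_def by (measurable; simp)
  have mG: "fG \<in> borel_measurable (gaussian ?G)"
    unfolding fG_def by (intro borel_measurable_SUP cT) (measurable; simp)
  have restr: "fA (restrict z ?A) = fA z" "fC (restrict z ?C) = fC z" "fH (restrict z ?H) = fH z" "fG (restrict z ?G) = fG z" for z
    by (simp_all add: fA_def fC_def fH_def fG_def)
  have eq1: "(SUP x\<in>T. ennreal (exp (- lam * (image_norm m N x z + z (m, 0))))) = fC z * fA z" for z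
    unfolding fA_def fC_def SUP_mult_left_ennreal ennreal_mult'[OF exp_ge_zero, symmetric] exp_add[symmetric] distrib_left
    by (simp only: add.commute)
  have eq2: "(SUP x\<in>T. ennreal (exp (- lam * (column_norm m z + row_dot N x z m)))) = fH z * fG z" for z
    unfolding fG_def fH_def SUP_mult_left_ennreal ennreal_mult'[OF exp_ge_zero, symmetric] exp_add[symmetric] distrib_left ..
  have C: "(\<integral>\<^sup>+c. fC c \<partial>gaussian ?C) = ennreal (exp (lam\<^sup>2 / 2))"
    unfolding fC_def nn_integral_exp_std_gauss[symmetric]
    by (rule gaussian.product_nn_integral_singleton) simp
  have "(\<integral>\<^sup>+c. fC c \<partial>gaussian ?C) * (\<integral>\<^sup>+a. fA a \<partial>gaussian ?A) = (\<integral>\<^sup>+z. fC (restrict z ?C) * fA (restrict z ?A) \<partial>gaussian ?L)"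
    by (intro nn_integral_gaussian_mult[symmetric] mC mA) auto
  also have "\<dots> \<le> (\<integral>\<^sup>+z. fH (restrict z ?H) * fG (restrict z ?G) \<partial>gaussian ?L)"
    using gordon_finite[OF fin unit] unfolding restr eq1 eq2 .
  also have "\<dots> = (\<integral>\<^sup>+h. fH h \<partial>gaussian ?H) * (\<integral>\<^sup>+g. fG g \<partial>gaussian ?G)"
    by (intro nn_integral_gaussian_mult mH mG) auto
  finally show ?thesis
    unfolding C by (simp only: fA_def fH_def fG_def)
qed

text \<open>Exhausting \<open>D\<close> by finite sets makes the suprema on the left increase, so
  monotone convergence carries the finite bound over.\<close>

lemma gordon_comparison:
  fixes D :: "(nat \<Rightarrow> real) set"
  assumes D: "countable D" and unit: "\<And>x. x \<in> D \<Longrightarrow> (\<Sum>j=1..N. (x j)\<^sup>2) = 1"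
  shows "ennreal (exp (lam\<^sup>2 / 2)) * (\<integral>\<^sup>+a. (SUP x\<in>D. ennreal (exp (- lam * image_norm m N x a))) \<partial>matrix_law m N)
    \<le> (\<integral>\<^sup>+h. ennreal (exp (- lam * column_norm m h)) \<partial>gaussian ({..<m} \<times> {0::nat}))
      * (\<integral>\<^sup>+g. (SUP x\<in>D. ennreal (exp (- lam * row_dot N x g m))) \<partial>gaussian ({m} \<times> {1..N}))"
    (is "?c * (\<integral>\<^sup>+a. (SUP x\<in>D. ?f x a) \<partial>?M) \<le> ?H * ?G D")
proof (cases "D = {}")
  case False
  define T where "T n = from_nat_into D ` {..n}" for n
  have T: "finite (T n)" "T n \<subseteq> D" for n
    using from_nat_into[OF False] by (auto simp: T_def)
  have "(\<Union>n. T n) = from_nat_into D ` (\<Union>n. {..n})" by (simp only: T_def image_UN)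
  then have D_eq: "D = (\<Union>n. T n)"
    using range_from_nat_into[OF False D] by (simp add: UN_atMost_UNIV)
  have inc: "incseq (\<lambda>n a. SUP x\<in>T n. ?f x a)"
    by (intro incseq_SucI le_funI SUP_subset_mono) (auto simp: T_def)
  have "(\<integral>\<^sup>+a. (SUP x\<in>D. ?f x a) \<partial>?M) = (\<integral>\<^sup>+a. (SUP n. SUP x\<in>T n. ?f x a) \<partial>?M)"
    unfolding D_eq by (simp add: SUP_UNION)
  also have "\<dots> = (SUP n. \<integral>\<^sup>+a. (SUP x\<in>T n. ?f x a) \<partial>?M)"
  proof (intro nn_integral_monotone_convergence_SUP inc)
    show "(\<lambda>a. SUP x\<in>T n. ?f x a) \<in> borel_measurable ?M" for n
      by (intro borel_measurable_SUP countable_finite T) (measurable; simp)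
  qed
  also have "?c * \<dots> \<le> ?H * ?G D"
    unfolding SUP_mult_left_ennreal
  proof (rule SUP_least)
    fix n
    have "?c * (\<integral>\<^sup>+a. (SUP x\<in>T n. ?f x a) \<partial>?M) \<le> ?H * ?G (T n)"
      using T by (intro gordon_finite_factored unit) auto
    also have "\<dots> \<le> ?H * ?G D"
      by (intro mult_left_mono nn_integral_mono SUP_subset_mono T) auto
    finally show "?c * (\<integral>\<^sup>+a. (SUP x\<in>T n. ?f x a) \<partial>?M) \<le> ?H * ?G D" .
  qed
  finally show ?thesis .
qed (simp add: bot_ennreal)

end

subsection \<open>Truncated Gaussian squares\<close>

definition gauss_cdf :: "real \<Rightarrow> real" where
  "gauss_cdf x = measure std_gauss {..x}"

lemma emeasure_std_gauss:
  "A \<in> sets borel \<Longrightarrow> emeasure std_gauss A = (\<integral>\<^sup>+x. ennreal (gauss_pdf x) * indicator A x \<partial>lborel)"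
  unfolding std_gauss_def by (subst emeasure_density) auto

lemma gauss_cdf_eq_cdf: "gauss_cdf = cdf std_gauss"
  by (simp add: fun_eq_iff gauss_cdf_def cdf_def)

lemma gauss_cdf_bounds: "0 \<le> gauss_cdf x" "gauss_cdf x \<le> 1"
  by (auto simp: gauss_cdf_def)

lemma gauss_cdf_at_top: "(gauss_cdf \<longlongrightarrow> 1) at_top"
  unfolding gauss_cdf_eq_cdf by (rule std_gauss.cdf_lim_at_top_prob)

text \<open>The density is continuous, so near \<open>s\<close> the distribution function equals an
  antiderivative \<open>H\<close> up to a constant. \<open>H\<close> lives on \<open>s - 2\<close>
  to \<open>s + 2\<close> and is used only within distance 1 of \<open>s\<close>, where its
  derivative is two-sided.\<close>

lemma DERIV_gauss_cdf: "(gauss_cdf has_real_derivative gauss_pdf s) (at s)"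
proof -
  let ?p = gauss_pdf
  have "continuous_on {s - 2..s + 2} ?p"
    by (intro DERIV_continuous_on[of _ _ "\<lambda>x. - x * ?p x"] DERIV_subset[OF DERIV_std_normal_density]) auto
  then obtain H where H: "\<And>x. x \<in> {s - 2..s + 2} \<Longrightarrow> (H has_vector_derivative ?p x) (at x within {s - 2..s + 2})"
    using antiderivative_continuous by blast
  have DH: "(H has_real_derivative ?p x) (at x)" if "x \<in> {s - 1..s + 1}" for x
    using H[of x] that at_within_Icc_at[of "s - 2" x "s + 2"]
    by (simp add: has_real_derivative_iff_has_vector_derivative)
  have eq: "gauss_cdf x = gauss_cdf (s - 1) + (H x - H (s - 1))" if x: "x \<in> {s - 1<..<s + 1}" for x
  proof -
    have "emeasure std_gauss {s - 1<..x} = (\<integral>\<^sup>+u. ennreal (?p u) * indicator {s - 1..x} u \<partial>lborel)"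
      unfolding emeasure_std_gauss[OF greaterThanAtMost_borel]
      by (rule nn_integral_cong_AE, rule AE_mp[OF AE_lborel_singleton[of "s - 1"]]) (auto simp: indicator_def)
    also have "\<dots> = ennreal (H x - H (s - 1))"
      using x by (intro nn_integral_FTC_Icc[where F = H] DH) auto
    finally have e: "emeasure std_gauss {s - 1<..x} = ennreal (H x - H (s - 1))" .
    have "\<exists>y. (H has_real_derivative y) (at u) \<and> 0 \<le> y" if "s - 1 \<le> u" "u \<le> x" for u
      using DH[of u] that x by (intro exI[of _ "?p u"]) auto
    then have "H (s - 1) \<le> H x"
      using x by (intro DERIV_nonneg_imp_nondecreasing[of "s - 1" x H]) auto
    then have "measure std_gauss {s - 1<..x} = H x - H (s - 1)"
      using e by (simp add: measure_def)
    then show ?thesis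
      using std_gauss.cdf_diff_eq[of "s - 1" x] x by (simp add: gauss_cdf_eq_cdf)
  qed
  have "((\<lambda>x. gauss_cdf (s - 1) + (H x - H (s - 1))) has_real_derivative ?p s) (at s)"
    by (auto intro!: derivative_eq_intros DH)
  then show ?thesis
    by (rule has_field_derivative_transform_within_open[of _ _ _ "{s - 1<..<s + 1}"]) (auto simp: eq)
qed

lemmas DERIV_gauss_cdf_chain [derivative_intros] = DERIV_gauss_cdf[THEN DERIV_chain2]
lemmas DERIV_std_normal_density_chain [derivative_intros] = DERIV_std_normal_density[THEN DERIV_chain2]

lemma std_gauss_nn_integral_reflect:
  assumes [measurable]: "f \<in> borel_measurable borel"
  shows "(\<integral>\<^sup>+x. f (- x) \<partial>std_gauss) = (\<integral>\<^sup>+x. f x \<partial>std_gauss)"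
proof -
  have "(\<integral>\<^sup>+x. f x \<partial>std_gauss) = (\<integral>\<^sup>+x. ennreal (gauss_pdf (0 + - 1 * x)) * f (0 + - 1 * x) \<partial>lborel)"
    by (subst nn_integral_std_gauss, simp, subst nn_integral_real_affine[where t = 0 and c = "- 1"]) auto
  also have "\<dots> = (\<integral>\<^sup>+x. f (- x) \<partial>std_gauss)"
    by (subst nn_integral_std_gauss) (auto simp: std_normal_density_def)
  finally show ?thesis by simp
qed

lemma emeasure_std_gauss_atMost: "emeasure std_gauss {..s} = ennreal (gauss_cdf s)"
  by (simp add: gauss_cdf_def std_gauss.emeasure_eq_measure)

lemma emeasure_std_gauss_atLeast: "emeasure std_gauss {s..} = ennreal (1 - gauss_cdf s)"
proof -
  have "emeasure std_gauss {s..} = (\<integral>\<^sup>+x. ennreal (gauss_pdf x) * indicator {s..} x \<partial>lborel)"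
    by (rule emeasure_std_gauss) simp
  also have "\<dots> = ennreal (1 - gauss_cdf s)"
    by (rule nn_integral_FTC_atLeast[where F = gauss_cdf]) (auto intro: DERIV_gauss_cdf gauss_cdf_at_top)
  finally show ?thesis .
qed

lemma gauss_cdf_minus: "gauss_cdf (- s) = 1 - gauss_cdf s"
proof -
  have "(\<integral>\<^sup>+x. indicator {..- s} (- x) \<partial>std_gauss) = (\<integral>\<^sup>+x. indicator {s..} x \<partial>std_gauss)"
    by (intro nn_integral_cong) (auto simp: indicator_def)
  then have "emeasure std_gauss {..- s} = emeasure std_gauss {s..}"
    by (subst (asm) std_gauss_nn_integral_reflect) auto
  then show ?thesis
    unfolding emeasure_std_gauss_atMost emeasure_std_gauss_atLeast
    using gauss_cdf_bounds[of s] gauss_cdf_bounds[of "- s"] by (subst (asm) ennreal_inj) auto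
qed

text \<open>On the tail \<open>t \<le> x\<close>, and \<open>x * gauss_pdf x\<close> is the
  derivative of \<open>- gauss_pdf x\<close>.\<close>

lemma mills_bound:
  assumes "t > 0"
  shows "t * (1 - gauss_cdf t) \<le> gauss_pdf t"
proof -
  have "ennreal (t * (1 - gauss_cdf t)) = ennreal t * emeasure std_gauss {t..}"
    using assms gauss_cdf_bounds[of t] by (simp add: emeasure_std_gauss_atLeast ennreal_mult)
  also have "\<dots> = (\<integral>\<^sup>+x. ennreal t * (ennreal (gauss_pdf x) * indicator {t..} x) \<partial>lborel)"
    by (subst emeasure_std_gauss) (auto simp: nn_integral_cmult)
  also have "\<dots> \<le> (\<integral>\<^sup>+x. ennreal (x * gauss_pdf x) * indicator {t..} x \<partial>lborel)"
    using assms by (intro nn_integral_mono) (auto simp: indicator_def simp flip: ennreal_mult' intro!: ennreal_leI mult_right_mono)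
  also have "\<dots> = ennreal (0 - - gauss_pdf t)"
    using assms tendsto_minus[OF std_normal_density_at_top]
    by (intro nn_integral_FTC_atLeast[where F = "\<lambda>x. - gauss_pdf x"]) (auto intro!: derivative_eq_intros)
  finally show ?thesis by simp
qed

text \<open>The expression is the mean of the positive part of \<open>s - X\<close> for a standard
  normal \<open>X\<close>. For negative \<open>s\<close> its sign is the Mills bound at
  \<open>- s\<close>; it fixes the sign of the derivative in \<open>tail_mgf_le\<close>.\<close>

lemma density_plus_cdf_nonneg: "0 \<le> gauss_pdf s + s * gauss_cdf s"
proof (cases "s \<ge> 0")
  case True
  then show ?thesis using gauss_cdf_bounds[of s] by simp
next
  case False
  then show ?thesis
    using mills_bound[of "- s"] gauss_cdf_minus[of s] by (simp add: std_normal_density_def)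
qed

text \<open>Closed form of the mean of \<open>(max 0 (X - s))\<^sup>2\<close> for a standard normal
  \<open>X\<close>, a form that can be differentiated in \<open>s\<close>.\<close>

definition gauss_tail2 :: "real \<Rightarrow> real" where
  "gauss_tail2 s = (1 + s\<^sup>2) * (1 - gauss_cdf s) - s * gauss_pdf s"

lemma nn_integral_gauss_tail2:
  "(\<integral>\<^sup>+x. ennreal ((x - s)\<^sup>2 * gauss_pdf x) * indicator {s..} x \<partial>lborel) = ennreal (gauss_tail2 s)"
proof -
  \<comment> \<open>This function of \<open>x\<close> is the antiderivative: its derivative is
    \<open>((1 + s\<^sup>2) - 1 - x * (2 * s - x)) * gauss_pdf x\<close>, and the bracket is
    \<open>(x - s)\<^sup>2\<close>.\<close>
  have "((\<lambda>x. (1 + s\<^sup>2) * gauss_cdf x + (2 * s - x) * gauss_pdf x) \<longlongrightarrow> (1 + s\<^sup>2) * 1 + 0) at_top"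
  proof (intro tendsto_intros gauss_cdf_at_top)
    show "((\<lambda>x. (2 * s - x) * gauss_pdf x) \<longlongrightarrow> 0) at_top"
      unfolding std_normal_density_def by real_asymp
  qed
  then have "(\<integral>\<^sup>+x. ennreal ((x - s)\<^sup>2 * gauss_pdf x) * indicator {s..} x \<partial>lborel)
      = ennreal ((1 + s\<^sup>2) * 1 + 0 - ((1 + s\<^sup>2) * gauss_cdf s + (2 * s - s) * gauss_pdf s))"
    by (intro nn_integral_FTC_atLeast[where F = "\<lambda>x. (1 + s\<^sup>2) * gauss_cdf x + (2 * s - x) * gauss_pdf x"])
      (simp, (auto intro!: derivative_eq_intros simp: power2_eq_square algebra_simps)[1], simp_all)
  then show ?thesis by (simp add: gauss_tail2_def algebra_simps)
qed

lemma DERIV_gauss_tail2: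
  "(gauss_tail2 has_real_derivative - 2 * (gauss_pdf s - s * (1 - gauss_cdf s))) (at s)"
  unfolding gauss_tail2_def[abs_def]
  by (auto intro!: derivative_eq_intros simp: algebra_simps power2_eq_square)

lemma gauss_tail2_at_top: "(gauss_tail2 \<longlongrightarrow> 0) at_top"
proof -
  have "((\<lambda>s. (1 + s\<^sup>2) * (1 - gauss_cdf s)) \<longlongrightarrow> 0) at_top"
  proof (rule tendsto_sandwich[OF _ _ tendsto_const])
    show "\<forall>\<^sub>F s in at_top. 0 \<le> (1 + s\<^sup>2) * (1 - gauss_cdf s)"
      using gauss_cdf_bounds by (intro always_eventually allI mult_nonneg_nonneg) auto
    show "\<forall>\<^sub>F s in at_top. (1 + s\<^sup>2) * (1 - gauss_cdf s) \<le> (1 + s\<^sup>2) * (gauss_pdf s / s)"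
      using eventually_gt_at_top[of 0]
    proof eventually_elim
      case (elim s)
      then have "1 - gauss_cdf s \<le> gauss_pdf s / s"
        using mills_bound[of s] by (simp add: field_simps)
      then show ?case by (intro mult_left_mono) auto
    qed
    show "((\<lambda>s. (1 + s\<^sup>2) * (gauss_pdf s / s)) \<longlongrightarrow> 0) at_top"
      unfolding std_normal_density_def by real_asymp
  qed
  moreover have "((\<lambda>s. s * gauss_pdf s) \<longlongrightarrow> 0) at_top"
    unfolding std_normal_density_def by real_asymp
  ultimately show ?thesis
    unfolding gauss_tail2_def[abs_def] using tendsto_diff by fastforce
qed

section \<open>Exponential moments of truncated squares\<close>

lemma exp_mult_density_rescale:
  assumes "\<sigma> > 0" "\<sigma>\<^sup>2 = 1 - 2 * \<xi>"
  shows "exp (\<xi> * s\<^sup>2 / \<sigma>\<^sup>2) * gauss_pdf (s / \<sigma>) = gauss_pdf s"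
proof -
  have "\<xi> * s\<^sup>2 / \<sigma>\<^sup>2 + - (s / \<sigma>)\<^sup>2 / 2 = - (1 - 2 * \<xi>) * s\<^sup>2 / (2 * \<sigma>\<^sup>2)"
    by (simp add: power_divide diff_divide_distrib left_diff_distrib)
  also have "\<dots> = - s\<^sup>2 / 2" using assms(1) by (simp flip: assms(2))
  finally have "exp (\<xi> * s\<^sup>2 / \<sigma>\<^sup>2) * exp (- (s / \<sigma>)\<^sup>2 / 2) = exp (- s\<^sup>2 / 2)"
    by (simp only: exp_add[symmetric])
  then show ?thesis by (simp add: std_normal_density_def)
qed

context
  fixes \<xi> :: real
  assumes \<xi>: "0 < \<xi>" "\<xi> < 1 / 2"
begin

text \<open>Closed form of the mean of \<open>exp (\<xi> * (max 0 (X - s))\<^sup>2)\<close> for a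
  standard normal \<open>X\<close>; it is finite since \<open>\<xi> < 1 / 2\<close>.\<close>

definition tail_mgf :: "real \<Rightarrow> real" where
  "tail_mgf s = gauss_cdf s + exp (\<xi> * s\<^sup>2 / (1 - 2 * \<xi>)) / sqrt (1 - 2 * \<xi>) * (1 - gauss_cdf (s / sqrt (1 - 2 * \<xi>)))"

text \<open>Left of \<open>s\<close> the integrand is the plain density. To the right, completing
  the square gives a normal density in \<open>\<sigma> * x + 2 * \<xi> * s / \<sigma>\<close> with
  \<open>\<sigma>\<^sup>2 = 1 - 2 * \<xi>\<close>; this argument equals \<open>s / \<sigma>\<close>
  at \<open>x = s\<close>.\<close>

lemma nn_integral_tail_mgf:
  "(\<integral>\<^sup>+x. ennreal (exp (\<xi> * (max 0 (x - s))\<^sup>2)) \<partial>std_gauss) = ennreal (tail_mgf s)"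
proof -
  define \<sigma> where "\<sigma> = sqrt (1 - 2 * \<xi>)"
  have \<sigma>: "\<sigma> > 0" "\<sigma>\<^sup>2 = 1 - 2 * \<xi>" using \<xi> by (auto simp: \<sigma>_def)
  define E where "E = exp (\<xi> * s\<^sup>2 / \<sigma>\<^sup>2)"
  have "(\<integral>\<^sup>+x. ennreal (exp (\<xi> * (max 0 (x - s))\<^sup>2)) \<partial>std_gauss)
      = (\<integral>\<^sup>+x. ennreal (gauss_pdf x) * ennreal (exp (\<xi> * (max 0 (x - s))\<^sup>2)) \<partial>lborel)"
    by (rule nn_integral_std_gauss) simp
  also have "\<dots> = (\<integral>\<^sup>+x. ennreal (gauss_pdf x) * indicator {..s} x
      + ennreal (E * gauss_pdf (\<sigma> * x + 2 * \<xi> * s / \<sigma>)) * indicator {s..} x \<partial>lborel)"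
  proof (rule nn_integral_cong_AE, rule AE_mp[OF AE_lborel_singleton[of s]], rule AE_I2, rule impI)
    fix x :: real assume "x \<noteq> s"
    then consider "x < s" | "x > s" by linarith
    then show "ennreal (gauss_pdf x) * ennreal (exp (\<xi> * (max 0 (x - s))\<^sup>2)) =
        ennreal (gauss_pdf x) * indicator {..s} x
      + ennreal (E * gauss_pdf (\<sigma> * x + 2 * \<xi> * s / \<sigma>)) * indicator {s..} x"
    proof cases
      case 1
      then show ?thesis by simp
    next
      case 2
      have "- x\<^sup>2 / 2 + \<xi> * (x - s)\<^sup>2 = \<xi> * s\<^sup>2 / \<sigma>\<^sup>2 + - (\<sigma> * x + 2 * \<xi> * s / \<sigma>)\<^sup>2 / 2"
      proof -
        define R where "R = 2 * \<xi>\<^sup>2 * s\<^sup>2 / \<sigma>\<^sup>2"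
        have 1: "(\<sigma> * x + 2 * \<xi> * s / \<sigma>)\<^sup>2 = (1 - 2 * \<xi>) * x\<^sup>2 + 4 * \<xi> * s * x + 2 * R"
          using \<sigma>(1) by (simp add: R_def power2_sum power_mult_distrib power_divide flip: \<sigma>(2))
        have "\<xi> * s\<^sup>2 / \<sigma>\<^sup>2 = \<xi> * s\<^sup>2 * (\<sigma>\<^sup>2 + 2 * \<xi>) / \<sigma>\<^sup>2" using \<sigma>(2) by simp
        also have "\<dots> = \<xi> * s\<^sup>2 + R"
          using \<sigma>(1) by (simp add: R_def add_divide_distrib distrib_left power2_eq_square)
        finally have 2: "\<xi> * s\<^sup>2 / \<sigma>\<^sup>2 = \<xi> * s\<^sup>2 + R" .
        show ?thesis unfolding 1 2 by (simp add: power2_eq_square field_simps)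
      qed
      then have "gauss_pdf x * exp (\<xi> * (x - s)\<^sup>2) = E * gauss_pdf (\<sigma> * x + 2 * \<xi> * s / \<sigma>)"
        unfolding std_normal_density_def E_def by (simp add: field_simps flip: exp_add)
      then show ?thesis using 2 by (simp flip: ennreal_mult')
    qed
  qed
  also have "\<dots> = (\<integral>\<^sup>+x. ennreal (gauss_pdf x) * indicator {..s} x \<partial>lborel)
      + (\<integral>\<^sup>+x. ennreal (E * gauss_pdf (\<sigma> * x + 2 * \<xi> * s / \<sigma>)) * indicator {s..} x \<partial>lborel)"
    by (rule nn_integral_add) auto
  also have "(\<integral>\<^sup>+x. ennreal (gauss_pdf x) * indicator {..s} x \<partial>lborel) = ennreal (gauss_cdf s)"
    by (simp add: emeasure_std_gauss flip: emeasure_std_gauss_atMost)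
  also have "(\<integral>\<^sup>+x. ennreal (E * gauss_pdf (\<sigma> * x + 2 * \<xi> * s / \<sigma>)) * indicator {s..} x \<partial>lborel)
      = ennreal (E / \<sigma> * 1 - E / \<sigma> * gauss_cdf (\<sigma> * s + 2 * \<xi> * s / \<sigma>))"
  proof (rule nn_integral_FTC_atLeast[where F = "\<lambda>x. E / \<sigma> * gauss_cdf (\<sigma> * x + 2 * \<xi> * s / \<sigma>)"])
    show "((\<lambda>x. E / \<sigma> * gauss_cdf (\<sigma> * x + 2 * \<xi> * s / \<sigma>)) \<longlongrightarrow> E / \<sigma> * 1) at_top"
    proof (intro tendsto_intros filterlim_compose[OF gauss_cdf_at_top])
      show "LIM x at_top. \<sigma> * x + 2 * \<xi> * s / \<sigma> :> at_top" using \<sigma>(1) by real_asymp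
    qed
    show "DERIV (\<lambda>x. E / \<sigma> * gauss_cdf (\<sigma> * x + 2 * \<xi> * s / \<sigma>)) x :> E * gauss_pdf (\<sigma> * x + 2 * \<xi> * s / \<sigma>)" for x
      using \<sigma>(1) by (auto intro!: derivative_eq_intros)
  qed (auto simp: E_def)
  also have "\<sigma> * s + 2 * \<xi> * s / \<sigma> = s / \<sigma>"
  proof -
    have "\<sigma> * s + 2 * \<xi> * s / \<sigma> = (\<sigma>\<^sup>2 + 2 * \<xi>) * s / \<sigma>"
      using \<sigma>(1) by (simp add: field_simps power2_eq_square)
    then show ?thesis by (simp add: \<sigma>(2))
  qed
  also have "E / \<sigma> * 1 - E / \<sigma> * gauss_cdf (s / \<sigma>) = E / \<sigma> * (1 - gauss_cdf (s / \<sigma>))"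
    by (simp add: algebra_simps)
  also have "ennreal (gauss_cdf s) + ennreal (E / \<sigma> * (1 - gauss_cdf (s / \<sigma>))) = ennreal (gauss_cdf s + E / \<sigma> * (1 - gauss_cdf (s / \<sigma>)))"
    using \<sigma>(1) gauss_cdf_bounds by (intro ennreal_plus[symmetric]) (auto simp: E_def)
  finally show ?thesis
    by (simp add: tail_mgf_def E_def \<sigma>(2)) (simp add: \<sigma>_def)
qed

lemma tail_mgf_ge_1: "tail_mgf s \<ge> 1"
proof -
  have "ennreal 1 = (\<integral>\<^sup>+x. 1 \<partial>std_gauss)"
    using std_gauss.emeasure_space_1 by simp
  also have "\<dots> \<le> (\<integral>\<^sup>+x. ennreal (exp (\<xi> * (max 0 (x - s))\<^sup>2)) \<partial>std_gauss)"
    using \<xi> by (intro nn_integral_mono) (simp add: ennreal_1[symmetric] del: ennreal_1)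
  also note nn_integral_tail_mgf
  finally show ?thesis by (simp add: ennreal_le_iff2)
qed

text \<open>The derivative is expressed through \<open>tail_mgf\<close> itself, the exponential
  factor being eliminated by \<open>exp_mult_density_rescale\<close>. In this form it matches
  \<open>DERIV_gauss_tail2\<close> term by term in \<open>tail_mgf_le\<close>.\<close>

lemma DERIV_tail_mgf:
  "(tail_mgf has_real_derivative - (2 * \<xi> / (1 - 2 * \<xi>)) * (gauss_pdf s - s * (tail_mgf s - gauss_cdf s))) (at s)"
proof -
  define \<sigma> where "\<sigma> = sqrt (1 - 2 * \<xi>)"
  have \<sigma>: "\<sigma> > 0" "\<sigma>\<^sup>2 = 1 - 2 * \<xi>" using \<xi> by (auto simp: \<sigma>_def)
  define E where "E s = exp (\<xi> * s\<^sup>2 / \<sigma>\<^sup>2)" for s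
  have mgf: "tail_mgf s = gauss_cdf s + E s / \<sigma> * (1 - gauss_cdf (s / \<sigma>))" for s
    by (simp add: tail_mgf_def E_def \<sigma>(2)) (simp add: \<sigma>_def)
  have DE: "(E has_real_derivative (2 * \<xi> * s / \<sigma>\<^sup>2) * E s) (at s)"
    unfolding E_def[abs_def] using \<sigma>(1) by (auto intro!: derivative_eq_intros simp: power2_eq_square)
  have E: "E s * gauss_pdf (s / \<sigma>) = gauss_pdf s"
    unfolding E_def by (rule exp_mult_density_rescale[OF \<sigma>])
  have "(tail_mgf has_real_derivative gauss_pdf s + (2 * \<xi> * s / \<sigma>\<^sup>2) * (E s / \<sigma> * (1 - gauss_cdf (s / \<sigma>)))
      - E s * gauss_pdf (s / \<sigma>) / \<sigma>\<^sup>2) (at s)"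
    unfolding mgf[abs_def] using \<sigma>(1)
    by (auto intro!: derivative_eq_intros DE DERIV_gauss_cdf simp: power2_eq_square field_simps)
  also have "E s / \<sigma> * (1 - gauss_cdf (s / \<sigma>)) = tail_mgf s - gauss_cdf s"
    by (simp add: mgf)
  also have "gauss_pdf s + (2 * \<xi> * s / \<sigma>\<^sup>2) * (tail_mgf s - gauss_cdf s) - E s * gauss_pdf (s / \<sigma>) / \<sigma>\<^sup>2
      = - (2 * \<xi> / \<sigma>\<^sup>2) * (gauss_pdf s - s * (tail_mgf s - gauss_cdf s))"
  proof -
    have "gauss_pdf s - gauss_pdf s / \<sigma>\<^sup>2 = - (2 * \<xi> / \<sigma>\<^sup>2) * gauss_pdf s"
    proof -
      have "2 * \<xi> = 1 - \<sigma>\<^sup>2" using \<sigma>(2) by simp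
      then show ?thesis using \<sigma>(1) by (simp only:) (simp add: field_simps)
    qed
    moreover define c where "c = 2 * \<xi> / \<sigma>\<^sup>2"
    moreover have "2 * \<xi> * s / \<sigma>\<^sup>2 = c * s" by (simp add: c_def)
    ultimately have "gauss_pdf s - gauss_pdf s / \<sigma>\<^sup>2 = - c * gauss_pdf s"
      "2 * \<xi> * s / \<sigma>\<^sup>2 = c * s" "2 * \<xi> / \<sigma>\<^sup>2 = c" by simp_all
    then show ?thesis unfolding E by (simp add: algebra_simps)
  qed
  finally show ?thesis by (simp only: \<sigma>(2))
qed

lemma tail_mgf_at_top: "(tail_mgf \<longlongrightarrow> 1) at_top"
proof -
  define \<sigma> where "\<sigma> = sqrt (1 - 2 * \<xi>)"
  have \<sigma>: "\<sigma> > 0" "\<sigma>\<^sup>2 = 1 - 2 * \<xi>" using \<xi> by (auto simp: \<sigma>_def)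
  have "((\<lambda>s. exp (\<xi> * s\<^sup>2 / \<sigma>\<^sup>2) / \<sigma> * (1 - gauss_cdf (s / \<sigma>))) \<longlongrightarrow> 0) at_top"
  proof (rule tendsto_sandwich[OF _ _ tendsto_const])
    show "\<forall>\<^sub>F s in at_top. 0 \<le> exp (\<xi> * s\<^sup>2 / \<sigma>\<^sup>2) / \<sigma> * (1 - gauss_cdf (s / \<sigma>))"
      using \<sigma>(1) gauss_cdf_bounds by (intro always_eventually allI mult_nonneg_nonneg) auto
    show "\<forall>\<^sub>F s in at_top. exp (\<xi> * s\<^sup>2 / \<sigma>\<^sup>2) / \<sigma> * (1 - gauss_cdf (s / \<sigma>)) \<le> gauss_pdf s / s"
      using eventually_gt_at_top[of 0]
    proof eventually_elim
      case (elim s)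
      have "1 - gauss_cdf (s / \<sigma>) \<le> gauss_pdf (s / \<sigma>) / (s / \<sigma>)"
        using mills_bound[of "s / \<sigma>"] elim \<sigma>(1) by (simp add: field_simps)
      then have "exp (\<xi> * s\<^sup>2 / \<sigma>\<^sup>2) / \<sigma> * (1 - gauss_cdf (s / \<sigma>))
          \<le> exp (\<xi> * s\<^sup>2 / \<sigma>\<^sup>2) / \<sigma> * (gauss_pdf (s / \<sigma>) / (s / \<sigma>))"
        using \<sigma>(1) by (intro mult_left_mono) auto
      also have "\<dots> = (exp (\<xi> * s\<^sup>2 / \<sigma>\<^sup>2) * gauss_pdf (s / \<sigma>)) / s"
        using \<sigma>(1) elim by simp
      also have "exp (\<xi> * s\<^sup>2 / \<sigma>\<^sup>2) * gauss_pdf (s / \<sigma>) = gauss_pdf s"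
        by (rule exp_mult_density_rescale[OF \<sigma>])
      finally show ?case .
    qed
    show "((\<lambda>s. gauss_pdf s / s) \<longlongrightarrow> 0) at_top"
      unfolding std_normal_density_def by real_asymp
  qed
  then have "((\<lambda>s. gauss_cdf s + exp (\<xi> * s\<^sup>2 / \<sigma>\<^sup>2) / \<sigma> * (1 - gauss_cdf (s / \<sigma>))) \<longlongrightarrow> 1 + 0) at_top"
    by (intro tendsto_add gauss_cdf_at_top)
  then show ?thesis by (simp add: tail_mgf_def[abs_def] \<sigma>(2)) (simp add: \<sigma>_def)
qed

text \<open>The logarithm of the quotient of both sides tends to \<open>0\<close> at infinity, and its derivative is a
  positive multiple of \<open>(gauss_pdf s + s * gauss_cdf s) * (1 - tail_mgf s)\<close>, hence nonpositive.\<close>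

lemma tail_mgf_le: "tail_mgf s \<le> exp (\<xi> / (1 - 2 * \<xi>) * gauss_tail2 s)"
proof -
  define D where "D s = \<xi> / (1 - 2 * \<xi>) * gauss_tail2 s - ln (tail_mgf s)" for s
  have mgf_pos: "tail_mgf s > 0" for s using tail_mgf_ge_1[of s] by linarith
  have "\<exists>y. (D has_real_derivative y) (at s) \<and> y \<le> 0" for s
  proof (intro exI conjI)
    define c where "c = \<xi> / (1 - 2 * \<xi>)"
    let ?p = "gauss_pdf s" and ?P = "gauss_cdf s" and ?M = "tail_mgf s"
    have c2: "2 * \<xi> / (1 - 2 * \<xi>) = 2 * c" by (simp add: c_def)
    have c: "c > 0" using \<xi> by (simp add: c_def)
    have "(D has_real_derivative c * (- 2 * (?p - s * (1 - ?P))) - - (2 * c) * (?p - s * (?M - ?P)) / ?M) (at s)"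
      unfolding D_def[abs_def] c_def[symmetric] c2[symmetric] using mgf_pos[of s]
      by (auto intro!: derivative_eq_intros DERIV_gauss_tail2 DERIV_tail_mgf)
    also have "c * (- 2 * (?p - s * (1 - ?P))) - - (2 * c) * (?p - s * (?M - ?P)) / ?M
        = - (2 * c) * ((?p - s * (1 - ?P)) - (?p - s * (?M - ?P)) / ?M)" by (simp add: algebra_simps)
    also have "(?p - s * (1 - ?P)) - (?p - s * (?M - ?P)) / ?M = (?p + s * ?P) * (?M - 1) / ?M"
      using mgf_pos[of s] by (simp add: field_simps)
    finally show "(D has_real_derivative - (2 * c) * ((?p + s * ?P) * (?M - 1) / ?M)) (at s)" .
    show "- (2 * c) * ((?p + s * ?P) * (?M - 1) / ?M) \<le> 0"
      using c mgf_pos[of s] tail_mgf_ge_1[of s] density_plus_cdf_nonneg[of s]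
      by (intro mult_nonpos_nonneg divide_nonneg_nonneg mult_nonneg_nonneg) auto
  qed
  then have mono: "D t \<le> D s" if "s \<le> t" for s t
    using DERIV_nonpos_imp_nonincreasing[OF that, of D] by blast
  have lim: "(D \<longlongrightarrow> \<xi> / (1 - 2 * \<xi>) * 0 - ln 1) at_top"
    unfolding D_def[abs_def] by (intro tendsto_intros gauss_tail2_at_top tail_mgf_at_top) auto
  have "\<xi> / (1 - 2 * \<xi>) * 0 - ln 1 \<le> D s"
    by (rule tendsto_upperbound[OF lim]) (use mono in \<open>auto simp: eventually_at_top_linorder\<close>)
  then have "ln (tail_mgf s) \<le> \<xi> / (1 - 2 * \<xi>) * gauss_tail2 s" by (simp add: D_def)
  then show ?thesis using mgf_pos[of s] by (metis exp_ln exp_le_cancel_iff)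
qed

end

lemma nn_integral_exp_trunc_square_le:
  assumes \<xi>: "0 < \<xi>" "\<xi> < 1 / 2" and s: "s = 1 \<or> s = - 1"
  shows "(\<integral>\<^sup>+x. ennreal (exp (\<xi> * (max 0 (s * x - t))\<^sup>2)) \<partial>std_gauss) \<le> ennreal (exp (\<xi> / (1 - 2 * \<xi>) * gauss_tail2 t))"
proof -
  have "(\<integral>\<^sup>+x. ennreal (exp (\<xi> * (max 0 (s * x - t))\<^sup>2)) \<partial>std_gauss) = (\<integral>\<^sup>+x. ennreal (exp (\<xi> * (max 0 (x - t))\<^sup>2)) \<partial>std_gauss)"
    using s std_gauss_nn_integral_reflect[of "\<lambda>x. ennreal (exp (\<xi> * (max 0 (x - t))\<^sup>2))"] by auto
  also have "\<dots> = ennreal (tail_mgf \<xi> t)"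
    by (rule nn_integral_tail_mgf[OF \<xi>])
  also have "\<dots> \<le> ennreal (exp (\<xi> / (1 - 2 * \<xi>) * gauss_tail2 t))"
    by (intro ennreal_leI tail_mgf_le[OF \<xi>])
  finally show ?thesis .
qed

text \<open>The square root is linearised by \<open>sqrt F \<le> F / (2 * a) + a / 2\<close> with \<open>a = lam + sqrt \<delta>\<close>, which turns
  the integrand into a product; this choice of \<open>a\<close> reproduces the Gaussian concentration bound exactly.\<close>

lemma nn_integral_exp_sqrt_trunc_squares_le:
  fixes s t :: "'j \<Rightarrow> real"
  assumes fin: "finite J" and s: "\<And>j. j \<in> J \<Longrightarrow> s j = 1 \<or> s j = - 1"
    and lam: "lam > 0" and \<delta>: "\<delta> > 0" "(\<Sum>j\<in>J. gauss_tail2 (t j)) \<le> \<delta>"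
  shows "(\<integral>\<^sup>+g. ennreal (exp (lam * sqrt (\<Sum>j\<in>J. (max 0 (s j * g j - t j))\<^sup>2))) \<partial>gaussian J) \<le> ennreal (exp (lam\<^sup>2 / 2 + lam * sqrt \<delta>))"
proof -
  define b where "b = sqrt \<delta>"
  define a where "a = lam + b"
  define \<xi> where "\<xi> = lam / (2 * a)"
  have b: "b > 0" "b * b = \<delta>" and a: "a > 0" using \<delta> lam by (auto simp: b_def a_def add_pos_pos)
  have \<xi>: "0 < \<xi>" "\<xi> < 1 / 2" using lam b a by (auto simp: \<xi>_def field_simps a_def)
  \<comment> \<open>Hence the factor in front of the truncated means is
    \<open>lam / (2 * b)\<close>, and their sum, at most \<open>b * b\<close>, contributes
    \<open>lam * b / 2\<close>. Together with \<open>lam * a / 2\<close> this is exactly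
    \<open>lam\<^sup>2 / 2 + lam * b\<close>. Positivity of \<open>\<delta>\<close> makes
    \<open>\<xi> < 1 / 2\<close> strict.\<close>
  have "1 - 2 * \<xi> = b / a" using a by (simp add: \<xi>_def field_simps a_def)
  then have \<xi>': "\<xi> / (1 - 2 * \<xi>) = lam / (2 * b)" using a b by (simp add: \<xi>_def)
  have le: "lam * sqrt F \<le> lam * a / 2 + \<xi> * F" if "F \<ge> 0" for F
  proof -
    have "0 \<le> (sqrt F - a)\<^sup>2" by simp
    then have "2 * a * sqrt F \<le> F + a\<^sup>2" using that by (simp add: power2_diff mult_ac)
    then have "lam * (2 * a * sqrt F) / (2 * a) \<le> lam * (F + a\<^sup>2) / (2 * a)"
      using lam a by (intro divide_right_mono mult_left_mono) auto
    then show ?thesis using a by (simp add: \<xi>_def field_simps power2_eq_square)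
  qed
  have "(\<integral>\<^sup>+g. ennreal (exp (lam * sqrt (\<Sum>j\<in>J. (max 0 (s j * g j - t j))\<^sup>2))) \<partial>gaussian J)
      \<le> (\<integral>\<^sup>+g. ennreal (exp (lam * a / 2)) * (\<Prod>j\<in>J. ennreal (exp (\<xi> * (max 0 (s j * g j - t j))\<^sup>2))) \<partial>gaussian J)"
  proof (rule nn_integral_mono)
    fix g :: "'j \<Rightarrow> real"
    have "exp (lam * sqrt (\<Sum>j\<in>J. (max 0 (s j * g j - t j))\<^sup>2)) \<le> exp (lam * a / 2 + \<xi> * (\<Sum>j\<in>J. (max 0 (s j * g j - t j))\<^sup>2))"
      by (subst exp_le_cancel_iff, rule le) (auto intro: sum_nonneg)
    also have "\<dots> = exp (lam * a / 2) * (\<Prod>j\<in>J. exp (\<xi> * (max 0 (s j * g j - t j))\<^sup>2))"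
      using fin by (simp add: exp_add exp_sum sum_distrib_left)
    finally show "ennreal (exp (lam * sqrt (\<Sum>j\<in>J. (max 0 (s j * g j - t j))\<^sup>2)))
        \<le> ennreal (exp (lam * a / 2)) * (\<Prod>j\<in>J. ennreal (exp (\<xi> * (max 0 (s j * g j - t j))\<^sup>2)))"
      by (simp add: prod_ennreal ennreal_leI flip: ennreal_mult')
  qed
  also have "\<dots> = ennreal (exp (lam * a / 2)) * (\<integral>\<^sup>+g. (\<Prod>j\<in>J. ennreal (exp (\<xi> * (max 0 (s j * g j - t j))\<^sup>2))) \<partial>gaussian J)"
    by (intro nn_integral_cmult borel_measurable_prod_ennreal) measurable
  also have "(\<integral>\<^sup>+g. (\<Prod>j\<in>J. ennreal (exp (\<xi> * (max 0 (s j * g j - t j))\<^sup>2))) \<partial>gaussian J)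
      = (\<Prod>j\<in>J. \<integral>\<^sup>+x. ennreal (exp (\<xi> * (max 0 (s j * x - t j))\<^sup>2)) \<partial>std_gauss)"
    using fin by (intro gaussian.product_nn_integral_prod) auto
  also have "\<dots> \<le> (\<Prod>j\<in>J. ennreal (exp (\<xi> / (1 - 2 * \<xi>) * gauss_tail2 (t j))))"
    by (intro prod_mono_ennreal nn_integral_exp_trunc_square_le \<xi> s)
  also have "\<dots> = ennreal (exp (\<xi> / (1 - 2 * \<xi>) * (\<Sum>j\<in>J. gauss_tail2 (t j))))"
    using fin by (simp add: prod_ennreal exp_sum sum_distrib_left)
  also have "\<dots> \<le> ennreal (exp (lam * b / 2))"
  proof (intro ennreal_leI, subst exp_le_cancel_iff)
    have "lam / (2 * b) * (\<Sum>j\<in>J. gauss_tail2 (t j)) \<le> lam / (2 * b) * \<delta>"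
      using \<delta> lam b by (intro mult_left_mono) auto
    also have "\<dots> = lam * b / 2" using b by (simp add: field_simps flip: b(2))
    finally show "\<xi> / (1 - 2 * \<xi>) * (\<Sum>j\<in>J. gauss_tail2 (t j)) \<le> lam * b / 2" by (simp only: \<xi>')
  qed
  also have "ennreal (exp (lam * a / 2)) * ennreal (exp (lam * b / 2)) = ennreal (exp (lam\<^sup>2 / 2 + lam * sqrt \<delta>))"
    unfolding b_def[symmetric]
    by (simp add: a_def field_simps power2_eq_square flip: ennreal_mult' exp_add)
  finally show ?thesis by (simp add: mult_left_mono)
qed

subsection \<open>The norm of a Gaussian vector\<close>

lemma gaussian_eq_density:
  assumes "finite A"
  shows "gaussian A = density (PiM A (\<lambda>_. lborel)) (\<lambda>z. ennreal (\<Prod>i\<in>A. gauss_pdf (z i)))"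
proof (rule gaussian.PiM_eqI[OF assms, symmetric])
  interpret L: product_sigma_finite "\<lambda>_::'a. lborel :: real measure" ..
  show "sets (density (PiM A (\<lambda>_. lborel)) (\<lambda>z. ennreal (\<Prod>i\<in>A. gauss_pdf (z i)))) = sets (gaussian A)"
    by (simp cong: sets_PiM_cong)
  fix X :: "'a \<Rightarrow> real set" assume "\<And>i. i \<in> A \<Longrightarrow> X i \<in> sets std_gauss"
  then have X: "\<And>i. i \<in> A \<Longrightarrow> X i \<in> sets borel" by simp
  then have X': "Pi\<^sub>E A X \<in> sets (PiM A (\<lambda>_. lborel :: real measure))"
    using assms by (intro sets_PiM_I_finite) auto
  have "emeasure (density (PiM A (\<lambda>_. lborel)) (\<lambda>z. ennreal (\<Prod>i\<in>A. gauss_pdf (z i)))) (Pi\<^sub>E A X)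
      = (\<integral>\<^sup>+z. ennreal (\<Prod>i\<in>A. gauss_pdf (z i)) * indicator (Pi\<^sub>E A X) z \<partial>PiM A (\<lambda>_. lborel))"
    using X' by (intro emeasure_density) auto
  also have "\<dots> = (\<integral>\<^sup>+z. (\<Prod>i\<in>A. ennreal (gauss_pdf (z i)) * indicator (X i) (z i)) \<partial>PiM A (\<lambda>_. lborel))"
  proof (rule nn_integral_cong)
    fix z :: "'a \<Rightarrow> real" assume z: "z \<in> space (PiM A (\<lambda>_. lborel))"
    have "(\<Prod>i\<in>A. indicator (X i) (z i) :: ennreal) = indicator (Pi\<^sub>E A X) z"
      using z assms by (auto simp: indicator_def space_PiM PiE_def Pi_def prod_zero_iff split: if_splits)
    then show "ennreal (\<Prod>i\<in>A. gauss_pdf (z i)) * indicator (Pi\<^sub>E A X) z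
        = (\<Prod>i\<in>A. ennreal (gauss_pdf (z i)) * indicator (X i) (z i))"
      by (simp add: prod.distrib prod_ennreal)
  qed
  also have "\<dots> = (\<Prod>i\<in>A. \<integral>\<^sup>+x. ennreal (gauss_pdf x) * indicator (X i) x \<partial>lborel)"
    using assms X by (intro L.product_nn_integral_prod) auto
  also have "\<dots> = (\<Prod>i\<in>A. emeasure std_gauss (X i))"
    using X by (intro prod.cong refl emeasure_std_gauss[symmetric])
  finally show "emeasure (density (PiM A (\<lambda>_. lborel)) (\<lambda>z. ennreal (\<Prod>i\<in>A. gauss_pdf (z i)))) (Pi\<^sub>E A X)
      = (\<Prod>i\<in>A. emeasure std_gauss (X i))" .
qed

text \<open>Polar coordinates for radial functions, drawn from the volume of balls alone: both
  measures give the half-line up to \<open>r\<close> the mass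
  \<open>\<omega> * (max 0 r) ^ m\<close>, and half-lines generate the Borel sets.\<close>

lemma distr_norm_PiM_lborel:
  assumes fin: "finite A" and ne: "A \<noteq> {}"
  shows "distr (PiM A (\<lambda>_. lborel)) borel (\<lambda>z. vec_norm A z)
    = density lborel (\<lambda>r. ennreal (real (card A) * unit_ball_vol (real (card A)) * r ^ (card A - 1)) * indicator {0..} r)"
    (is "?D = ?N")
proof -
  define m where "m = card A"
  have m: "m > 0" using fin ne by (simp add: m_def card_gt_0_iff)
  define \<omega> where "\<omega> = unit_ball_vol (real m)"
  have \<omega>: "\<omega> > 0" by (simp add: \<omega>_def)
  have [measurable]: "(\<lambda>z. vec_norm A z) \<in> borel_measurable (PiM A (\<lambda>_. lborel))"
    by measurable
  have D: "emeasure ?D {..r} = ennreal (\<omega> * (max 0 r) ^ m)" for r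
  proof -
    have eq: "emeasure ?D {..r} = emeasure (PiM A (\<lambda>_. lborel)) ({f. sqrt (\<Sum>i\<in>A. (f i)\<^sup>2) \<le> r} \<inter> space (PiM A (\<lambda>_. lborel)))" for r
      by (subst emeasure_distr) (auto intro!: arg_cong2[where f = emeasure])
    have pos: "emeasure ?D {..r} = ennreal (\<omega> * r ^ m)" if "r > 0" for r
      unfolding eq \<omega>_def m_def by (rule emeasure_cball_aux[OF fin that])
    show ?thesis
    proof (cases "r > 0")
      \<comment> \<open>A nonpositive radius is squeezed below the radii \<open>1 / (n + 1)\<close>,
        whose balls have volume tending to 0 because \<open>m > 0\<close>.\<close>
      case False
      have le: "emeasure ?D {..r} \<le> ennreal (\<omega> * (1 / real (Suc n)) ^ m)" for n
      proof -
        have "r \<le> 1 / real (Suc n)" using False by (rule_tac order_trans[of r 0]) auto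
        then have "emeasure ?D {..r} \<le> emeasure ?D {..1 / real (Suc n)}" by (intro emeasure_mono) auto
        also have "\<dots> = ennreal (\<omega> * (1 / real (Suc n)) ^ m)" by (rule pos) simp
        finally show ?thesis .
      qed
      have lim: "(\<lambda>n. ennreal (\<omega> * (1 / real (Suc n)) ^ m)) \<longlonglongrightarrow> ennreal (\<omega> * 0 ^ m)"
        by (intro tendsto_ennrealI tendsto_mult tendsto_const tendsto_power LIMSEQ_Suc[OF lim_1_over_real])
      have "emeasure ?D {..r} \<le> ennreal (\<omega> * 0 ^ m)"
        by (rule LIMSEQ_le_const[OF lim]) (use le in blast)
      then show ?thesis using False m by (simp add: power_0_left max_absorb1)
    qed (use pos in simp)
  qed
  have N: "emeasure ?N {..r} = ennreal (\<omega> * (max 0 r) ^ m)" for r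
  proof -
    have "emeasure ?N {..r} = (\<integral>\<^sup>+x. ennreal (real m * \<omega> * x ^ (m - 1)) * indicator {0..} x * indicator {..r} x \<partial>lborel)"
      unfolding m_def \<omega>_def by (subst emeasure_density) auto
    also have "\<dots> = ennreal (\<omega> * (max 0 r) ^ m)"
    proof (cases "r \<ge> 0")
      case True
      have "(\<integral>\<^sup>+x. ennreal (real m * \<omega> * x ^ (m - 1)) * indicator {0..} x * indicator {..r} x \<partial>lborel)
          = (\<integral>\<^sup>+x. ennreal (real m * \<omega> * x ^ (m - 1)) * indicator {0..r} x \<partial>lborel)"
        by (intro nn_integral_cong) (auto simp: indicator_def)
      also have "\<dots> = ennreal (\<omega> * r ^ m - \<omega> * 0 ^ m)"
        using True \<omega> by (intro nn_integral_FTC_Icc[where F = "\<lambda>x. \<omega> * x ^ m"]) (auto intro!: derivative_eq_intros)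
      finally show ?thesis using True m by (simp add: power_0_left)
    next
      case False
      then have "(\<integral>\<^sup>+x. ennreal (real m * \<omega> * x ^ (m - 1)) * indicator {0..} x * indicator {..r} x \<partial>lborel) = (\<integral>\<^sup>+x. 0 \<partial>(lborel :: real measure))"
        by (intro nn_integral_cong) (auto simp: indicator_def)
      then show ?thesis using False m by (simp add: power_0_left max_absorb1)
    qed
    finally show ?thesis .
  qed
  have B: "sets (borel :: real measure) = sigma_sets UNIV (range (\<lambda>r. {..r}))"
    by (subst borel_eq_atMost) (rule sets_measure_of, simp)
  show ?thesis
  proof (rule measure_eqI_generator_eq[where E = "range (\<lambda>r::real. {..r})" and \<Omega> = UNIV and A = "\<lambda>n. {..real n}"])
    show "Int_stable (range (\<lambda>r::real. {..r}))"
      by (auto simp: Int_stable_def)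
    show "emeasure ?D X = emeasure ?N X" if X_in: "X \<in> range (\<lambda>r::real. {..r})" for X
      proof -
      obtain r where X: "X = {..r}" using X_in by blast
      show ?thesis unfolding X D N ..
    qed
    show "sets ?D = sigma_sets UNIV (range (\<lambda>r::real. {..r}))" "sets ?N = sigma_sets UNIV (range (\<lambda>r::real. {..r}))"
      using B by (simp_all only: sets_distr sets_density sets_lborel)
    have "x \<in> (\<Union>n. {..real n})" for x
      using real_arch_simple[of x] by (simp add: Bex_def)
    then show "(\<Union>n. {..real n}) = UNIV" by blast
    show "emeasure ?D {..real n} \<noteq> \<infinity>" for n unfolding D by simp
    show "range (\<lambda>r::real. {..r}) \<subseteq> Pow UNIV" by simp
    show "range (\<lambda>n. {..real n}) \<subseteq> range (\<lambda>r::real. {..r})" by blast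
  qed
qed

text \<open>The Gaussian density depends on the norm only, so integrals of radial functions reduce
  to the half-line. The constant stays implicit; normalisation pins it down where its value
  matters.\<close>

lemma gaussian_radial:
  assumes fin: "finite A" and ne: "A \<noteq> {}"
  shows "\<exists>c>0. \<forall>f\<in>borel_measurable borel. (\<integral>\<^sup>+z. f (vec_norm A z) \<partial>gaussian A)
      = (\<integral>\<^sup>+r. ennreal (c * r ^ (card A - 1) * exp (- r\<^sup>2 / 2)) * f r * indicator {0<..} r \<partial>lborel)"
proof -
  define m where "m = card A"
  have m: "m > 0" using fin ne by (simp add: m_def card_gt_0_iff)
  define d where "d = real m * unit_ball_vol (real m)"
  have d: "d > 0" using m by (simp add: d_def)
  define e where "e = (1 / sqrt (2 * pi)) ^ m"
  have e: "e > 0" by (simp add: e_def)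
  have dens: "(\<Prod>i\<in>A. gauss_pdf (z i)) = e * exp (- (vec_norm A z)\<^sup>2 / 2)" for z
  proof -
    have "(\<Sum>i\<in>A. - (z i)\<^sup>2 / 2) = - (\<Sum>i\<in>A. (z i)\<^sup>2) / 2"
      by (simp only: sum_divide_distrib[symmetric] sum_negf)
    also have "\<dots> = - (vec_norm A z)\<^sup>2 / 2" by (simp add: sum_nonneg)
    finally show ?thesis
      unfolding std_normal_density_def prod.distrib exp_sum[OF fin, symmetric] e_def m_def by (simp only: prod_constant)
  qed
  have "(\<integral>\<^sup>+z. f (vec_norm A z) \<partial>gaussian A)
      = (\<integral>\<^sup>+r. ennreal (e * d * r ^ (m - 1) * exp (- r\<^sup>2 / 2)) * f r * indicator {0<..} r \<partial>lborel)"
    if [measurable]: "f \<in> borel_measurable borel" for f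
  proof -
    have "(\<integral>\<^sup>+z. f (vec_norm A z) \<partial>gaussian A)
        = (\<integral>\<^sup>+z. ennreal (\<Prod>i\<in>A. gauss_pdf (z i)) * f (vec_norm A z) \<partial>PiM A (\<lambda>_. lborel))"
      unfolding gaussian_eq_density[OF fin] by (subst nn_integral_density) auto
    also have "\<dots> = (\<integral>\<^sup>+z. ennreal (e * exp (- (vec_norm A z)\<^sup>2 / 2)) * f (vec_norm A z) \<partial>PiM A (\<lambda>_. lborel))"
      by (simp only: dens)
    also have "\<dots> = (\<integral>\<^sup>+r. ennreal (e * exp (- r\<^sup>2 / 2)) * f r \<partial>distr (PiM A (\<lambda>_. lborel)) borel (\<lambda>z. vec_norm A z))"
      by (subst nn_integral_distr) auto
    also have "\<dots> = (\<integral>\<^sup>+r. ennreal (d * r ^ (m - 1)) * indicator {0..} r * (ennreal (e * exp (- r\<^sup>2 / 2)) * f r) \<partial>lborel)"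
      unfolding distr_norm_PiM_lborel[OF fin ne] m_def[symmetric] d_def[symmetric]
      by (subst nn_integral_density) auto
    also have "\<dots> = (\<integral>\<^sup>+r. ennreal (e * d * r ^ (m - 1) * exp (- r\<^sup>2 / 2)) * f r * indicator {0<..} r \<partial>lborel)"
    proof (rule nn_integral_cong_AE, rule AE_mp[OF AE_lborel_singleton[of 0]], rule AE_I2, rule impI)
      fix r :: real assume "r \<noteq> 0"
      show "ennreal (d * r ^ (m - 1)) * indicator {0..} r * (ennreal (e * exp (- r\<^sup>2 / 2)) * f r)
          = ennreal (e * d * r ^ (m - 1) * exp (- r\<^sup>2 / 2)) * f r * indicator {0<..} r"
      proof (cases "r > 0")
        case True
        have "ennreal (d * r ^ (m - 1)) * ennreal (e * exp (- r\<^sup>2 / 2)) = ennreal (e * d * r ^ (m - 1) * exp (- r\<^sup>2 / 2))"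
          using True d e by (subst ennreal_mult[symmetric]) (auto simp: ac_simps)
        then show ?thesis using True by (simp add: mult.assoc[symmetric])
      qed (use \<open>r \<noteq> 0\<close> in auto)
    qed
    finally show ?thesis .
  qed
  then show ?thesis using d e by (intro exI[of _ "e * d"]) (simp add: m_def)
qed

section \<open>Moments of the tilted radial law\<close>

abbreviation half_weight :: "real \<Rightarrow> nat \<Rightarrow> real \<Rightarrow> real" where
  "half_weight lam j r \<equiv> indicator {0<..} r * (r ^ j * exp (- r\<^sup>2 / 2 - lam * r))"

text \<open>Up to elementary factors a parabolic cylinder function; for
  \<open>j = card A - 1\<close> it is proportional to the Laplace transform at \<open>lam\<close> of
  the Gaussian norm.\<close>

definition half_moment :: "real \<Rightarrow> nat \<Rightarrow> real" where
  "half_moment lam j = (\<integral>r. half_weight lam j r \<partial>lborel)"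

lemma integrable_half_moment:
  assumes "lam \<ge> 0"
  shows "integrable lborel (\<lambda>r::real. half_weight lam j r)"
proof (rule Bochner_Integration.integrable_bound)
  show "integrable lborel (\<lambda>r. sqrt (2 * pi) * (gauss_pdf r * \<bar>r\<bar> ^ j))"
    by (intro integrable_mult_right integrable_std_normal_moment_abs)
  show "AE r in lborel. norm (half_weight lam j r) \<le> norm (sqrt (2 * pi) * (gauss_pdf r * \<bar>r\<bar> ^ j))"
  proof (rule AE_I2)
    fix r :: real
    show "norm (half_weight lam j r) \<le> norm (sqrt (2 * pi) * (gauss_pdf r * \<bar>r\<bar> ^ j))"
    proof (cases "r > 0")
      case True
      have "r ^ j * exp (- r\<^sup>2 / 2 - lam * r) \<le> r ^ j * exp (- r\<^sup>2 / 2)"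
        using True assms by (intro mult_left_mono) auto
      moreover have "sqrt (2 * pi) * (gauss_pdf r * \<bar>r\<bar> ^ j) = r ^ j * exp (- r\<^sup>2 / 2)"
        using True by (simp add: std_normal_density_def)
      ultimately show ?thesis using True by simp
    qed simp
  qed
qed simp

lemma half_moment_pos:
  assumes "lam \<ge> 0"
  shows "half_moment lam j > 0"
proof -
  have nonneg: "0 \<le> half_weight lam j r" for r :: real
    by (auto simp: indicator_def)
  have "half_moment lam j \<noteq> 0"
  proof
    assume "half_moment lam j = 0"
    then have "AE r in lborel. half_weight lam j r = (0::real)"
      using integral_nonneg_eq_0_iff_AE[OF integrable_half_moment[OF assms] AE_I2[OF nonneg]]
      unfolding half_moment_def by blast
    then have "AE r in lborel. r \<notin> {0<..<1::real}"
      by eventually_elim (auto simp: indicator_def)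
    then have "{0<..<1::real} \<in> null_sets lborel"
      by (subst AE_iff_null_sets) auto
    then show False by (auto simp: null_sets_def)
  qed
  moreover have "half_moment lam j \<ge> 0"
    unfolding half_moment_def by (intro Bochner_Integration.integral_nonneg nonneg)
  ultimately show ?thesis by simp
qed

text \<open>The derivative of \<open>r ^ (k + 1) * exp (- r\<^sup>2 / 2 - lam * r)\<close>
  integrates to 0, since this function vanishes at 0 and at infinity.\<close>

lemma half_moment_recurrence:
  assumes lam: "lam \<ge> 0"
  shows "half_moment lam (k + 2) + lam * half_moment lam (k + 1) = real (k + 1) * half_moment lam k"
proof -
  define w where "w r = exp (- r\<^sup>2 / 2 - lam * r)" for r
  define f where "f r = real (k + 1) * (r ^ k * w r) - r ^ (k + 2) * w r - lam * (r ^ (k + 1) * w r)" for r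
  have ind: "indicator {0<..} r * f r = real (k + 1) * (indicator {0<..} r * (r ^ k * w r))
      - indicator {0<..} r * (r ^ (k + 2) * w r) - lam * (indicator {0<..} r * (r ^ (k + 1) * w r))" for r
    by (simp add: f_def algebra_simps)
  note int = integrable_half_moment[OF lam, folded w_def]
  have "(LBINT r=0..\<infinity>. f r) = 0 - 0"
  proof (rule interval_integral_FTC_integrable)
    show "((\<lambda>r. r ^ (k + 1) * w r) has_vector_derivative f r) (at r)" for r
    proof -
      have "((\<lambda>r. r ^ (k + 1)) has_real_derivative real (k + 1) * r ^ k) (at r)"
        using DERIV_pow[of "k + 1" r] by simp
      moreover have "((\<lambda>r. - r\<^sup>2 / 2 - lam * r) has_real_derivative - r - lam) (at r)"
        by (rule derivative_eq_intros refl | simp)+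
      then have "(w has_real_derivative (- r - lam) * w r) (at r)"
        unfolding w_def by (rule DERIV_fun_exp[THEN DERIV_cong]) simp
      ultimately have "((\<lambda>r. r ^ (k + 1) * w r) has_real_derivative real (k + 1) * r ^ k * w r + (- r - lam) * w r * r ^ (k + 1)) (at r)"
        by (rule DERIV_mult)
      also have "real (k + 1) * r ^ k * w r + (- r - lam) * w r * r ^ (k + 1) = f r"
        by (simp add: f_def algebra_simps)
      finally show ?thesis by (simp only: has_real_derivative_iff_has_vector_derivative)
    qed
    show "isCont f r" for r
      unfolding f_def w_def by (intro continuous_intros) auto
    have "integrable lborel (\<lambda>r. indicator {0<..} r * f r)"
      unfolding ind by (intro Bochner_Integration.integrable_diff integrable_mult_right int)
    then show "set_integrable lborel (einterval 0 \<infinity>) f"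
      by (simp add: set_integrable_def einterval_def greaterThan_def)
    have "((\<lambda>r. r ^ (k + 1) * w r) \<longlongrightarrow> 0 ^ (k + 1) * w 0) (at_right 0)"
      unfolding w_def by (intro tendsto_intros) simp
    then show "(((\<lambda>r. r ^ (k + 1) * w r) \<circ> real_of_ereal) \<longlongrightarrow> 0) (at_right 0)"
      unfolding zero_ereal_def ereal_tendsto_simps1 by simp
    have "((\<lambda>r. r ^ (k + 1) * w r) \<longlongrightarrow> 0) at_top"
    proof (rule tendsto_sandwich[OF _ _ tendsto_const tendsto_power_div_exp_0])
      show "\<forall>\<^sub>F r in at_top. 0 \<le> r ^ (k + 1) * w r"
        using eventually_ge_at_top[of 0] by eventually_elim (simp add: w_def)
      show "\<forall>\<^sub>F r in at_top. r ^ (k + 1) * w r \<le> r ^ (k + 1) / exp r"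
        using eventually_ge_at_top[of 2]
      proof eventually_elim
        case (elim r)
        have "0 \<le> lam * r" "r * 2 \<le> r * r" using elim lam by (auto intro: mult_left_mono)
        then have "- r\<^sup>2 / 2 - lam * r \<le> - r" unfolding power2_eq_square by linarith
        then have "w r \<le> exp (- r)" unfolding w_def by simp
        then have "r ^ (k + 1) * w r \<le> r ^ (k + 1) * exp (- r)" using elim by (intro mult_left_mono) auto
        then show ?case by (simp add: exp_minus divide_inverse)
      qed
    qed
    then show "(((\<lambda>r. r ^ (k + 1) * w r) \<circ> real_of_ereal) \<longlongrightarrow> 0) (at_left \<infinity>)"
      unfolding ereal_tendsto_simps1 .
  qed auto
  then have "(\<integral>r. indicator {0<..} r * f r \<partial>lborel) = 0"
    by (simp add: interval_lebesgue_integral_def set_lebesgue_integral_def einterval_def greaterThan_def)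
  then show ?thesis
    unfolding ind half_moment_def w_def[symmetric]
    using int by (simp only: Bochner_Integration.integral_diff Bochner_Integration.integrable_diff
        integral_mult_right_zero integrable_mult_right)
qed

text \<open>Integrating \<open>(r - p)\<^sup>2 * r ^ (k - 1)\<close> against the weight gives
  log-convexity of the moments, \<open>W k \<le> p * W (k - 1)\<close>. The recurrence replaces
  \<open>k * W (k - 1)\<close> by \<open>(p + lam) * W k\<close>.\<close>

lemma half_moment_ratio_bound:
  assumes lam: "lam \<ge> 0" and k: "k \<ge> 1"
  defines "p \<equiv> half_moment lam (k + 1) / half_moment lam k"
  shows "real k \<le> p * (p + lam)"
proof -
  define W where "W = half_moment lam"
  have W: "W j > 0" for j unfolding W_def by (rule half_moment_pos[OF lam])
  have p: "p > 0" "W (k + 1) = p * W k" using W[of k] W[of "k + 1"] by (auto simp: p_def W_def)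
  obtain l where l: "k = l + 1" using k by (metis add.commute le_Suc_ex)
  define w where "w r = exp (- r\<^sup>2 / 2 - lam * r)" for r
  note int = integrable_half_moment[OF lam, folded w_def]
  have "0 \<le> (\<integral>r. indicator {0<..} r * ((r - p)\<^sup>2 * (r ^ l * w r)) \<partial>lborel)"
    by (intro Bochner_Integration.integral_nonneg) (auto simp: indicator_def w_def)
  also have "\<dots> = (\<integral>r. indicator {0<..} r * (r ^ (l + 2) * w r) - 2 * p * (indicator {0<..} r * (r ^ (l + 1) * w r)) + p\<^sup>2 * (indicator {0<..} r * (r ^ l * w r)) \<partial>lborel)"
    by (intro Bochner_Integration.integral_cong) (auto simp: power2_eq_square algebra_simps)
  also have "\<dots> = W (l + 2) - 2 * p * W (l + 1) + p\<^sup>2 * W l"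
    unfolding W_def half_moment_def w_def[symmetric]
    using int by (simp only: Bochner_Integration.integral_add Bochner_Integration.integral_diff
        Bochner_Integration.integrable_diff integral_mult_right_zero integrable_mult_right)
  also have "\<dots> = p * (p * W l - W k)" 
  proof -
    have e: "l + 2 = k + 1" "l + 1 = k" using l by simp_all
    have "W (l + 2) - 2 * p * W (l + 1) + p\<^sup>2 * W l = p * W k - 2 * p * W k + p\<^sup>2 * W l"
      unfolding e p(2) ..
    also have "\<dots> = p * (p * W l - W k)" by (simp add: power2_eq_square algebra_simps)
    finally show ?thesis .
  qed
  finally have "W k \<le> p * W l" using p(1) by (simp add: zero_le_mult_iff)
  then have "real k * W k \<le> p * (real k * W l)"
    using mult_left_mono[of "W k" "p * W l" "real k"] by (simp add: ac_simps)
  also have "real k * W l = W (k + 1) + lam * W k"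
    using half_moment_recurrence[OF lam, of l] unfolding W_def l by (simp add: numeral_2_eq_2)
  also have "p * (W (k + 1) + lam * W k) = p * (p + lam) * W k"
    unfolding p(2) by (simp add: algebra_simps)
  finally show ?thesis using W[of k] by simp
qed

context
  fixes A :: "'i set"
  assumes fin: "finite A" and ne: "A \<noteq> {}"
begin

lemma nn_integral_exp_neg_norm_half_moment:
  obtains c where "c > 0" "c * half_moment 0 (card A - 1) = 1"
    "\<And>lam. lam \<ge> 0 \<Longrightarrow> (\<integral>\<^sup>+z. ennreal (exp (- lam * vec_norm A z)) \<partial>gaussian A) = ennreal (c * half_moment lam (card A - 1))"
proof -
  define k where "k = card A - 1"
  obtain c where c: "c > 0" and rad: "\<And>f. f \<in> borel_measurable borel \<Longrightarrow> (\<integral>\<^sup>+z. f (vec_norm A z) \<partial>gaussian A)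
      = (\<integral>\<^sup>+r. ennreal (c * r ^ k * exp (- r\<^sup>2 / 2)) * f r * indicator {0<..} r \<partial>lborel)"
    using gaussian_radial[OF fin ne] unfolding k_def by blast
  have E: "(\<integral>\<^sup>+z. ennreal (exp (- lam * vec_norm A z)) \<partial>gaussian A) = ennreal (c * half_moment lam k)"
    if lam: "lam \<ge> 0" for lam
  proof -
    have "(\<integral>\<^sup>+z. ennreal (exp (- lam * vec_norm A z)) \<partial>gaussian A)
        = (\<integral>\<^sup>+r. ennreal (c * r ^ k * exp (- r\<^sup>2 / 2)) * ennreal (exp (- lam * r)) * indicator {0<..} r \<partial>lborel)"
      by (rule rad[of "\<lambda>r. ennreal (exp (- lam * r))"]) simp
    also have "\<dots> = (\<integral>\<^sup>+r. ennreal (c * (half_weight lam k r)) \<partial>lborel)"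
    proof (rule nn_integral_cong)
      fix r :: real
      have "exp (- r\<^sup>2 / 2 - lam * r) = exp (- r\<^sup>2 / 2) * exp (- lam * r)"
        unfolding exp_add[symmetric] by simp
      then show "ennreal (c * r ^ k * exp (- r\<^sup>2 / 2)) * ennreal (exp (- lam * r)) * indicator {0<..} r
          = ennreal (c * (half_weight lam k r))"
        using c by (cases "r > 0") (simp_all add: mult.assoc flip: ennreal_mult)
    qed
    also have "\<dots> = ennreal (c * half_moment lam k)"
      unfolding half_moment_def using c integrable_half_moment[OF lam]
      by (subst nn_integral_eq_integral) (auto simp: indicator_def)
    finally show ?thesis .
  qed
  have "ennreal (c * half_moment 0 k) = ennreal 1"
    using E[of 0] prob_space.emeasure_space_1[OF prob_space_gaussian, of A] by simp
  then have "c * half_moment 0 k = 1"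
    using c half_moment_pos[of 0 k] by (subst (asm) ennreal_inj) auto
  with c E show thesis using that by (simp add: k_def)
qed

text \<open>Jensen's inequality for the law of the norm tilted by \<open>exp (- lam * r)\<close>, whose mean is \<open>p\<close>.\<close>

lemma nn_integral_exp_neg_norm_le:
  assumes lam: "lam > 0"
  shows "(\<integral>\<^sup>+z. ennreal (exp (- lam * vec_norm A z)) \<partial>gaussian A) \<le> ennreal (exp (lam\<^sup>2 / 2 - lam * sqrt (real (card A - 1))))"
proof (cases "card A - 1 = 0")
  \<comment> \<open>For one coordinate the claimed bound is
    \<open>exp (lam\<^sup>2 / 2) \<ge> 1\<close>, and the integrand is at most 1.\<close>
  case True
  have "(\<integral>\<^sup>+z. ennreal (exp (- lam * vec_norm A z)) \<partial>gaussian A) \<le> (\<integral>\<^sup>+z. ennreal 1 \<partial>gaussian A)"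
    using lam by (intro nn_integral_mono ennreal_leI) (auto intro!: mult_nonneg_nonneg sum_nonneg)
  also have "\<dots> = ennreal 1" using prob_space.emeasure_space_1[OF prob_space_gaussian] by simp
  also have "\<dots> \<le> ennreal (exp (lam\<^sup>2 / 2 - lam * sqrt (real (card A - 1))))"
    using True by (intro ennreal_leI) simp
  finally show ?thesis .
next
  case False
  define k where "k = card A - 1"
  have k: "k \<ge> 1" using False by (simp add: k_def)
  obtain c where c: "c > 0" "c * half_moment 0 k = 1"
    and E: "\<And>lam. lam \<ge> 0 \<Longrightarrow> (\<integral>\<^sup>+z. ennreal (exp (- lam * vec_norm A z)) \<partial>gaussian A) = ennreal (c * half_moment lam k)"
    using nn_integral_exp_neg_norm_half_moment unfolding k_def by metis
  define p where "p = half_moment lam (k + 1) / half_moment lam k"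
  have W: "half_moment lam j > 0" for j using lam by (intro half_moment_pos) simp
  have p: "p > 0" "half_moment lam (k + 1) = p * half_moment lam k"
    using W[of k] W[of "k + 1"] by (auto simp: p_def)
  have "real k \<le> p * (p + lam)"
    unfolding p_def using half_moment_ratio_bound[OF _ k, of lam] lam by simp
  \<comment> \<open>Completing the square in \<open>p * (p + lam)\<close>; the loss
    \<open>lam / 2\<close> becomes the term \<open>lam\<^sup>2 / 2\<close> of the final
    exponent.\<close>
  then have p_ge: "sqrt k - lam / 2 \<le> p"
  proof -
    have "real k \<le> (p + lam / 2)\<^sup>2"
    proof -
      have "(p + lam / 2)\<^sup>2 = p * (p + lam) + (lam / 2)\<^sup>2" by (simp add: power2_eq_square algebra_simps)
      then show ?thesis using \<open>real k \<le> p * (p + lam)\<close> zero_le_power2[of "lam / 2"] by linarith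
    qed
    then have "sqrt k \<le> sqrt ((p + lam / 2)\<^sup>2)" by (rule real_sqrt_le_mono)
    then show ?thesis using p(1) lam by simp
  qed
  \<comment> \<open>The tangent of \<open>exp (lam * r)\<close> at \<open>r = p\<close> lies below
    it, and its linear part \<open>lam * (r - p)\<close> integrates to 0 against the tilted weight
    because \<open>p\<close> is the mean.\<close>
  have "exp (lam * p) * half_moment lam k \<le> half_moment 0 k"
  proof -
    have i: "integrable lborel (\<lambda>r::real. half_weight lam j r)" for j
      using lam by (intro integrable_half_moment) simp
    have "exp (lam * p) * half_moment lam k = exp (lam * p) * ((1 - lam * p) * half_moment lam k + lam * half_moment lam (k + 1))"
      unfolding p(2) by (simp add: algebra_simps)
    also have "\<dots> = (\<integral>r. exp (lam * p) * ((1 - lam * p) * (half_weight lam k r)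
        + lam * (half_weight lam (k + 1) r)) \<partial>lborel)"
      unfolding half_moment_def using i[of k] i[of "k + 1"] by simp
    also have "\<dots> \<le> half_moment 0 k"
      unfolding half_moment_def
    proof (rule integral_mono)
      show "integrable lborel (\<lambda>r::real. exp (lam * p) * ((1 - lam * p) * (half_weight lam k r)
        + lam * (half_weight lam (k + 1) r)))"
        by (intro integrable_mult_right Bochner_Integration.integrable_add i)
      show "integrable lborel (\<lambda>r::real. half_weight 0 k r)"
        by (rule integrable_half_moment) simp
      fix r :: real
      have "exp (lam * p) * (1 + lam * (r - p)) \<le> exp (lam * p) * exp (lam * (r - p))"
        by (intro mult_left_mono exp_ge_add_one_self) auto
      also have "\<dots> = exp (lam * r)" by (simp add: algebra_simps flip: exp_add)
      finally have *: "exp (lam * p) * (1 + lam * (r - p)) \<le> exp (lam * r)" .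
      have e: "exp (- r\<^sup>2 / 2 - lam * r) * exp (lam * r) = exp (- r\<^sup>2 / 2 - 0 * r)" by (simp flip: exp_add)
      show "exp (lam * p) * ((1 - lam * p) * (half_weight lam k r)
        + lam * (half_weight lam (k + 1) r)) \<le> half_weight 0 k r"
      proof (cases "r > 0")
        case True
        then have "(r ^ k * exp (- r\<^sup>2 / 2 - lam * r)) * (exp (lam * p) * (1 + lam * (r - p))) \<le> (r ^ k * exp (- r\<^sup>2 / 2 - lam * r)) * exp (lam * r)"
          by (intro mult_left_mono *) auto
        also have "\<dots> = r ^ k * exp (- r\<^sup>2 / 2 - 0 * r)" by (simp only: mult.assoc e)
        finally show ?thesis using True by (simp add: algebra_simps)
      qed simp
    qed
    finally show ?thesis .
  qed
  then have "exp (lam * p) * (c * half_moment lam k) \<le> 1"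
    using c mult_left_mono[of "exp (lam * p) * half_moment lam k" "half_moment 0 k" c] by (simp add: ac_simps)
  then have "c * half_moment lam k \<le> exp (- (lam * p))"
    by (simp add: exp_minus field_simps)
  also have "\<dots> \<le> exp (lam\<^sup>2 / 2 - lam * sqrt k)"
    using mult_left_mono[OF p_ge, of lam] lam by (simp add: algebra_simps power2_eq_square)
  finally show ?thesis
    using lam by (subst E) (auto simp: k_def intro: ennreal_leI)
qed

text \<open>Dropping \<open>exp (- r\<^sup>2 / 2) \<le> 1\<close> leaves a Gamma integral. Only the
  order in \<open>lam\<close> counts, for the limit in
  \<open>emeasure_kernel_hits_eq_0\<close>.\<close>

lemma nn_integral_exp_neg_norm_le_power:
  "\<exists>C\<ge>0. \<forall>lam>0. (\<integral>\<^sup>+z. ennreal (exp (- lam * vec_norm A z)) \<partial>gaussian A) \<le> ennreal (C / lam ^ card A)"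
proof -
  define k where "k = card A - 1"
  have card: "card A = Suc k" using fin ne by (simp add: k_def card_gt_0_iff)
  obtain c where c: "c > 0" and rad: "\<And>f. f \<in> borel_measurable borel \<Longrightarrow> (\<integral>\<^sup>+z. f (vec_norm A z) \<partial>gaussian A)
      = (\<integral>\<^sup>+r. ennreal (c * r ^ k * exp (- r\<^sup>2 / 2)) * f r * indicator {0<..} r \<partial>lborel)"
    using gaussian_radial[OF fin ne] unfolding k_def by blast
  have "(\<integral>\<^sup>+z. ennreal (exp (- lam * vec_norm A z)) \<partial>gaussian A) \<le> ennreal (c * fact k / lam ^ card A)"
    if lam: "lam > 0" for lam
  proof -
    have "(\<integral>\<^sup>+z. ennreal (exp (- lam * vec_norm A z)) \<partial>gaussian A)
        = (\<integral>\<^sup>+r. ennreal (c * r ^ k * exp (- r\<^sup>2 / 2)) * ennreal (exp (- lam * r)) * indicator {0<..} r \<partial>lborel)"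
      by (rule rad[of "\<lambda>r. ennreal (exp (- lam * r))"]) simp
    also have "\<dots> \<le> (\<integral>\<^sup>+r. ennreal (c / lam ^ k) * (ennreal ((0 + lam * r) ^ k * exp (- (0 + lam * r))) * indicator {0..} (0 + lam * r)) \<partial>lborel)"
    proof (rule nn_integral_mono)
      fix r :: real
      show "ennreal (c * r ^ k * exp (- r\<^sup>2 / 2)) * ennreal (exp (- lam * r)) * indicator {0<..} r
          \<le> ennreal (c / lam ^ k) * (ennreal ((0 + lam * r) ^ k * exp (- (0 + lam * r))) * indicator {0..} (0 + lam * r))"
      proof (cases "r > 0")
        case True
        have "c * r ^ k * exp (- r\<^sup>2 / 2) * exp (- lam * r) \<le> c * r ^ k * 1 * exp (- lam * r)"
          using c True by (intro mult_right_mono mult_left_mono) auto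
        also have "\<dots> = c / lam ^ k * ((0 + lam * r) ^ k * exp (- (0 + lam * r)))"
          using lam by (simp add: power_mult_distrib)
        finally show ?thesis using True c lam by (simp add: ennreal_leI flip: ennreal_mult ennreal_mult')
      qed simp
    qed
    also have "\<dots> = ennreal (c / lam ^ k) * (\<integral>\<^sup>+r. ennreal ((0 + lam * r) ^ k * exp (- (0 + lam * r))) * indicator {0..} (0 + lam * r) \<partial>lborel)"
      by (rule nn_integral_cmult) simp
    also have "(\<integral>\<^sup>+r. ennreal ((0 + lam * r) ^ k * exp (- (0 + lam * r))) * indicator {0..} (0 + lam * r) \<partial>lborel) = ennreal (fact k / lam)"
    proof -
      have "ennreal lam * (\<integral>\<^sup>+r. ennreal ((0 + lam * r) ^ k * exp (- (0 + lam * r))) * indicator {0..} (0 + lam * r) \<partial>lborel) = ennreal (fact k)"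
        using nn_intergal_power_times_exp_Ici[of k] lam
          nn_integral_real_affine[of "\<lambda>x. ennreal (x ^ k * exp (- x)) * indicator {0..} x" lam 0] by simp
      then have "ennreal (1 / lam) * (ennreal lam * (\<integral>\<^sup>+r. ennreal ((0 + lam * r) ^ k * exp (- (0 + lam * r))) * indicator {0..} (0 + lam * r) \<partial>lborel)) = ennreal (1 / lam) * ennreal (fact k)"
        by simp
      moreover have "ennreal (1 / lam) * ennreal lam = 1" using lam by (simp flip: ennreal_mult)
      ultimately show ?thesis using lam by (simp add: mult.assoc[symmetric] flip: ennreal_mult)
    qed
    also have "ennreal (c / lam ^ k) * ennreal (fact k / lam) = ennreal (c * fact k / lam ^ card A)"
      using c lam by (simp add: card field_simps flip: ennreal_mult)
    finally show ?thesis .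
  qed
  then show ?thesis using c by (intro exI[of _ "c * fact k"]) auto
qed

text \<open>Completing the square centres the weight at \<open>lam\<close>, and
  \<open>r \<le> lam * (1 + \<bar>r - lam\<bar>)\<close> for \<open>lam \<ge> 1\<close> splits off
  the power. A factor \<open>exp (lam * sqrt \<delta>)\<close>, as in the concentration bound, would
  be too large for the limit \<open>lam \<rightarrow> \<infinity>\<close>.\<close>

lemma nn_integral_exp_norm_le_power:
  "\<exists>C\<ge>0. \<forall>lam\<ge>1. (\<integral>\<^sup>+z. ennreal (exp (lam * vec_norm A z)) \<partial>gaussian A) \<le> ennreal (exp (lam\<^sup>2 / 2) * (C * lam ^ (card A - 1)))"
proof -
  define k where "k = card A - 1"
  obtain c where c: "c > 0" and rad: "\<And>f. f \<in> borel_measurable borel \<Longrightarrow> (\<integral>\<^sup>+z. f (vec_norm A z) \<partial>gaussian A)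
      = (\<integral>\<^sup>+r. ennreal (c * r ^ k * exp (- r\<^sup>2 / 2)) * f r * indicator {0<..} r \<partial>lborel)"
    using gaussian_radial[OF fin ne] unfolding k_def by blast
  define h where "h x = (1 + \<bar>x\<bar>) ^ k * exp (- x\<^sup>2 / 2)" for x :: real
  have h: "integrable lborel h"
  proof (rule Bochner_Integration.integrable_bound)
    show "integrable lborel (\<lambda>x. sqrt (2 * pi) * 2 ^ k * (gauss_pdf x * \<bar>x\<bar> ^ 0 + gauss_pdf x * \<bar>x\<bar> ^ k))"
      by (intro integrable_mult_right Bochner_Integration.integrable_add integrable_std_normal_moment_abs)
    show "AE x in lborel. norm (h x) \<le> norm (sqrt (2 * pi) * 2 ^ k * (gauss_pdf x * \<bar>x\<bar> ^ 0 + gauss_pdf x * \<bar>x\<bar> ^ k))"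
    proof (rule AE_I2)
      fix x :: real
      have "(1 + \<bar>x\<bar>) ^ k \<le> (2 * max 1 \<bar>x\<bar>) ^ k" by (intro power_mono) auto
      also have "\<dots> \<le> 2 ^ k * (1 + \<bar>x\<bar> ^ k)"
        by (simp add: power_mult_distrib max_def)
      finally have "h x \<le> 2 ^ k * (1 + \<bar>x\<bar> ^ k) * exp (- x\<^sup>2 / 2)"
        unfolding h_def by (intro mult_right_mono) auto
      also have "\<dots> = sqrt (2 * pi) * 2 ^ k * (gauss_pdf x * \<bar>x\<bar> ^ 0 + gauss_pdf x * \<bar>x\<bar> ^ k)"
        by (simp add: std_normal_density_def field_simps)
      finally show "norm (h x) \<le> norm (sqrt (2 * pi) * 2 ^ k * (gauss_pdf x * \<bar>x\<bar> ^ 0 + gauss_pdf x * \<bar>x\<bar> ^ k))"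
        by (simp add: h_def)
    qed
  qed (simp add: h_def[abs_def])
  have h0: "h x \<ge> 0" for x by (simp add: h_def)
  define C where "C = c * integral\<^sup>L lborel h"
  have C: "C \<ge> 0" unfolding C_def using c h0 by (intro mult_nonneg_nonneg Bochner_Integration.integral_nonneg) auto
  have "(\<integral>\<^sup>+z. ennreal (exp (lam * vec_norm A z)) \<partial>gaussian A) \<le> ennreal (exp (lam\<^sup>2 / 2) * (C * lam ^ k))"
    if lam: "lam \<ge> 1" for lam
  proof -
    have "(\<integral>\<^sup>+z. ennreal (exp (lam * vec_norm A z)) \<partial>gaussian A)
        = (\<integral>\<^sup>+r. ennreal (c * r ^ k * exp (- r\<^sup>2 / 2)) * ennreal (exp (lam * r)) * indicator {0<..} r \<partial>lborel)"
      by (rule rad[of "\<lambda>r. ennreal (exp (lam * r))"]) simp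
    also have "\<dots> \<le> (\<integral>\<^sup>+r. ennreal (exp (lam\<^sup>2 / 2) * (c * lam ^ k)) * ennreal (h (- lam + 1 * r)) \<partial>lborel)"
    proof (rule nn_integral_mono)
      fix r :: real
      show "ennreal (c * r ^ k * exp (- r\<^sup>2 / 2)) * ennreal (exp (lam * r)) * indicator {0<..} r
          \<le> ennreal (exp (lam\<^sup>2 / 2) * (c * lam ^ k)) * ennreal (h (- lam + 1 * r))"
      proof (cases "r > 0")
        case True
        have "\<bar>r - lam\<bar> * 1 \<le> \<bar>r - lam\<bar> * lam" using lam by (intro mult_left_mono) auto
        then have "r \<le> lam * (1 + \<bar>r - lam\<bar>)" by (simp add: algebra_simps)
        then have "r ^ k \<le> (lam * (1 + \<bar>r - lam\<bar>)) ^ k"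
          using True by (intro power_mono) auto
        then have "r ^ k \<le> lam ^ k * (1 + \<bar>r - lam\<bar>) ^ k"
          by (simp only: power_mult_distrib)
        then have "c * r ^ k * exp (lam\<^sup>2 / 2 + - (r - lam)\<^sup>2 / 2) \<le> c * (lam ^ k * (1 + \<bar>r - lam\<bar>) ^ k) * exp (lam\<^sup>2 / 2 + - (r - lam)\<^sup>2 / 2)"
          using c by (intro mult_right_mono mult_left_mono) auto
        moreover have "lam\<^sup>2 / 2 + - (r - lam)\<^sup>2 / 2 = - r\<^sup>2 / 2 + lam * r"
          by (simp add: power2_eq_square field_simps)
        ultimately have "c * r ^ k * (exp (- r\<^sup>2 / 2) * exp (lam * r)) \<le> c * (lam ^ k * (1 + \<bar>r - lam\<bar>) ^ k) * (exp (lam\<^sup>2 / 2) * exp (- (r - lam)\<^sup>2 / 2))"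
          unfolding exp_add[symmetric] by simp
        also have "\<dots> = exp (lam\<^sup>2 / 2) * (c * lam ^ k) * h (- lam + 1 * r)"
          by (simp add: h_def)
        finally have "ennreal (c * r ^ k * (exp (- r\<^sup>2 / 2) * exp (lam * r))) \<le> ennreal (exp (lam\<^sup>2 / 2) * (c * lam ^ k) * h (- lam + 1 * r))"
          by (rule ennreal_leI)
        then show ?thesis using True c lam
          by (subst (1 2) ennreal_mult'[symmetric]) (simp_all add: mult.assoc h0)
      qed simp
    qed
    also have "\<dots> = ennreal (exp (lam\<^sup>2 / 2) * (c * lam ^ k)) * (\<integral>\<^sup>+r. ennreal (h (- lam + 1 * r)) \<partial>lborel)"
      by (rule nn_integral_cmult) (simp add: h_def)
    also have "(\<integral>\<^sup>+r. ennreal (h (- lam + 1 * r)) \<partial>lborel) = (\<integral>\<^sup>+r. ennreal (h r) \<partial>lborel)"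
      by (subst (2) nn_integral_real_affine[where t = "- lam" and c = 1]) (auto simp: h_def[abs_def])
    also have "\<dots> = ennreal (integral\<^sup>L lborel h)"
      using h h0 by (intro nn_integral_eq_integral) auto
    also have "ennreal (exp (lam\<^sup>2 / 2) * (c * lam ^ k)) * ennreal (integral\<^sup>L lborel h) = ennreal (exp (lam\<^sup>2 / 2) * (C * lam ^ k))"
      unfolding C_def using c lam by (subst ennreal_mult'[symmetric]) (auto simp: ac_simps)
    finally show ?thesis .
  qed
  then show ?thesis using C by (intro exI[of _ C]) (auto simp: k_def)
qed

end

subsection \<open>Escape from a compact section of the sphere\<close>

lemma continuous_on_coordinate: "continuous_on S (\<lambda>x :: 'i \<Rightarrow> 'b::topological_space. x i)"
  by (rule continuous_on_subset[OF continuous_on_product_coordinates]) simp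

lemma sum_abs_mult_le_sqrt:
  fixes x c :: "'a \<Rightarrow> real"
  assumes "(\<Sum>j\<in>A. (x j)\<^sup>2) = 1"
  shows "(\<Sum>j\<in>A. \<bar>x j\<bar> * c j) \<le> sqrt (\<Sum>j\<in>A. (c j)\<^sup>2)"
proof -
  have "(\<Sum>j\<in>A. \<bar>x j\<bar> * c j) \<le> sqrt ((\<Sum>j\<in>A. \<bar>x j\<bar> * c j)\<^sup>2)" by simp
  also have "\<dots> \<le> sqrt ((\<Sum>j\<in>A. \<bar>x j\<bar>\<^sup>2) * (\<Sum>j\<in>A. (c j)\<^sup>2))"
    by (intro real_sqrt_le_mono Cauchy_Schwarz_ineq_sum)
  also have "\<dots> = sqrt (\<Sum>j\<in>A. (c j)\<^sup>2)" using assms by simp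
  finally show ?thesis .
qed

definition kernel_hits :: "nat \<Rightarrow> nat \<Rightarrow> (nat \<Rightarrow> real) set \<Rightarrow> (nat \<times> nat \<Rightarrow> real) set" where
  "kernel_hits m N C = {a \<in> space (matrix_law m N). \<exists>x\<in>C. \<forall>i<m. row_dot N x a i = 0}"

context
  fixes m N :: nat and C :: "(nat \<Rightarrow> real) set"
  assumes compact: "compact C" and unit: "\<And>x. x \<in> C \<Longrightarrow> (\<Sum>j=1..N. (x j)\<^sup>2) = 1"
begin

text \<open>By continuity a countable dense \<open>D\<close> sees the same supremum as
  \<open>C\<close>; by compactness the norm attains its infimum, so a supremum of at least 1 yields
  an exact kernel vector. This makes the event measurable and opens it to the countable
  comparison.\<close>

lemma kernel_hits_eq_sup:
  assumes lam: "lam > 0"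
  obtains D where "countable D" "D \<subseteq> C"
    "kernel_hits m N C = {a \<in> space (matrix_law m N). 1 \<le> (SUP x\<in>D. ennreal (exp (- lam * image_norm m N x a)))}"
proof -
  obtain D where D: "countable D" "D \<subseteq> C" "C \<subseteq> closure D"
    using separable[of C] by blast
  define \<phi> where "\<phi> a x = image_norm m N x a" for a :: "nat \<times> nat \<Rightarrow> real" and x
  have cont: "continuous_on S (\<phi> a)" for a S
    unfolding \<phi>_def by (intro continuous_intros continuous_on_coordinate)
  have \<phi>0: "\<phi> a x = 0 \<longleftrightarrow> (\<forall>i<m. row_dot N x a i = 0)" for a x
    unfolding \<phi>_def by (auto simp: sum_nonneg_eq_0_iff)
  have \<phi>_ge: "\<phi> a x \<ge> 0" for a x unfolding \<phi>_def by (simp add: sum_nonneg)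
  have "(\<exists>x\<in>C. \<phi> a x = 0) \<longleftrightarrow> 1 \<le> (SUP x\<in>D. ennreal (exp (- lam * \<phi> a x)))" for a
  proof
    assume "\<exists>x\<in>C. \<phi> a x = 0"
    then obtain x where x: "x \<in> C" "\<phi> a x = 0" by blast
    have "closed {x. ennreal (exp (- lam * \<phi> a x)) \<le> (SUP x\<in>D. ennreal (exp (- lam * \<phi> a x)))}"
      by (intro closed_Collect_le continuous_intros continuous_on_ennreal cont)
    moreover have "D \<subseteq> {x. ennreal (exp (- lam * \<phi> a x)) \<le> (SUP x\<in>D. ennreal (exp (- lam * \<phi> a x)))}"
      by (auto intro: SUP_upper)
    ultimately have "closure D \<subseteq> {x. ennreal (exp (- lam * \<phi> a x)) \<le> (SUP x\<in>D. ennreal (exp (- lam * \<phi> a x)))}"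
      by (intro closure_minimal)
    then have "ennreal (exp (- lam * \<phi> a x)) \<le> (SUP x\<in>D. ennreal (exp (- lam * \<phi> a x)))"
      using x(1) D(3) by blast
    then show "1 \<le> (SUP x\<in>D. ennreal (exp (- lam * \<phi> a x)))" using x(2) by simp
  next
    assume ge: "1 \<le> (SUP x\<in>D. ennreal (exp (- lam * \<phi> a x)))"
    then have "D \<noteq> {}" by (auto simp: bot_ennreal)
    then have "C \<noteq> {}" using D(2) by blast
    then obtain x where x: "x \<in> C" "\<And>y. y \<in> C \<Longrightarrow> \<phi> a x \<le> \<phi> a y"
      using continuous_attains_inf[OF compact _ cont, of a] by blast
    have "(SUP x\<in>D. ennreal (exp (- lam * \<phi> a x))) \<le> ennreal (exp (- lam * \<phi> a x))"
      using x D(2) lam by (intro SUP_least ennreal_leI) (auto intro!: mult_left_mono)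
    with ge have "1 \<le> exp (- lam * \<phi> a x)"
      by (metis ennreal_1 ennreal_le_iff exp_ge_zero order_trans)
    then have "\<phi> a x = 0" using lam \<phi>_ge[of a x] by (simp add: mult_le_0_iff)
    then show "\<exists>x\<in>C. \<phi> a x = 0" using x(1) by blast
  qed
  then have "kernel_hits m N C = {a \<in> space (matrix_law m N). 1 \<le> (SUP x\<in>D. ennreal (exp (- lam * \<phi> a x)))}"
    unfolding kernel_hits_def by (simp only: \<phi>0[symmetric])
  then show thesis using that[OF D(1,2)] by (simp only: \<phi>_def)
qed

lemma sets_kernel_hits: "kernel_hits m N C \<in> sets (matrix_law m N)"
proof (rule kernel_hits_eq_sup[OF zero_less_one])
  fix D assume D: "countable D" and eq: "kernel_hits m N C = {a \<in> space (matrix_law m N).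
      1 \<le> (SUP x\<in>D. ennreal (exp (- 1 * image_norm m N x a)))}"
  have "(\<lambda>a. SUP x\<in>D. ennreal (exp (- 1 * image_norm m N x a))) \<in> borel_measurable (matrix_law m N)"
    by (intro borel_measurable_SUP D) (measurable; simp)
  then show ?thesis
    unfolding eq by (rule borel_measurable_le[OF borel_measurable_const])
qed

text \<open>Markov's inequality in exponential form: on the event the supremum of the exponentials
  is at least 1. \<open>B\<close> may be any pointwise bound on the support function of
  \<open>C\<close>, which allows two different uses.\<close>

lemma emeasure_kernel_hits_le:
  assumes lam: "lam > 0" and B: "\<And>g x. x \<in> C \<Longrightarrow> - row_dot N x g m \<le> B g"
  shows "ennreal (exp (lam\<^sup>2 / 2)) * emeasure (matrix_law m N) (kernel_hits m N C)
    \<le> (\<integral>\<^sup>+h. ennreal (exp (- lam * sqrt (\<Sum>l\<in>{..<m} \<times> {0::nat}. (h l)\<^sup>2))) \<partial>gaussian ({..<m} \<times> {0}))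
      * (\<integral>\<^sup>+g. ennreal (exp (lam * B g)) \<partial>gaussian ({m} \<times> {1..N}))"
proof -
  obtain D where D: "countable D" "D \<subseteq> C" and eq: "kernel_hits m N C = {a \<in> space (matrix_law m N).
      1 \<le> (SUP x\<in>D. ennreal (exp (- lam * image_norm m N x a)))}"
    using kernel_hits_eq_sup[OF lam] by blast
  have sumH: "(\<Sum>i<m. (h (i, 0))\<^sup>2) = (\<Sum>l\<in>{..<m} \<times> {0::nat}. (h l)\<^sup>2)" for h :: "nat \<times> nat \<Rightarrow> real"
    by (simp add: sum.cartesian_product')
  let ?s = "\<lambda>a. SUP x\<in>D. ennreal (exp (- lam * image_norm m N x a))"
  have "emeasure (matrix_law m N) (kernel_hits m N C) = (\<integral>\<^sup>+a. indicator (kernel_hits m N C) a \<partial>matrix_law m N)"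
    using sets_kernel_hits by simp
  also have "\<dots> \<le> (\<integral>\<^sup>+a. ?s a \<partial>matrix_law m N)"
    by (intro nn_integral_mono) (auto simp: eq indicator_def)
  finally have "ennreal (exp (lam\<^sup>2 / 2)) * emeasure (matrix_law m N) (kernel_hits m N C)
      \<le> ennreal (exp (lam\<^sup>2 / 2)) * (\<integral>\<^sup>+a. ?s a \<partial>matrix_law m N)"
    by (rule mult_left_mono) simp
  also have "\<dots> \<le> (\<integral>\<^sup>+h. ennreal (exp (- lam * column_norm m h)) \<partial>gaussian ({..<m} \<times> {0::nat}))
      * (\<integral>\<^sup>+g. (SUP x\<in>D. ennreal (exp (- lam * row_dot N x g m))) \<partial>gaussian ({m} \<times> {1..N}))"
    using D unit by (intro gordon_comparison lam) auto
  also have "\<dots> \<le> (\<integral>\<^sup>+h. ennreal (exp (- lam * column_norm m h)) \<partial>gaussian ({..<m} \<times> {0::nat}))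
      * (\<integral>\<^sup>+g. ennreal (exp (lam * B g)) \<partial>gaussian ({m} \<times> {1..N}))"
  proof (intro mult_left_mono nn_integral_mono SUP_least ennreal_leI)
    fix g :: "nat \<times> nat \<Rightarrow> real" and x assume "x \<in> D"
    then have "lam * - row_dot N x g m \<le> lam * B g"
      using B D(2) lam by (intro mult_left_mono) auto
    then show "exp (- lam * row_dot N x g m) \<le> exp (lam * B g)" by simp
  qed simp
  finally show ?thesis by (simp only: sumH)
qed

lemma sum_row_sq: "(\<Sum>l\<in>{m} \<times> {1..N}. f l) = (\<Sum>j=1..N. f (m, j))" for f :: "nat \<times> nat \<Rightarrow> real"
  by (simp add: sum.cartesian_product')

text \<open>Obtained by letting \<open>lam \<rightarrow> \<infinity>\<close> in the comparison bound, which is of order \<open>lam ^ (N - 1 - m)\<close>.\<close>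

lemma emeasure_kernel_hits_eq_0:
  assumes mN: "N \<le> m" "N > 0"
  shows "emeasure (matrix_law m N) (kernel_hits m N C) = 0"
proof -
  let ?M = "matrix_law m N" and ?H = "{..<m} \<times> {0::nat}" and ?G = "{m} \<times> {1..N}"
  have H: "finite ?H" "?H \<noteq> {}" "card ?H = m" using mN by (auto simp: card_cartesian_product lessThan_empty_iff)
  have G: "finite ?G" "?G \<noteq> {}" "card ?G = N" using mN by (auto simp: card_cartesian_product lessThan_empty_iff)
  obtain c1 where c1: "c1 \<ge> 0" "\<And>lam. lam > 0 \<Longrightarrow> (\<integral>\<^sup>+z. ennreal (exp (- lam * vec_norm ?H z)) \<partial>gaussian ?H) \<le> ennreal (c1 / lam ^ m)"
    using nn_integral_exp_neg_norm_le_power[OF H(1,2)] unfolding H(3) by blast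
  obtain c2 where c2: "c2 \<ge> 0" "\<And>lam. lam \<ge> 1 \<Longrightarrow> (\<integral>\<^sup>+z. ennreal (exp (lam * vec_norm ?G z)) \<partial>gaussian ?G) \<le> ennreal (exp (lam\<^sup>2 / 2) * (c2 * lam ^ (N - 1)))"
    using nn_integral_exp_norm_le_power[OF G(1,2)] unfolding G(3) by blast
  interpret M: prob_space ?M by (rule prob_space_gaussian)
  define P where "P = measure ?M (kernel_hits m N C)"
  have P: "P \<ge> 0" "emeasure ?M (kernel_hits m N C) = ennreal P"
    unfolding P_def by (rule measure_nonneg, rule M.emeasure_eq_measure)
  have le: "P \<le> c1 * c2 / lam" if lam: "lam \<ge> 1" for lam
  proof -
    have "ennreal (exp (lam\<^sup>2 / 2)) * ennreal P \<le> (\<integral>\<^sup>+z. ennreal (exp (- lam * vec_norm ?H z)) \<partial>gaussian ?H)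
        * (\<integral>\<^sup>+z. ennreal (exp (lam * vec_norm ?G z)) \<partial>gaussian ?G)"
      unfolding P(2)[symmetric]
    proof (rule emeasure_kernel_hits_le)
      show "- row_dot N x g m \<le> sqrt (\<Sum>l\<in>?G. (g l)\<^sup>2)" if "x \<in> C" for g x
      proof -
        have "- row_dot N x g m \<le> (\<Sum>j=1..N. \<bar>x j\<bar> * \<bar>g (m, j)\<bar>)"
          unfolding sum_negf[symmetric] by (intro sum_mono) (simp flip: abs_mult)
        also have "\<dots> \<le> sqrt (\<Sum>j=1..N. \<bar>g (m, j)\<bar>\<^sup>2)"
          by (intro sum_abs_mult_le_sqrt unit that)
        finally have "- row_dot N x g m \<le> sqrt (\<Sum>j=1..N. \<bar>g (m, j)\<bar>\<^sup>2)" .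
        then show ?thesis by (simp only: sum_row_sq power2_abs)
      qed
    qed (use lam in simp)
    also have "\<dots> \<le> ennreal (c1 / lam ^ m) * ennreal (exp (lam\<^sup>2 / 2) * (c2 * lam ^ (N - 1)))"
      using lam by (intro mult_mono c1(2) c2(2)) auto
    finally have "exp (lam\<^sup>2 / 2) * P \<le> (c1 / lam ^ m) * (exp (lam\<^sup>2 / 2) * (c2 * lam ^ (N - 1)))"
      using c1(1) c2(1) P(1) lam by (simp flip: ennreal_mult)
    then have "exp (lam\<^sup>2 / 2) * P \<le> exp (lam\<^sup>2 / 2) * (c1 * c2 * (lam ^ (N - 1) / lam ^ m))"
      by (simp add: ac_simps)
    then have "P \<le> c1 * c2 * (lam ^ (N - 1) / lam ^ m)" by (rule mult_left_le_imp_le) simp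
    \<comment> \<open>With \<open>N \<le> m\<close> at least one power of \<open>lam\<close> remains
      in the denominator. The exponent \<open>N - 1\<close> is the radial Jacobian of the row,
      \<open>m\<close> the small-ball order of the column.\<close>
    also have "lam ^ (N - 1) / lam ^ m \<le> 1 / lam"
    proof -
      have "lam ^ (N - 1) * lam = lam ^ N" using mN by (metis Suc_diff_1 power_Suc2)
      also have "\<dots> \<le> lam ^ m" using lam mN by (intro power_increasing) auto
      finally show ?thesis using lam by (simp add: field_simps)
    qed
    then have "c1 * c2 * (lam ^ (N - 1) / lam ^ m) \<le> c1 * c2 * (1 / lam)"
      using c1(1) c2(1) by (intro mult_left_mono) auto
    finally show ?thesis by simp
  qed
  have "(\<lambda>n. c1 * c2 * (1 / real (Suc n))) \<longlonglongrightarrow> c1 * c2 * 0"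
    by (intro tendsto_mult tendsto_const LIMSEQ_Suc[OF lim_1_over_real])
  then have "P \<le> c1 * c2 * 0"
    by (rule LIMSEQ_le_const) (use le in auto)
  then show ?thesis using P by simp
qed

text \<open>The column and the row each contribute \<open>exp (lam\<^sup>2 / 2)\<close>; one of
  these cancels against the factor of the corner scalar on the left.\<close>

lemma measure_kernel_hits_le:
  assumes m: "m > 0" and lam: "lam > 0" and \<delta>: "\<delta> > 0" "(\<Sum>j=1..N. gauss_tail2 (t j)) \<le> \<delta>"
    and s: "\<And>j. j \<in> {1..N} \<Longrightarrow> s j = 1 \<or> s j = - 1"
    and B: "\<And>x y. x \<in> C \<Longrightarrow> - (\<Sum>j=1..N. x j * y j) \<le> sqrt (\<Sum>j=1..N. (max 0 (s j * y j - t j))\<^sup>2)"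
  shows "measure (matrix_law m N) (kernel_hits m N C) \<le> exp (lam\<^sup>2 / 2 - lam * (sqrt (real (m - 1)) - sqrt \<delta>))"
proof -
  let ?M = "matrix_law m N" and ?H = "{..<m} \<times> {0::nat}" and ?G = "{m} \<times> {1..N}"
  have H: "finite ?H" "?H \<noteq> {}" "card ?H = m" using m by (auto simp: card_cartesian_product lessThan_empty_iff)
  interpret M: prob_space ?M by (rule prob_space_gaussian)
  have "ennreal (exp (lam\<^sup>2 / 2)) * emeasure ?M (kernel_hits m N C) \<le> (\<integral>\<^sup>+z. ennreal (exp (- lam * vec_norm ?H z)) \<partial>gaussian ?H)
      * (\<integral>\<^sup>+g. ennreal (exp (lam * sqrt (\<Sum>l\<in>?G. (max 0 (s (snd l) * g l - t (snd l)))\<^sup>2))) \<partial>gaussian ?G)"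
  proof (rule emeasure_kernel_hits_le[OF lam])
    show "- row_dot N x g m \<le> sqrt (\<Sum>l\<in>?G. (max 0 (s (snd l) * g l - t (snd l)))\<^sup>2)" if "x \<in> C" for g x
      using B[OF that, of "\<lambda>j. g (m, j)"] by (simp only: sum_row_sq snd_conv)
  qed
  also have "\<dots> \<le> ennreal (exp (lam\<^sup>2 / 2 - lam * sqrt (real (m - 1)))) * ennreal (exp (lam\<^sup>2 / 2 + lam * sqrt \<delta>))"
  proof (rule mult_mono)
    show "(\<integral>\<^sup>+z. ennreal (exp (- lam * vec_norm ?H z)) \<partial>gaussian ?H) \<le> ennreal (exp (lam\<^sup>2 / 2 - lam * sqrt (real (m - 1))))"
      using nn_integral_exp_neg_norm_le[OF H(1,2) lam] by (simp only: H(3))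
    show "(\<integral>\<^sup>+g. ennreal (exp (lam * sqrt (\<Sum>l\<in>?G. (max 0 (s (snd l) * g l - t (snd l)))\<^sup>2))) \<partial>gaussian ?G) \<le> ennreal (exp (lam\<^sup>2 / 2 + lam * sqrt \<delta>))"
    proof (rule nn_integral_exp_sqrt_trunc_squares_le[where s = "\<lambda>l. s (snd l)" and t = "\<lambda>l. t (snd l)", OF _ _ lam \<delta>(1)])
      show "(\<Sum>l\<in>?G. gauss_tail2 (t (snd l))) \<le> \<delta>" using \<delta>(2) by (simp only: sum_row_sq snd_conv)
      show "s (snd l) = 1 \<or> s (snd l) = - 1" if "l \<in> ?G" for l
        using that by (intro s) auto
    qed simp
  qed auto
  finally have "ennreal (exp (lam\<^sup>2 / 2) * measure ?M (kernel_hits m N C))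
      \<le> ennreal (exp (lam\<^sup>2 / 2 - lam * sqrt (real (m - 1))) * exp (lam\<^sup>2 / 2 + lam * sqrt \<delta>))"
    by (simp only: M.emeasure_eq_measure ennreal_mult'[OF exp_ge_zero])
  then have "exp (lam\<^sup>2 / 2) * measure ?M (kernel_hits m N C) \<le> exp (lam\<^sup>2 / 2 - lam * sqrt (real (m - 1))) * exp (lam\<^sup>2 / 2 + lam * sqrt \<delta>)"
    by (subst (asm) ennreal_le_iff) auto
  also have "\<dots> = exp (lam\<^sup>2 / 2) * exp (lam\<^sup>2 / 2 - lam * (sqrt (real (m - 1)) - sqrt \<delta>))"
    by (simp add: algebra_simps flip: exp_add)
  finally show ?thesis by simp
qed

end

subsection \<open>The descent cone of the binary program\<close>

definition descent_sphere :: "nat \<Rightarrow> nat set \<Rightarrow> (nat \<Rightarrow> real) set" where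
  "descent_sphere N K = {x. is_vec N x \<and> (\<forall>i\<in>K. x i \<le> 0) \<and> (\<forall>i\<in>{1..N} - K. 0 \<le> x i)
     \<and> (\<Sum>i=1..N. x i) \<le> 0 \<and> (\<Sum>i=1..N. (x i)\<^sup>2) = 1}"

lemma abs_le_1_of_sum_sq:
  fixes x :: "nat \<Rightarrow> real"
  assumes "(\<Sum>i=1..N. (x i)\<^sup>2) = 1" "i \<in> {1..N}"
  shows "\<bar>x i\<bar> \<le> 1"
proof -
  have "(x i)\<^sup>2 \<le> (\<Sum>i=1..N. (x i)\<^sup>2)" using assms(2) by (intro member_le_sum) auto
  then show ?thesis using assms(1) by (simp add: abs_square_le_1)
qed

text \<open>Coordinates outside \<open>{1..N}\<close> are pinned to 0, so the set is a closed part
  of a product of intervals and single points, compact by Tychonoff in the product topology on all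
  functions.\<close>

lemma compact_descent_sphere: "compact (descent_sphere N K)"
proof -
  define box :: "(nat \<Rightarrow> real) set" where "box = PiE UNIV (\<lambda>i. if i \<in> {1..N} then {- 1..1} else {0})"
  have "compactin (product_topology (\<lambda>_. euclidean) UNIV) box"
    unfolding box_def by (subst compactin_PiE) auto
  then have box: "compact box"
    by (simp only: euclidean_product_topology compactin_euclidean_iff)
  define S :: "(nat \<Rightarrow> real) set" where
    "S = (\<Inter>i\<in>K. {x. x i \<le> 0}) \<inter> (\<Inter>i\<in>{1..N} - K. {x. 0 \<le> x i}) \<inter> {x. (\<Sum>i=1..N. x i) \<le> 0} \<inter> {x. (\<Sum>i=1..N. (x i)\<^sup>2) = 1}"
  have "closed S"
    unfolding S_def
    by (intro closed_Int closed_INT ballI closed_Collect_le closed_Collect_eq continuous_intros continuous_on_coordinate)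
  moreover have "descent_sphere N K = box \<inter> S"
  proof -
    have "x \<in> box" if "x \<in> descent_sphere N K" for x
      using that abs_le_1_of_sum_sq[of x N] by (auto simp: box_def descent_sphere_def is_vec_def abs_le_iff)
    moreover have "is_vec N x" if "x \<in> box" for x
      using that by (auto simp: box_def is_vec_def PiE_def Pi_def split: if_splits)
    ultimately show ?thesis by (auto simp: descent_sphere_def S_def)
  qed
  ultimately show ?thesis using compact_Int_closed[OF box] by simp
qed

lemma mat_vec_gauss_eq_iff:
  assumes "m > 0"
  shows "mat_vec m N (gauss_matrix m a) x = mat_vec m N (gauss_matrix m a) y
    \<longleftrightarrow> (\<forall>i<m. (\<Sum>j=1..N. (x j - y j) * a (i, j)) = 0)"
proof -
  have r: "sqrt (real m) \<noteq> 0" using assms by simp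
  have alg: "u / d * v - u / d * w = (v - w) * u / d" for u v w d :: real
    by (simp add: algebra_simps diff_divide_distrib)
  have diff_iff: "u = v \<longleftrightarrow> w = 0" if "u - v = w / sqrt (real m)" for u v w
    using that r by auto
  have "(\<Sum>j=1..N. gauss_matrix m a (i, j) * x j) = (\<Sum>j=1..N. gauss_matrix m a (i, j) * y j)
      \<longleftrightarrow> (\<Sum>j=1..N. (x j - y j) * a (i, j)) = 0" for i
  proof -
    have "(\<Sum>j=1..N. gauss_matrix m a (i, j) * x j) - (\<Sum>j=1..N. gauss_matrix m a (i, j) * y j)
        = (\<Sum>j=1..N. (x j - y j) * a (i, j)) / sqrt (real m)"
      unfolding sum_subtractf[symmetric] sum_divide_distrib
      by (intro sum.cong refl) (simp only: gauss_matrix_def alg)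
    then show ?thesis by (rule diff_iff)
  qed
  then show ?thesis by (auto simp: mat_vec_def fun_eq_iff)
qed

text \<open>On the box the l1 norm is the plain sum, hence linear. A unit kernel vector with the
  right signs has entries of modulus at most 1, so adding it to the binary vector stays in the box
  without rescaling; conversely, the difference to a competitor that is no worse can be
  normalised.\<close>

lemma Pbin_unique_iff:
  assumes m: "m > 0" and K: "K \<subseteq> {1..N}"
  shows "Pbin_unique_solution m N (gauss_matrix m a) (mat_vec m N (gauss_matrix m a) (ind_vec K)) (ind_vec K)
    \<longleftrightarrow> \<not> (\<exists>x\<in>descent_sphere N K. \<forall>i<m. row_dot N x a i = 0)"
proof -
  define z where "z = ind_vec K"
  have z: "z i = (if i \<in> K then 1 else 0)" for i by (simp add: z_def ind_vec_def)
  have feas: "Pbin_feasible m N (gauss_matrix m a) (mat_vec m N (gauss_matrix m a) z) x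
      \<longleftrightarrow> is_vec N x \<and> (\<forall>i<m. (\<Sum>j=1..N. (x j - z j) * a (i, j)) = 0) \<and> (\<forall>i\<in>{1..N}. 0 \<le> x i \<and> x i \<le> 1)" for x
    unfolding Pbin_feasible_def mat_vec_gauss_eq_iff[OF m] by blast
  have zvec: "is_vec N z" using K by (auto simp: is_vec_def z)
  have feas_z: "Pbin_feasible m N (gauss_matrix m a) (mat_vec m N (gauss_matrix m a) z) z"
    unfolding feas using zvec by (auto simp: z)
  have l1: "l1norm N x = (\<Sum>i=1..N. x i)" if "\<forall>i\<in>{1..N}. 0 \<le> x i \<and> x i \<le> 1" for x
    using that by (auto simp: l1norm_def intro!: sum.cong)
  have l1z: "l1norm N z = (\<Sum>i=1..N. z i)" by (rule l1) (auto simp: z)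
  have "Pbin_unique_solution m N (gauss_matrix m a) (mat_vec m N (gauss_matrix m a) z) z
    \<longleftrightarrow> \<not> (\<exists>x\<in>descent_sphere N K. \<forall>i<m. row_dot N x a i = 0)" (is "?U \<longleftrightarrow> \<not> ?E")
  proof
    assume U: ?U
    show "\<not> ?E"
    proof
      assume ?E
      then obtain x where x: "x \<in> descent_sphere N K" "\<forall>i<m. row_dot N x a i = 0" by blast
      define y where "y i = z i + x i" for i
      have abs: "\<bar>x i\<bar> \<le> 1" if "i \<in> {1..N}" for i
        using x(1) that by (intro abs_le_1_of_sum_sq) (auto simp: descent_sphere_def)
      have y01: "\<forall>i\<in>{1..N}. 0 \<le> y i \<and> y i \<le> 1"
      proof
        fix i assume i: "i \<in> {1..N}"
        show "0 \<le> y i \<and> y i \<le> 1"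
          using x(1) abs[OF i] i by (cases "i \<in> K") (auto simp: y_def z descent_sphere_def abs_le_iff)
      qed
      have "Pbin_feasible m N (gauss_matrix m a) (mat_vec m N (gauss_matrix m a) z) y"
        unfolding feas using x y01 zvec by (auto simp: y_def is_vec_def descent_sphere_def)
      moreover have "y \<noteq> z"
      proof
        assume "y = z"
        then have "x i = 0" for i by (simp add: y_def fun_eq_iff)
        then show False using x(1) by (simp add: descent_sphere_def)
      qed
      ultimately have "l1norm N z < l1norm N y"
        using U by (simp add: Pbin_unique_solution_def)
      then have "(\<Sum>i=1..N. z i) < (\<Sum>i=1..N. y i)"
        by (simp only: l1[OF y01] l1z)
      then show False using x(1) by (simp add: y_def sum.distrib descent_sphere_def)
    qed
  next
    assume nE: "\<not> ?E"
    have "l1norm N z < l1norm N x"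
      if x: "Pbin_feasible m N (gauss_matrix m a) (mat_vec m N (gauss_matrix m a) z) x" and ne: "x \<noteq> z" for x
    proof (rule ccontr)
      assume le: "\<not> l1norm N z < l1norm N x"
      have x': "is_vec N x" "\<And>i. i < m \<Longrightarrow> (\<Sum>j=1..N. (x j - z j) * a (i, j)) = 0" "\<forall>i\<in>{1..N}. 0 \<le> x i \<and> x i \<le> 1"
        using x unfolding feas by auto
      define r where "r = sqrt (\<Sum>i=1..N. (x i - z i)\<^sup>2)"
      obtain k where k: "x k \<noteq> z k" using ne by auto
      have "x i = z i" if "i \<notin> {1..N}" for i
        using x'(1) zvec that unfolding is_vec_def by metis
      then have kN: "k \<in> {1..N}" using k by blast
      have "0 < (x k - z k)\<^sup>2" using k by simp
      also have "\<dots> \<le> (\<Sum>i=1..N. (x i - z i)\<^sup>2)" using kN by (intro member_le_sum) auto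
      finally have r: "r > 0" "r\<^sup>2 = (\<Sum>i=1..N. (x i - z i)\<^sup>2)" by (auto simp: r_def)
      define y where "y i = (x i - z i) / r" for i
      have "(\<Sum>i=1..N. (y i)\<^sup>2) = (\<Sum>i=1..N. (x i - z i)\<^sup>2) / r\<^sup>2"
        by (simp only: y_def power_divide sum_divide_distrib)
      also have "\<dots> = 1" using r(1) by (simp only: r(2)[symmetric]) simp
      finally have "(\<Sum>i=1..N. (y i)\<^sup>2) = 1" .
      moreover have "(\<Sum>i=1..N. y i) \<le> 0"
      proof -
        have "(\<Sum>i=1..N. y i) = ((\<Sum>i=1..N. x i) - (\<Sum>i=1..N. z i)) / r"
          by (simp add: y_def sum_subtractf flip: sum_divide_distrib)
        then show ?thesis using le r(1) unfolding l1[OF x'(3)] l1z by (simp add: divide_nonpos_pos)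
      qed
      moreover have "is_vec N y" using x'(1) zvec by (auto simp: is_vec_def y_def)
      moreover have "\<forall>i\<in>K. y i \<le> 0"
      proof
        fix i assume "i \<in> K"
        then have "x i - z i \<le> 0" using x'(3) K by (auto simp: z)
        then show "y i \<le> 0" using r(1) by (simp add: y_def divide_nonpos_pos)
      qed
      moreover have "\<forall>i\<in>{1..N} - K. 0 \<le> y i"
        using x'(3) r(1) by (auto simp: y_def z)
      ultimately have "y \<in> descent_sphere N K" by (simp add: descent_sphere_def)
      moreover have "(\<Sum>j=1..N. y j * a (i, j)) = 0" if "i < m" for i
      proof -
        have "(\<Sum>j=1..N. y j * a (i, j)) = (\<Sum>j=1..N. (x j - z j) * a (i, j)) / r"
          by (simp add: y_def sum_divide_distrib)
        then show ?thesis using x'(2)[OF that] by simp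
      qed
      ultimately show False using nE by blast
    qed
    then show ?U using feas_z by (simp add: Pbin_unique_solution_def)
  qed
  then show ?thesis by (simp only: z_def)
qed

text \<open>\<open>\<tau>\<close> is a Lagrange multiplier for the constraint that the coordinate
  sum is at most 0: subtracting \<open>\<tau>\<close> times that sum can only increase the left
  side. The sign constraints then keep only positive parts, and Cauchy-Schwarz ends the
  argument.\<close>

lemma descent_sphere_support_le:
  fixes y :: "nat \<Rightarrow> real"
  assumes x: "x \<in> descent_sphere N K" and \<tau>: "\<tau> \<ge> 0"
  shows "- (\<Sum>j=1..N. x j * y j) \<le> sqrt (\<Sum>j=1..N. (max 0 ((if j \<in> K then 1 else - 1) * y j - (if j \<in> K then - \<tau> else \<tau>)))\<^sup>2)"
proof -
  define c where "c j = max 0 ((if j \<in> K then 1 else - 1) * y j - (if j \<in> K then - \<tau> else \<tau>))" for j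
  have x': "(\<Sum>j=1..N. x j) \<le> 0" "(\<Sum>j=1..N. (x j)\<^sup>2) = 1" "\<And>j. j \<in> K \<Longrightarrow> x j \<le> 0"
      "\<And>j. j \<in> {1..N} - K \<Longrightarrow> 0 \<le> x j"
    using x by (auto simp: descent_sphere_def)
  have "- (\<Sum>j=1..N. x j * y j) \<le> - (\<Sum>j=1..N. x j * y j) + - (\<tau> * (\<Sum>j=1..N. x j))"
    using \<tau> x'(1) by (simp add: mult_nonneg_nonpos)
  also have "\<dots> = - (\<Sum>j=1..N. x j * (y j + \<tau>))"
    by (simp add: sum_distrib_left sum.distrib algebra_simps)
  also have "\<dots> \<le> (\<Sum>j=1..N. \<bar>x j\<bar> * c j)"
    unfolding sum_negf[symmetric]
  proof (rule sum_mono)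
    fix j assume j: "j \<in> {1..N}"
    show "- (x j * (y j + \<tau>)) \<le> \<bar>x j\<bar> * c j"
    proof (cases "j \<in> K")
      case True
      then have "- (x j * (y j + \<tau>)) = \<bar>x j\<bar> * (y j + \<tau>)" using x'(3)[of j] by (simp add: abs_if)
      also have "\<dots> \<le> \<bar>x j\<bar> * c j" using True by (intro mult_left_mono) (auto simp: c_def)
      finally show ?thesis .
    next
      case False
      then have "- (x j * (y j + \<tau>)) = \<bar>x j\<bar> * (- y j - \<tau>)" using x'(4)[of j] j by (simp add: abs_if algebra_simps)
      also have "\<dots> \<le> \<bar>x j\<bar> * c j" using False by (intro mult_left_mono) (auto simp: c_def)
      finally show ?thesis .
    qed
  qed
  also have "\<dots> \<le> sqrt (\<Sum>j=1..N. (c j)\<^sup>2)"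
    by (rule sum_abs_mult_le_sqrt[OF x'(2)])
  finally show ?thesis by (simp only: c_def)
qed

section \<open>The objective under the infimum and its relation to truncated second moments\<close>

definition bin_objective :: "nat \<Rightarrow> nat \<Rightarrow> real \<Rightarrow> real" where
  "bin_objective N k \<tau> = real k * (LINT u:{..\<tau>}|lborel. (u - \<tau>)\<^sup>2 * gauss_pdf u)
    + real (N - k) * (LINT u:{\<tau>..}|lborel. (u - \<tau>)\<^sup>2 * gauss_pdf u)"

text \<open>Passing through \<open>ennreal\<close>, the integral equals the positive part of the
  closed form, which gives this inequality without first settling the sign of
  \<open>gauss_tail2\<close>.\<close>

lemma gauss_tail2_le_LINT_atLeast: "gauss_tail2 \<tau> \<le> (LINT u:{\<tau>..}|lborel. (u - \<tau>)\<^sup>2 * gauss_pdf u)"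
proof -
  have "(LINT u:{\<tau>..}|lborel. (u - \<tau>)\<^sup>2 * gauss_pdf u)
      = enn2real (\<integral>\<^sup>+u. ennreal (indicator {\<tau>..} u *\<^sub>R ((u - \<tau>)\<^sup>2 * gauss_pdf u)) \<partial>lborel)"
    unfolding set_lebesgue_integral_def by (rule integral_eq_nn_integral) auto
  also have "(\<integral>\<^sup>+u. ennreal (indicator {\<tau>..} u *\<^sub>R ((u - \<tau>)\<^sup>2 * gauss_pdf u)) \<partial>lborel)
      = (\<integral>\<^sup>+u. ennreal ((u - \<tau>)\<^sup>2 * gauss_pdf u) * indicator {\<tau>..} u \<partial>lborel)"
    by (intro nn_integral_cong) (auto simp: indicator_def)
  also have "\<dots> = ennreal (gauss_tail2 \<tau>)" by (rule nn_integral_gauss_tail2)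
  finally show ?thesis
    by (cases "0 \<le> gauss_tail2 \<tau>") (auto intro: order_trans[of _ 0])
qed

lemma LINT_atMost_eq_atLeast:
  "(LINT u:{..\<tau>}|lborel. (u - \<tau>)\<^sup>2 * gauss_pdf u) = (LINT u:{- \<tau>..}|lborel. (u - - \<tau>)\<^sup>2 * gauss_pdf u)"
proof -
  have "(LINT u:{..\<tau>}|lborel. (u - \<tau>)\<^sup>2 * gauss_pdf u)
      = (LINT u|lborel. indicator {..\<tau>} (0 + - 1 * u) *\<^sub>R ((0 + - 1 * u - \<tau>)\<^sup>2 * gauss_pdf (0 + - 1 * u)))"
    unfolding set_lebesgue_integral_def
    using lborel_integral_real_affine[of "- 1" "\<lambda>u. indicator {..\<tau>} u *\<^sub>R ((u - \<tau>)\<^sup>2 * gauss_pdf u)" 0] by simp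
  also have "\<dots> = (LINT u:{- \<tau>..}|lborel. (u - - \<tau>)\<^sup>2 * gauss_pdf u)"
    unfolding set_lebesgue_integral_def
    by (intro Bochner_Integration.integral_cong) (auto simp: indicator_def std_normal_density_def power2_eq_square algebra_simps)
  finally show ?thesis .
qed

lemma LINT_square_std_normal_le_1:
  assumes "A \<in> sets borel"
  shows "(LINT u:A|lborel. (u - 0)\<^sup>2 * gauss_pdf u) \<le> 1"
proof -
  have int: "integrable lborel (\<lambda>u. gauss_pdf u * u ^ (2 * 1))"
    using integrable_std_normal_moment[of 2] by simp
  have "(LINT u:A|lborel. (u - 0)\<^sup>2 * gauss_pdf u) \<le> (LINT u|lborel. gauss_pdf u * u ^ (2 * 1))"
    unfolding set_lebesgue_integral_def
  proof (rule integral_mono[OF _ int])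
    show "integrable lborel (\<lambda>u. indicator A u *\<^sub>R ((u - 0)\<^sup>2 * gauss_pdf u))"
      by (rule Bochner_Integration.integrable_bound[OF int]) (use assms in \<open>auto simp: indicator_def mult.commute\<close>)
    show "indicator A u *\<^sub>R ((u - 0)\<^sup>2 * gauss_pdf u) \<le> gauss_pdf u * u ^ (2 * 1)" for u
      by (auto simp: indicator_def mult.commute)
  qed
  also have "\<dots> = 1"
    by (subst integral_std_normal_moment_even) (simp add: fact_numeral)
  finally show ?thesis .
qed

lemma bin_objective_nonneg: "bin_objective N k \<tau> \<ge> 0"
  unfolding bin_objective_def set_lebesgue_integral_def
  by (intro add_nonneg_nonneg mult_nonneg_nonneg Bochner_Integration.integral_nonneg) auto

lemma Delta_bin_eq: "Delta_bin N k = (INF \<tau>\<in>{0..}. bin_objective N k \<tau>)"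
  by (simp only: Delta_bin_def bin_objective_def)

lemma Delta_bin_nonneg: "Delta_bin N k \<ge> 0"
  unfolding Delta_bin_eq by (intro cINF_greatest bin_objective_nonneg) auto

text \<open>At \<open>\<tau> = 0\<close> each integral is at most the second moment 1. The bound
  keeps \<open>sqrt m + sqrt \<Delta>\<close> below \<open>2 * sqrt N\<close> when
  \<open>m \<le> N\<close>.\<close>

lemma Delta_bin_le:
  assumes "k \<le> N"
  shows "Delta_bin N k \<le> real N"
proof -
  have "Delta_bin N k \<le> bin_objective N k 0"
    unfolding Delta_bin_eq by (intro cINF_lower bdd_belowI2[of _ 0] bin_objective_nonneg) auto
  also have "\<dots> \<le> real k * 1 + real (N - k) * 1"
    unfolding bin_objective_def by (intro add_mono mult_left_mono LINT_square_std_normal_le_1) auto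
  also have "\<dots> = real N" using assms by simp
  finally show ?thesis .
qed

lemma ex_bin_objective_less:
  assumes "Delta_bin N k < \<delta>"
  obtains \<tau> where "\<tau> \<ge> 0" "bin_objective N k \<tau> < \<delta>"
  using assms cInf_lessD[of "bin_objective N k ` {0..}" \<delta>] unfolding Delta_bin_eq by auto

text \<open>Reflecting \<open>u\<close> turns the integral over \<open>{..\<tau>}\<close> into a
  tail integral with threshold \<open>- \<tau>\<close>, hence the negative threshold on
  \<open>K\<close>.\<close>

lemma sum_gauss_tail2_le_objective:
  assumes K: "K \<subseteq> {1..N}"
  shows "(\<Sum>j=1..N. gauss_tail2 (if j \<in> K then - \<tau> else \<tau>)) \<le> bin_objective N (card K) \<tau>"
proof -
  have fK: "finite K" using K by (rule finite_subset) simp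
  have "(\<Sum>j=1..N. gauss_tail2 (if j \<in> K then - \<tau> else \<tau>)) = (\<Sum>j\<in>K. gauss_tail2 (- \<tau>)) + (\<Sum>j\<in>{1..N} - K. gauss_tail2 \<tau>)"
    by (subst sum.subset_diff[OF K]) auto
  also have "\<dots> = real (card K) * gauss_tail2 (- \<tau>) + real (N - card K) * gauss_tail2 \<tau>"
    using K fK by (simp add: card_Diff_subset)
  also have "\<dots> \<le> bin_objective N (card K) \<tau>"
    unfolding bin_objective_def LINT_atMost_eq_atLeast[of \<tau>]
    by (intro add_mono mult_left_mono gauss_tail2_le_LINT_atLeast) auto
  finally show ?thesis .
qed

text \<open>The infimum need not be attained and may be 0, while the tail bounds want a strictly
  positive \<open>\<delta>\<close> above some value of the objective. So the estimate is made for
  every \<open>\<delta> > \<Delta>\<close> and then \<open>\<delta>\<close> decreases to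
  \<open>\<Delta>\<close>.\<close>

lemma measure_kernel_hits_descent_le:
  assumes m: "m > 0" and K: "K \<subseteq> {1..N}" and lam: "lam > 0"
  shows "measure (matrix_law m N) (kernel_hits m N (descent_sphere N K))
    \<le> exp (lam\<^sup>2 / 2 - lam * (sqrt (real (m - 1)) - sqrt (Delta_bin N (card K))))"
proof -
  define \<Delta> where "\<Delta> = Delta_bin N (card K)"
  have unit: "(\<Sum>j=1..N. (x j)\<^sup>2) = 1" if "x \<in> descent_sphere N K" for x
    using that by (simp add: descent_sphere_def)
  let ?P = "measure (matrix_law m N) (kernel_hits m N (descent_sphere N K))"
  let ?f = "\<lambda>\<delta>. exp (lam\<^sup>2 / 2 - lam * (sqrt (real (m - 1)) - sqrt \<delta>))"
  have le: "?P \<le> ?f \<delta>" if \<delta>: "\<delta> > \<Delta>" for \<delta>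
  proof -
    obtain \<tau> where \<tau>: "\<tau> \<ge> 0" "bin_objective N (card K) \<tau> < \<delta>"
      using ex_bin_objective_less \<delta> unfolding \<Delta>_def by blast
    have \<delta>0: "\<delta> > 0" using \<delta> Delta_bin_nonneg[of N "card K"] by (simp add: \<Delta>_def)
    have sum: "(\<Sum>j=1..N. gauss_tail2 (if j \<in> K then - \<tau> else \<tau>)) \<le> \<delta>"
      using sum_gauss_tail2_le_objective[OF K, of \<tau>] \<tau>(2) by linarith
    show ?thesis
      by (rule measure_kernel_hits_le[OF compact_descent_sphere unit m lam \<delta>0 sum,
            where s = "\<lambda>j. if j \<in> K then 1 else - 1"])
         (assumption, simp, rule descent_sphere_support_le[OF _ \<tau>(1)])
  qed
  have "(\<lambda>n. ?f (\<Delta> + 1 / real (Suc n))) \<longlonglongrightarrow> ?f (\<Delta> + 0)"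
    by (intro tendsto_intros LIMSEQ_Suc[OF lim_1_over_real])
  then have "?P \<le> ?f (\<Delta> + 0)"
    by (rule LIMSEQ_le_const) (use le in auto)
  then show ?thesis by (simp add: \<Delta>_def)
qed

text \<open>\<open>s\<close> minimises
  \<open>lam\<^sup>2 / 2 - lam * (sqrt m - sqrt \<Delta>)\<close>, with value
  \<open>- s\<^sup>2 / 2\<close>. Having \<open>sqrt (m - 1)\<close> in place of
  \<open>sqrt m\<close> adds \<open>s * (sqrt m - sqrt (m - 1)) \<le> m - (m - 1) = 1\<close>, and
  \<open>t \<le> s * (2 * sqrt N)\<close> gives
  \<open>s\<^sup>2 / 2 \<ge> t\<^sup>2 / (8 * N)\<close>.\<close>

lemma deviation_exponent_bound:
  fixes m N :: nat and \<Delta> t :: real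
  assumes m: "0 < m" "m \<le> N" and \<Delta>: "0 \<le> \<Delta>" "\<Delta> \<le> real N" and t: "t > 0" "real m \<ge> \<Delta> + t"
  defines "s \<equiv> sqrt (real m) - sqrt \<Delta>"
  shows "s > 0" "s\<^sup>2 / 2 - s * (sqrt (real (m - 1)) - sqrt \<Delta>) \<le> 1 - t\<^sup>2 / (8 * real N)"
proof -
  have sd: "sqrt \<Delta> < sqrt (real m)" using t by simp
  then show s: "s > 0" by (simp add: s_def)
  have "s * (sqrt (real m) + sqrt \<Delta>) = real m - \<Delta>"
    using \<Delta> by (simp add: s_def algebra_simps flip: power2_eq_square)
  then have "t \<le> s * (sqrt (real m) + sqrt \<Delta>)" using t by linarith
  also have "\<dots> \<le> s * (2 * sqrt (real N))"
    using s m \<Delta> by (intro mult_left_mono) (auto intro: add_mono[of "sqrt (real m)" "sqrt (real N)" "sqrt \<Delta>" "sqrt (real N)", simplified])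
  finally have "t\<^sup>2 \<le> (s * (2 * sqrt (real N)))\<^sup>2" using t by (intro power_mono) auto
  also have "\<dots> = 4 * real N * s\<^sup>2" by (simp add: power_mult_distrib)
  finally have "t\<^sup>2 / (8 * real N) \<le> s\<^sup>2 / 2" using m by (simp add: field_simps)
  moreover have "s * (sqrt (real m) - sqrt (real (m - 1))) \<le> 1"
  proof -
    have mono: "sqrt (real (m - 1)) \<le> sqrt (real m)" by simp
    have "s * (sqrt (real m) - sqrt (real (m - 1))) \<le> sqrt (real m) * (sqrt (real m) - sqrt (real (m - 1)))"
      using \<Delta> mono by (intro mult_right_mono) (auto simp: s_def)
    also have "\<dots> \<le> real m - real (m - 1)"
      using mult_right_mono[OF mono, of "sqrt (real (m - 1))"] by (simp add: right_diff_distrib)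
    also have "\<dots> = 1" using m by simp
    finally show ?thesis .
  qed
  moreover have "s\<^sup>2 / 2 - s * (sqrt (real (m - 1)) - sqrt \<Delta>) = s * (sqrt (real m) - sqrt (real (m - 1))) - s\<^sup>2 / 2"
    by (simp add: s_def power2_eq_square algebra_simps)
  ultimately show "s\<^sup>2 / 2 - s * (sqrt (real (m - 1)) - sqrt \<Delta>) \<le> 1 - t\<^sup>2 / (8 * real N)" by linarith
qed

theorem theorem2p7:
  fixes \<epsilon> :: real and m N :: nat and K :: "nat set"
  assumes "\<epsilon> > 0"
    and "K \<subseteq> {1..N}"
    and "real m \<ge> Delta_bin N (card K) + sqrt (8 * ln (4 / \<epsilon>) * real N)"
  shows "prob_space.prob (gauss_entries m N)
           {a \<in> space (gauss_entries m N).
              Pbin_unique_solution m N (gauss_matrix m a)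
                (mat_vec m N (gauss_matrix m a) (ind_vec K)) (ind_vec K)} > 1 - \<epsilon>"
proof -
  define M where "M = gauss_entries m N"
  have M: "M = matrix_law m N" by (simp add: M_def gauss_entries_def)
  interpret M: prob_space M unfolding M by (rule prob_space_gaussian)
  define G where "G = {a \<in> space M. Pbin_unique_solution m N (gauss_matrix m a)
                (mat_vec m N (gauss_matrix m a) (ind_vec K)) (ind_vec K)}"
  have "measure M G > 1 - \<epsilon>"
  proof -
    \<comment> \<open>For \<open>\<epsilon> > 1\<close> a probability is trivially above
      \<open>1 - \<epsilon>\<close>, and for \<open>N = 0\<close> there is only one vector.
      Otherwise \<open>ln (4 / \<epsilon>)\<close> and \<open>t\<close> are positive, which forces
      \<open>m > 0\<close>.\<close>
    consider "\<epsilon> > 1" | "N = 0" | "\<epsilon> \<le> 1" "N > 0" by linarith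
    then show ?thesis
    proof cases
      case 1
      then show ?thesis using measure_nonneg[of M G] by linarith
    next
      case 2
      then have K: "K = {}" using assms(2) by simp
      have "G = space M"
        unfolding G_def K 2 by (auto simp: Pbin_unique_solution_def Pbin_feasible_def is_vec_def ind_vec_def fun_eq_iff)
      then show ?thesis using assms(1) M.prob_space by simp
    next
      case 3
      define \<Delta> where "\<Delta> = Delta_bin N (card K)"
      define t where "t = sqrt (8 * ln (4 / \<epsilon>) * real N)"
      have cardK: "card K \<le> N" using card_mono[OF _ assms(2)] by simp
      have \<Delta>: "0 \<le> \<Delta>" "\<Delta> \<le> real N"
        unfolding \<Delta>_def by (rule Delta_bin_nonneg, rule Delta_bin_le[OF cardK])
      have ln: "ln (4 / \<epsilon>) > 0" using 3 assms(1) by simp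
      have t: "t > 0" "t\<^sup>2 = 8 * ln (4 / \<epsilon>) * real N" using ln 3 by (auto simp: t_def)
      have mt: "real m \<ge> \<Delta> + t" using assms(3) by (simp add: \<Delta>_def t_def)
      then have m: "m > 0" using \<Delta>(1) t(1) by (cases m) auto
      have unit: "(\<Sum>j=1..N. (x j)\<^sup>2) = 1" if "x \<in> descent_sphere N K" for x
        using that by (simp add: descent_sphere_def)
      define F where "F = kernel_hits m N (descent_sphere N K)"
      have F_sets: "F \<in> sets M"
        unfolding F_def M by (rule sets_kernel_hits[OF compact_descent_sphere unit])
      have "G = space M - F"
        unfolding G_def F_def kernel_hits_def Pbin_unique_iff[OF m assms(2)] M by blast
      then have G: "measure M G = 1 - measure M F"
        using M.prob_compl[OF F_sets] by simp
      have "measure M F < \<epsilon>"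
      proof (cases "m \<le> N")
        case False
        then have "emeasure M F = 0"
          unfolding F_def M using 3 by (intro emeasure_kernel_hits_eq_0[OF compact_descent_sphere unit]) auto
        then show ?thesis using assms(1) by (simp add: measure_def)
      next
        case True
        define s where "s = sqrt (real m) - sqrt \<Delta>"
        note s = deviation_exponent_bound[OF m True \<Delta> t(1) mt, folded s_def]
        have "measure M F \<le> exp (s\<^sup>2 / 2 - s * (sqrt (real (m - 1)) - sqrt \<Delta>))"
          unfolding F_def M \<Delta>_def by (rule measure_kernel_hits_descent_le[OF m assms(2) s(1)])
        also have "\<dots> \<le> exp (1 - t\<^sup>2 / (8 * real N))" using s(2) by simp
        also have "t\<^sup>2 / (8 * real N) = ln (4 / \<epsilon>)" using t(2) 3 by simp
        \<comment> \<open>Here the 4 under the logarithm pays for the lost 1 in the exponent, since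
          \<open>exp 1 \<le> 3 < 4\<close>; this also makes the final inequality strict.\<close>
        also have "exp (1 - ln (4 / \<epsilon>)) = exp 1 * \<epsilon> / 4"
          using assms(1) by (simp add: exp_diff)
        also have "\<dots> < \<epsilon>" using exp_le assms(1) by (simp add: mult.commute[of _ \<epsilon>] pos_less_divide_eq)
        finally show ?thesis .
      qed
      then show ?thesis using G by simp
    qed
  qed
  then show ?thesis by (simp only: G_def M_def)
qed

end
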